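(* There is a (deterministic) algorithm for Structural Partial Grundy Coloring running in time $2^{\mathcal{O}(k^2 d)}\cdot 2^{\ell k+k^2\log k}\cdot n^{\mathcal{O}(1)}$, where $n=|V(G)|$.
   Context: Structural Partial Grundy Coloring: the input consists of positive integers $k,d,\ell$, a graph $G$, and $\ell$ subgraphs $A_1,\dots,A_\ell$ of $G$, each a biclique (bipartite with nonempty sides $L_t,R_t$ and all edges between them), such that $G-F$ is $d$-degenerate, where $F$ is the union of the edge sets of the $A_t$ and $G-F=(V(G),E(G)\setminus F)$. The question is whether $G$ admits a partial Grundy coloring using at least $k$ colors. A graph is $d$-degenerate if every subgraph has a vertex of degree at most $d$. A partial Grundy coloring of $G$ using $k'$ colors is a proper coloring $c:V(G)\to[k']$ such that for every $i\in[k']$ there is a vertex $v$ with $c(v)=i$ which, for every $j\in[i-1]$, has a neighbor $u$ with $c(u)=j$; "using at least $k$ colors" means for some $k'\ge k$. *)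

theory Defs
  imports Complex_Main "HOL-Library.Discrete_Functions"
begin

section \<open>Graphs\<close>

record 'a ugraph =
  verts :: "'a set"
  edges :: "'a set set"

definition simple_graph :: "'a ugraph \<Rightarrow> bool" where
  "simple_graph G \<longleftrightarrow> finite (verts G) \<and> (\<forall>e \<in> edges G. e \<subseteq> verts G \<and> card e = 2)"

definition subgraph :: "'a ugraph \<Rightarrow> 'a ugraph \<Rightarrow> bool" where
  "subgraph H G \<longleftrightarrow> simple_graph H \<and> verts H \<subseteq> verts G \<and> edges H \<subseteq> edges G"

definition degree :: "'a ugraph \<Rightarrow> 'a \<Rightarrow> nat" where
  "degree G v = card {e \<in> edges G. v \<in> e}"

text \<open>The quantification is over subgraphs with at least one vertex; the empty subgraph has no
  vertex at all.\<close>
definition degenerate :: "nat \<Rightarrow> 'a ugraph \<Rightarrow> bool" where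
  "degenerate d G \<longleftrightarrow>
     (\<forall>H. subgraph H G \<and> verts H \<noteq> {} \<longrightarrow> (\<exists>v \<in> verts H. degree H v \<le> d))"

definition biclique :: "'a ugraph \<Rightarrow> bool" where
  "biclique A \<longleftrightarrow>
     (\<exists>L R. L \<noteq> {} \<and> R \<noteq> {} \<and> L \<inter> R = {} \<and> verts A = L \<union> R \<and>
            edges A = {{u, v} | u v. u \<in> L \<and> v \<in> R})"

definition delete_edges :: "'a ugraph \<Rightarrow> 'a set set \<Rightarrow> 'a ugraph" where
  "delete_edges G F = \<lparr>verts = verts G, edges = edges G - F\<rparr>"

definition partial_grundy_coloring :: "'a ugraph \<Rightarrow> nat \<Rightarrow> ('a \<Rightarrow> nat) \<Rightarrow> bool" where
  "partial_grundy_coloring G k c \<longleftrightarrow>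
     (\<forall>v \<in> verts G. c v \<in> {1..k}) \<and>
     (\<forall>u \<in> verts G. \<forall>v \<in> verts G. {u, v} \<in> edges G \<longrightarrow> c u \<noteq> c v) \<and>
     (\<forall>i \<in> {1..k}. \<exists>v \<in> verts G. c v = i \<and>
        (\<forall>j \<in> {1..<i}. \<exists>u \<in> verts G. {u, v} \<in> edges G \<and> c u = j))"


section \<open>Random access machines with logarithmic cost\<close>

text \<open>
  The model of computation is a random access machine with arithmetic on natural numbers and the
  \<^emph>\<open>logarithmic\<close> cost criterion (as in Aho, Hopcroft and Ullman), programmed by structured
  commands.  The memory consists of arrays of unbounded length; a program names finitely many of
  them, and a scalar variable is an array used at index 0 only.  Subtraction is truncated.
\<close>

type_synonym state = "nat \<Rightarrow> nat \<Rightarrow> nat"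

datatype exp =
    Const nat
  | Read nat exp
  | Add exp exp
  | Sub exp exp
  | Mul exp exp
  | Div exp exp

datatype com =
    Skip
  | Write nat exp exp
  | Seq com com
  | If exp com com
  | While exp com

text \<open>Length of the binary representation of a number, where 0 has length 1.\<close>
definition bitlen :: "nat \<Rightarrow> nat" where
  "bitlen n = Suc (floor_log n)"

primrec eval :: "exp \<Rightarrow> state \<Rightarrow> nat" where
  "eval (Const n) s = n"
| "eval (Read a e) s = s a (eval e s)"
| "eval (Add e f) s = eval e s + eval f s"
| "eval (Sub e f) s = eval e s - eval f s"
| "eval (Mul e f) s = eval e s * eval f s"
| "eval (Div e f) s = eval e s div eval f s"

primrec eval_cost :: "exp \<Rightarrow> state \<Rightarrow> nat" where
  "eval_cost (Const n) s = bitlen n"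
| "eval_cost (Read a e) s =
     eval_cost e s + bitlen (eval e s) + bitlen (s a (eval e s))"
| "eval_cost (Add e f) s =
     eval_cost e s + eval_cost f s + bitlen (eval e s) + bitlen (eval f s)"
| "eval_cost (Sub e f) s =
     eval_cost e s + eval_cost f s + bitlen (eval e s) + bitlen (eval f s)"
| "eval_cost (Mul e f) s =
     eval_cost e s + eval_cost f s + bitlen (eval e s) + bitlen (eval f s)"
| "eval_cost (Div e f) s =
     eval_cost e s + eval_cost f s + bitlen (eval e s) + bitlen (eval f s)"

text \<open>\<open>exec P s t s'\<close>: started in memory \<open>s\<close>, the program \<open>P\<close> halts after time \<open>t\<close> with
  memory \<open>s'\<close>.  Conditions count as true if their value is nonzero.\<close>
inductive exec :: "com \<Rightarrow> state \<Rightarrow> nat \<Rightarrow> state \<Rightarrow> bool" where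
  Skip: "exec Skip s 1 s"
| Write: "exec (Write a e f) s
     (eval_cost e s + eval_cost f s + bitlen (eval e s) + bitlen (eval f s))
     (s(a := (s a)(eval e s := eval f s)))"
| Seq: "\<lbrakk>exec P s t s'; exec Q s' t' s''\<rbrakk> \<Longrightarrow> exec (Seq P Q) s (t + t') s''"
| IfTrue: "\<lbrakk>eval e s \<noteq> 0; exec P s t s'\<rbrakk>
     \<Longrightarrow> exec (If e P Q) s (eval_cost e s + bitlen (eval e s) + t) s'"
| IfFalse: "\<lbrakk>eval e s = 0; exec Q s t s'\<rbrakk>
     \<Longrightarrow> exec (If e P Q) s (eval_cost e s + bitlen (eval e s) + t) s'"
| WhileTrue: "\<lbrakk>eval e s \<noteq> 0; exec P s t s'; exec (While e P) s' t' s''\<rbrakk>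
     \<Longrightarrow> exec (While e P) s (eval_cost e s + bitlen (eval e s) + t + t') s''"
| WhileFalse: "eval e s = 0
     \<Longrightarrow> exec (While e P) s (eval_cost e s + bitlen (eval e s)) s"

inductive_cases SkipE: "exec Skip s t s'"
  and WriteE: "exec (Write a e f) s t s'"
  and SeqE: "exec (Seq P Q) s t s'"
  and IfE: "exec (If e P Q) s t s'"
  and WhileE: "exec (While e P) s t s'"

lemma exec_deterministic:
  "exec P s t s' \<Longrightarrow> exec P s u s'' \<Longrightarrow> u = t \<and> s'' = s'"
proof (induction arbitrary: u s'' rule: exec.induct)
  case (Skip s)
  then show ?case by (auto elim: SkipE)
next
  case (Write a e f s)
  then show ?case by (auto elim: WriteE)
next
  case (Seq P s t s' Q t' s'')
  then show ?case by (metis SeqE)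
next
  case (IfTrue e s P t s' Q)
  from IfTrue.prems IfTrue.hyps show ?case by (cases rule: exec.cases) (auto dest: IfTrue.IH)
next
  case (IfFalse e s Q t s' P)
  from IfFalse.prems IfFalse.hyps show ?case by (cases rule: exec.cases) (auto dest: IfFalse.IH)
next
  case (WhileTrue e s P t s' t' s'')
  from WhileTrue.prems WhileTrue.hyps show ?case
    by (cases rule: exec.cases) (auto dest!: WhileTrue.IH)
next
  case (WhileFalse e s P)
  from WhileFalse.prems WhileFalse.hyps show ?case by (cases rule: exec.cases) auto
qed

text \<open>The input word is stored in array 0, everything else is 0; the answer is read off cell 0 of
  array 1.\<close>
definition initial :: "nat list \<Rightarrow> state" where
  "initial xs = (\<lambda>a i. if a = 0 \<and> i < length xs then xs ! i else 0)"

definition accepting :: "state \<Rightarrow> bool" where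
  "accepting s \<longleftrightarrow> s 1 0 \<noteq> 0"

text \<open>The program decides the promise problem with valid inputs \<open>valid\<close> and yes-instances \<open>yes\<close>
  in time \<open>T\<close>.\<close>
definition decides_in_time ::
  "com \<Rightarrow> ('i \<Rightarrow> nat list) \<Rightarrow> ('i \<Rightarrow> bool) \<Rightarrow> ('i \<Rightarrow> bool) \<Rightarrow> ('i \<Rightarrow> real) \<Rightarrow> bool" where
  "decides_in_time P encode valid yes T \<longleftrightarrow>
     (\<forall>x. valid x \<longrightarrow>
        (\<exists>t s. exec P (initial (encode x)) t s \<and> real t \<le> T x \<and> (accepting s \<longleftrightarrow> yes x)))"


section \<open>Structural Partial Grundy Coloring\<close>

record spgc_input =
  colors :: nat
  degeneracy :: nat
  graph :: "nat ugraph"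
  bicliques :: "nat ugraph list"

definition num_vertices :: "spgc_input \<Rightarrow> nat" where
  "num_vertices x = card (verts (graph x))"

text \<open>As usual for graphs that are given to an algorithm, the vertices are numbered
  \<open>0, \<dots>, n - 1\<close>.\<close>
definition spgc_valid :: "spgc_input \<Rightarrow> bool" where
  "spgc_valid x \<longleftrightarrow>
     colors x > 0 \<and> degeneracy x > 0 \<and> length (bicliques x) > 0 \<and>
     simple_graph (graph x) \<and> verts (graph x) = {..<num_vertices x} \<and>
     (\<forall>A \<in> set (bicliques x). subgraph A (graph x) \<and> biclique A) \<and>
     degenerate (degeneracy x) (delete_edges (graph x) (\<Union>A \<in> set (bicliques x). edges A))"

definition spgc_yes :: "spgc_input \<Rightarrow> bool" where
  "spgc_yes x \<longleftrightarrow> (\<exists>k' \<ge> colors x. \<exists>c. partial_grundy_coloring (graph x) k' c)"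

definition adjacency_matrix :: "nat \<Rightarrow> nat ugraph \<Rightarrow> nat list" where
  "adjacency_matrix n G =
     concat (map (\<lambda>u. map (\<lambda>v. if {u, v} \<in> edges G then 1 else 0) [0..<n]) [0..<n])"

text \<open>The vertex set of a biclique need not be stored, see \<open>biclique_verts\<close> below.\<close>
definition spgc_encode :: "spgc_input \<Rightarrow> nat list" where
  "spgc_encode x =
     [colors x, degeneracy x, length (bicliques x), num_vertices x]
     @ adjacency_matrix (num_vertices x) (graph x)
     @ concat (map (adjacency_matrix (num_vertices x)) (bicliques x))"

lemma biclique_verts: "biclique A \<Longrightarrow> verts A = \<Union>(edges A)"
  unfolding biclique_def by (elim exE conjE) auto

end

theory Submission
  imports Defs
begin

text \<open>
  By greedy extension, a partial Grundy coloring with at least \<open>k\<close> colors exists iff there are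
  disjoint independent sets \<open>X\<^sub>1, \<dots>, X\<^sub>k\<close> with at most \<open>k - i + 1\<close> vertices in \<open>X\<^sub>i\<close> such that
  every \<open>X\<^sub>i\<close> has a vertex with neighbors in all \<open>X\<^sub>j\<close>, \<open>j < i\<close>. The algorithm runs through a set
  of guesses and decodes each of them to a partial coloring, which is made proper by uncoloring
  every vertex with an equally colored neighbor that comes later in a degeneracy order of \<open>G - F\<close>;
  it then tests the remaining condition. This is sound for arbitrary guesses.

  For completeness, one bit for every biclique and color \<open>i\<close> tells which side \<open>X\<^sub>i\<close> avoids (\<open>2\<^bsup>l k\<^esup>\<close>
  choices). Among the vertices allowed for color \<open>i\<close> all edges belong to \<open>G - F\<close>, so that
  \<open>X\<^sub>i\<close> survives if none of its at most \<open>k d\<close> later neighbors gets color \<open>i\<close>. A global hash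
  function into a range polynomial in \<open>d\<close> and \<open>k\<close>, followed by one hash function for each color
  into a range of size \<open>O(d k\<^sup>3)\<close>, separates \<open>X\<^sub>i\<close> from these vertices and from the other \<open>X\<^sub>j\<close>.
  The at most \<open>k (k + 1) / 2\<close> hash values of the \<open>X\<^sub>i\<close> are guessed as a set of cells in \<open>k\<^sup>2\<close>
  blocks of \<open>13 d k\<^sup>2\<close> cells, that is by \<open>2 k\<^sup>2\<close> bits and \<open>k (k + 1) / 2\<close> offsets, which
  contributes the factor \<open>2\<^bsup>O(k\<^sup>2 d)\<^esup> k\<^bsup>k\<^sup>2\<^esup>\<close>.

  A verification time polynomial in \<open>l\<close> is affordable if \<open>2\<^sup>l < n\<^bsup>2 k\<^esup>\<close>. Otherwise the \<open>X\<^sub>i\<close> are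
  listed directly: these are \<open>n\<^bsup>k\<^sup>2\<^esup> \<le> 2\<^bsup>l k / 2\<^esup>\<close> guesses, which leaves room for the polynomial
  factor.
\<close>

section \<open>Correctness and running time of programs\<close>

primrec writes :: "com \<Rightarrow> nat set" where
  "writes Skip = {}"
| "writes (Write a e f) = {a}"
| "writes (Seq P Q) = writes P \<union> writes Q"
| "writes (If e P Q) = writes P \<union> writes Q"
| "writes (While e P) = writes P"

lemma exec_frame: "exec P s t s' \<Longrightarrow> a \<notin> writes P \<Longrightarrow> s' a = s a"
  by (induction rule: exec.induct) auto

definition bounded_by :: "nat \<Rightarrow> state \<Rightarrow> bool" where
  "bounded_by B s \<longleftrightarrow> 2 \<le> B \<and> (\<forall>a i. s a i \<le> B)"

lemma bounded_byD: "bounded_by B s \<Longrightarrow> s a i \<le> B"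
  by (simp add: bounded_by_def)

lemma bounded_by_initial: "2 \<le> B \<Longrightarrow> (\<And>y. y \<in> set xs \<Longrightarrow> y \<le> B) \<Longrightarrow> bounded_by B (initial xs)"
  by (auto simp: bounded_by_def initial_def)

subsection \<open>Expressions\<close>

primrec reads :: "exp \<Rightarrow> nat set" where
  "reads (Const n) = {}"
| "reads (Read a e) = insert a (reads e)"
| "reads (Add e f) = reads e \<union> reads f"
| "reads (Sub e f) = reads e \<union> reads f"
| "reads (Mul e f) = reads e \<union> reads f"
| "reads (Div e f) = reads e \<union> reads f"

lemma eval_cong: "(\<And>a. a \<in> reads e \<Longrightarrow> s a = s' a) \<Longrightarrow> eval e s = eval e s'"
  by (induction e) auto

text \<open>A constant counts with its value, so that \<open>eval_le_power\<close> holds without a bound on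
  constants.\<close>
primrec esize :: "exp \<Rightarrow> nat" where
  "esize (Const n) = Suc n"
| "esize (Read a e) = Suc (esize e)"
| "esize (Add e f) = Suc (esize e + esize f)"
| "esize (Sub e f) = Suc (esize e + esize f)"
| "esize (Mul e f) = Suc (esize e + esize f)"
| "esize (Div e f) = Suc (esize e + esize f)"

lemma esize_pos: "0 < esize e"
  by (cases e) auto

lemma add_mult_le_power_Suc:
  fixes x y B :: nat
  assumes "2 \<le> B" "x \<le> B ^ m" "y \<le> B ^ n"
  shows "x + y \<le> B ^ Suc (m + n)" "x * y \<le> B ^ Suc (m + n)"
proof -
  have "B ^ m \<le> B ^ (m + n)" "B ^ n \<le> B ^ (m + n)"
    using assms(1) by (simp_all add: power_increasing)
  then have "x + y \<le> 2 * B ^ (m + n)" using assms(2,3) by linarith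
  also have "\<dots> \<le> B ^ Suc (m + n)" using assms(1) by simp
  finally show "x + y \<le> B ^ Suc (m + n)" .
  have "x * y \<le> B ^ (m + n)" using assms(2,3) by (simp add: power_add mult_le_mono)
  also have "\<dots> \<le> B ^ Suc (m + n)" using assms(1) by simp
  finally show "x * y \<le> B ^ Suc (m + n)" .
qed

lemma eval_le_power:
  assumes "bounded_by B s"
  shows "eval e s \<le> B ^ esize e"
proof (induction e)
  have B: "2 \<le> B" using assms by (simp add: bounded_by_def)
  {
    case (Const n)
    have "n \<le> 2 ^ Suc n" by (rule order_trans[OF less_imp_le[OF less_exp]]) simp
    also have "\<dots> \<le> B ^ Suc n" using B by (rule power_mono) simp
    finally show ?case by simp
  next
    case (Read a e)
    have "s a (eval e s) \<le> B ^ 1" using bounded_byD[OF assms] by simp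
    also have "\<dots> \<le> B ^ esize (Read a e)" using B by (intro power_increasing) auto
    finally show ?case by simp
  next
    case (Add e f)
    then show ?case using add_mult_le_power_Suc(1)[OF B] by simp
  next
    case (Sub e f)
    then show ?case using add_mult_le_power_Suc(1)[OF B Sub] by simp
  next
    case (Mul e f)
    then show ?case using add_mult_le_power_Suc(2)[OF B] by simp
  next
    case (Div e f)
    have "eval (Div e f) s \<le> eval e s + eval f s" by (simp add: trans_le_add1)
    then show ?case using add_mult_le_power_Suc(1)[OF B Div] by simp
  }
qed

lemma less_two_power_bitlen: "n < 2 ^ bitlen n"
  using floor_log_exp2_gt[of n] by (simp add: bitlen_def)

lemma bitlen_pos: "0 < bitlen n"
  by (simp add: bitlen_def)

lemma bitlen_le:
  assumes "n < 2 ^ m" "0 < m"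
  shows "bitlen n \<le> m"
proof (cases "n = 0")
  case True
  then show ?thesis using assms by (simp add: bitlen_def)
next
  case False
  then have "(2::nat) ^ floor_log n < 2 ^ m" using assms floor_log_exp2_le[of n] by linarith
  then show ?thesis by (simp add: bitlen_def)
qed

lemma bitlen_eval_le:
  assumes "bounded_by B s"
  shows "bitlen (eval e s) \<le> esize e * bitlen B"
proof (rule bitlen_le)
  have "eval e s \<le> B ^ esize e" by (rule eval_le_power[OF assms])
  also have "\<dots> < (2 ^ bitlen B) ^ esize e"
    by (intro power_strict_mono less_two_power_bitlen) (auto simp: esize_pos)
  finally show "eval e s < 2 ^ (esize e * bitlen B)"
    by (simp add: power_mult[symmetric] mult.commute)
qed (simp add: esize_pos bitlen_pos)

primrec ecost :: "exp \<Rightarrow> nat" where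
  "ecost (Const n) = 2 * esize (Const n)"
| "ecost (Read a e) = ecost e + 2 * esize (Read a e)"
| "ecost (Add e f) = ecost e + ecost f + esize (Add e f)"
| "ecost (Sub e f) = ecost e + ecost f + esize (Sub e f)"
| "ecost (Mul e f) = ecost e + ecost f + esize (Mul e f)"
| "ecost (Div e f) = ecost e + ecost f + esize (Div e f)"

lemma eval_cost_le_ecost:
  assumes "bounded_by B s"
  shows "eval_cost e s + bitlen (eval e s) \<le> ecost e * bitlen B"
proof (induction e)
  case (Const n)
  show ?case using bitlen_eval_le[OF assms, of "Const n"] by simp
next
  case (Read a e)
  then show ?case using bitlen_eval_le[OF assms, of "Read a e"] by (simp add: algebra_simps)
next
  case (Add e f)
  then show ?case using bitlen_eval_le[OF assms, of "Add e f"] by (simp add: algebra_simps)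
next
  case (Sub e f)
  then show ?case using bitlen_eval_le[OF assms, of "Sub e f"] by (simp add: algebra_simps)
next
  case (Mul e f)
  then show ?case using bitlen_eval_le[OF assms, of "Mul e f"] by (simp add: algebra_simps)
next
  case (Div e f)
  then show ?case using bitlen_eval_le[OF assms, of "Div e f"] by (simp add: algebra_simps)
qed

subsection \<open>Commands\<close>

text \<open>Time in units of the bit length of the largest number in memory, if no loop makes more than
  \<open>R\<close> iterations.\<close>
primrec cost :: "nat \<Rightarrow> com \<Rightarrow> nat" where
  "cost R Skip = 1"
| "cost R (Write a e f) = ecost e + ecost f"
| "cost R (Seq P Q) = cost R P + cost R Q"
| "cost R (If e P Q) = ecost e + (cost R P + cost R Q)"
| "cost R (While e P) = Suc R * (ecost e + cost R P)"

lemma cost_le_polynomial: "cost R P \<le> cost 0 P * Suc R ^ size P"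
proof (induction P)
  case (Seq P Q)
  have "cost 0 P * Suc R ^ size P \<le> cost 0 P * Suc R ^ size (Seq P Q)"
    "cost 0 Q * Suc R ^ size Q \<le> cost 0 Q * Suc R ^ size (Seq P Q)"
    by (intro mult_le_mono2 power_increasing; simp)+
  then show ?case using Seq by (simp only: cost.simps distrib_right)
next
  case (If e P Q)
  have "cost 0 P * Suc R ^ size P \<le> cost 0 P * Suc R ^ size (If e P Q)"
    "cost 0 Q * Suc R ^ size Q \<le> cost 0 Q * Suc R ^ size (If e P Q)"
    by (intro mult_le_mono2 power_increasing; simp)+
  moreover have "ecost e * 1 \<le> ecost e * Suc R ^ size (If e P Q)"
    by (intro mult_le_mono2 one_le_power) simp
  ultimately show ?case using If by (simp only: cost.simps distrib_right)
next
  case (While e P)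
  have "ecost e * 1 \<le> ecost e * Suc R ^ size P" by (intro mult_le_mono2) simp
  then have "ecost e + cost R P \<le> (ecost e + cost 0 P) * Suc R ^ size P"
    using While by (simp only: distrib_right)
  then have "Suc R * (ecost e + cost R P) \<le> Suc R * ((ecost e + cost 0 P) * Suc R ^ size P)"
    by (rule mult_le_mono2)
  also have "\<dots> = (ecost e + cost 0 P) * Suc R ^ Suc (size P)" by (simp only: power_Suc mult_ac)
  finally show ?case by simp
qed simp_all

definition ensures :: "nat \<Rightarrow> nat \<Rightarrow> com \<Rightarrow> state \<Rightarrow> (state \<Rightarrow> bool) \<Rightarrow> bool" where
  "ensures B T P s Q \<longleftrightarrow> (bounded_by B s \<longrightarrow>
     (\<exists>t s'. exec P s t s' \<and> t \<le> T * bitlen B \<and> bounded_by B s' \<and> Q s'))"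

abbreviation spec :: "nat \<Rightarrow> nat \<Rightarrow> com \<Rightarrow> state \<Rightarrow> (state \<Rightarrow> bool) \<Rightarrow> bool" where
  "spec B R P \<equiv> ensures B (cost R P) P"

lemma ensuresI:
  assumes "bounded_by B s \<Longrightarrow> \<exists>t s'. exec P s t s' \<and> t \<le> T * bitlen B \<and> bounded_by B s' \<and> Q s'"
  shows "ensures B T P s Q"
  using assms by (simp add: ensures_def)

lemma ensuresE:
  assumes "ensures B T P s Q" "bounded_by B s"
  obtains t s' where "exec P s t s'" "t \<le> T * bitlen B" "bounded_by B s'" "Q s'"
    "\<And>a. a \<notin> writes P \<Longrightarrow> s' a = s a"
  using assms exec_frame unfolding ensures_def by metis

lemma ensures_bounded: "(bounded_by B s \<Longrightarrow> ensures B T P s Q) \<Longrightarrow> ensures B T P s Q"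
  by (auto simp: ensures_def)

lemma ensures_mono: "ensures B T P s Q \<Longrightarrow> T \<le> T' \<Longrightarrow> ensures B T' P s Q"
  unfolding ensures_def by (meson le_trans mult_le_mono1)

lemma ensures_conseq [consumes 1, case_names post [bounded frame post]]:
  assumes "ensures B T P s Q"
    and "\<And>s'. bounded_by B s' \<Longrightarrow> (\<And>a. a \<notin> writes P \<Longrightarrow> s' a = s a) \<Longrightarrow> Q s' \<Longrightarrow> Q' s'"
  shows "ensures B T P s Q'"
proof (rule ensuresI)
  assume "bounded_by B s"
  with assms(1) obtain t s' where "exec P s t s'" "t \<le> T * bitlen B" "bounded_by B s'" "Q s'"
    "\<And>a. a \<notin> writes P \<Longrightarrow> s' a = s a"
    by (rule ensuresE) blast
  then show "\<exists>t s'. exec P s t s' \<and> t \<le> T * bitlen B \<and> bounded_by B s' \<and> Q' s'"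
    using assms(2) by blast
qed

lemma ensures_Seq [consumes 1, case_names second [bounded frame post]]:
  assumes "ensures B T P s Q"
    and "\<And>s'. bounded_by B s' \<Longrightarrow> (\<And>a. a \<notin> writes P \<Longrightarrow> s' a = s a) \<Longrightarrow> Q s' \<Longrightarrow>
      ensures B T' P' s' Q'"
  shows "ensures B (T + T') (Seq P P') s Q'"
proof (rule ensuresI)
  assume "bounded_by B s"
  with assms(1) obtain t s' where first: "exec P s t s'" "t \<le> T * bitlen B"
    and mid: "bounded_by B s'" "Q s'" "\<And>a. a \<notin> writes P \<Longrightarrow> s' a = s a"
    by (rule ensuresE) blast
  from assms(2)[OF mid(1,3,2)] mid(1) obtain t' s'' where
    second: "exec P' s' t' s''" "t' \<le> T' * bitlen B" "bounded_by B s''" "Q' s''"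
    by (rule ensuresE) blast
  have "exec (Seq P P') s (t + t') s''" using first second by (blast intro: exec.Seq)
  moreover have "t + t' \<le> (T + T') * bitlen B" using first second by (simp add: distrib_right)
  ultimately show "\<exists>t s'. exec (Seq P P') s t s' \<and> t \<le> (T + T') * bitlen B \<and> bounded_by B s' \<and>
      Q' s'"
    using second by blast
qed

lemma spec_Seq [consumes 1, case_names second [bounded frame post]]:
  assumes "spec B R P s Q"
    and "\<And>s'. bounded_by B s' \<Longrightarrow> (\<And>a. a \<notin> writes P \<Longrightarrow> s' a = s a) \<Longrightarrow> Q s' \<Longrightarrow> spec B R P' s' Q'"
  shows "spec B R (Seq P P') s Q'"
  using ensures_Seq[OF assms] by simp

lemma spec_Skip: "Q s \<Longrightarrow> spec B R Skip s Q"
  unfolding ensures_def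
  using exec.Skip[of s] bitlen_pos[of B] by (intro impI exI[of _ 1] exI[of _ s]) auto

lemma spec_Write:
  assumes "bounded_by B s \<Longrightarrow> eval f s \<le> B" "Q (s(a := (s a)(eval e s := eval f s)))"
  shows "spec B R (Write a e f) s Q"
proof (rule ensuresI, intro exI conjI)
  assume bounded: "bounded_by B s"
  show "exec (Write a e f) s (eval_cost e s + eval_cost f s + bitlen (eval e s) + bitlen (eval f s))
     (s(a := (s a)(eval e s := eval f s)))" by (rule exec.Write)
  show "eval_cost e s + eval_cost f s + bitlen (eval e s) + bitlen (eval f s)
      \<le> cost R (Write a e f) * bitlen B"
    using eval_cost_le_ecost[OF bounded, of e] eval_cost_le_ecost[OF bounded, of f]
    by (simp add: distrib_right)
  show "bounded_by B (s(a := (s a)(eval e s := eval f s)))"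
    using bounded assms(1) by (auto simp: bounded_by_def)
qed (rule assms(2))

lemma spec_Seq_Write:
  assumes "bounded_by B s \<Longrightarrow> eval f s \<le> B" "spec B R P (s(a := (s a)(eval e s := eval f s))) Q"
  shows "spec B R (Seq (Write a e f) P) s Q"
  using spec_Write[where Q = "\<lambda>s'. s' = s(a := (s a)(eval e s := eval f s))", OF assms(1)]
  by (rule spec_Seq) (use assms(2) in auto)

lemma spec_If:
  assumes "eval e s \<noteq> 0 \<Longrightarrow> spec B R P s Q" "eval e s = 0 \<Longrightarrow> spec B R P' s Q"
  shows "spec B R (If e P P') s Q"
proof (rule ensuresI)
  assume bounded: "bounded_by B s"
  let ?t = "eval_cost e s + bitlen (eval e s)"
  have "\<exists>t s'. exec (If e P P') s (?t + t) s' \<and> t \<le> (cost R P + cost R P') * bitlen B \<and>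
      bounded_by B s' \<and> Q s'"
  proof (cases "eval e s = 0")
    case True
    with assms(2) bounded obtain t s' where "exec P' s t s'" "t \<le> cost R P' * bitlen B"
      "bounded_by B s'" "Q s'"
      by (blast elim: ensuresE)
    moreover from this(1) have "exec (If e P P') s (?t + t) s'"
      using True by (blast intro: exec.IfFalse)
    ultimately show ?thesis by (auto simp: distrib_right intro: trans_le_add2)
  next
    case False
    with assms(1) bounded obtain t s' where "exec P s t s'" "t \<le> cost R P * bitlen B"
      "bounded_by B s'" "Q s'"
      by (blast elim: ensuresE)
    moreover from this(1) have "exec (If e P P') s (?t + t) s'"
      using False by (blast intro: exec.IfTrue)
    ultimately show ?thesis by (auto simp: distrib_right intro: trans_le_add1)
  qed
  then obtain t s' where run: "exec (If e P P') s (?t + t) s'"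
    "t \<le> (cost R P + cost R P') * bitlen B"
    "bounded_by B s'" "Q s'"
    by blast
  have "?t + t \<le> cost R (If e P P') * bitlen B"
    using eval_cost_le_ecost[OF bounded, of e] run(2) by (simp add: distrib_right)
  then show "\<exists>t s'. exec (If e P P') s t s' \<and> t \<le> cost R (If e P P') * bitlen B \<and>
      bounded_by B s' \<and> Q s'"
    using run by blast
qed

abbreviation Var :: "nat \<Rightarrow> exp" where
  "Var a \<equiv> Read a (Const 0)"

abbreviation Assign :: "nat \<Rightarrow> exp \<Rightarrow> com" where
  "Assign a e \<equiv> Write a (Const 0) e"

definition Mod :: "exp \<Rightarrow> exp \<Rightarrow> exp" where
  "Mod e f = Sub e (Mul (Div e f) f)"

lemma eval_Mod [simp]: "eval (Mod e f) s = eval e s mod eval f s"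
  by (simp add: Mod_def minus_div_mult_eq_mod)

definition Eq :: "exp \<Rightarrow> exp \<Rightarrow> exp" where
  "Eq e f = Sub (Const 1) (Add (Sub e f) (Sub f e))"

lemma eval_Eq [simp]: "eval (Eq e f) s = (if eval e s = eval f s then 1 else 0)"
  by (simp add: Eq_def)

subsection \<open>Counting loops\<close>

definition For_step :: "nat \<Rightarrow> com \<Rightarrow> com" where
  "For_step i P = Seq P (Assign i (Add (Var i) (Const 1)))"

definition For_loop :: "nat \<Rightarrow> exp \<Rightarrow> com \<Rightarrow> com" where
  "For_loop i N P = While (Sub N (Var i)) (For_step i P)"

definition For :: "nat \<Rightarrow> exp \<Rightarrow> com \<Rightarrow> com" where
  "For i N P = Seq (Assign i (Const 0)) (For_loop i N P)"

lemma writes_For [simp]: "writes (For i N P) = insert i (writes P)"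
  by (auto simp: For_def For_loop_def For_step_def)

context
  fixes i n R B :: nat and P :: com and N :: exp and Inv :: "nat \<Rightarrow> state \<Rightarrow> bool" and s :: state
  assumes bound: "n \<le> B"
    and fresh: "i \<notin> writes P"
    and limit: "\<And>s'. (\<And>a. a \<notin> insert i (writes P) \<Longrightarrow> s' a = s a) \<Longrightarrow> eval N s' = n"
    and stable: "\<And>j s' x. Inv j s' \<Longrightarrow> Inv j (s'(i := x))"
    and init: "Inv 0 s"
    and step: "\<And>j s'. j < n \<Longrightarrow> s' i 0 = j \<Longrightarrow> bounded_by B s' \<Longrightarrow>
      (\<And>a. a \<notin> insert i (writes P) \<Longrightarrow> s' a = s a) \<Longrightarrow> Inv j s' \<Longrightarrow> spec B R P s' (Inv (Suc j))"
begin

abbreviation (input) "reached j s' \<equiv>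
  s' i 0 = j \<and> (\<forall>a. a \<notin> insert i (writes P) \<longrightarrow> s' a = s a) \<and> Inv j s'"

abbreviation (input) "iteration_cost \<equiv> ecost (Sub N (Var i)) + cost R (For_step i P)"

lemma spec_For_step:
  assumes "j < n" "bounded_by B s1" "reached j s1"
  shows "spec B R (For_step i P) s1 (reached (Suc j))"
proof -
  have "spec B R P s1 (Inv (Suc j))" using assms by (intro step) auto
  then show ?thesis
    unfolding For_step_def
  proof (induction rule: spec_Seq)
    case (second s2)
    have "s2 i 0 = j" using second.frame[OF fresh] assms(3) by simp
    then show ?case
      using second.frame second.post assms(1,3) bound stable by (intro spec_Write) auto
  qed
qed

lemma ensures_For_loop:
  assumes "j \<le> n" "reached j s1"
  shows "ensures B (Suc (n - j) * iteration_cost) (For_loop i N P) s1 (Inv n)"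
proof (rule ensuresI)
  assume "bounded_by B s1"
  with assms show "\<exists>t s'. exec (For_loop i N P) s1 t s' \<and>
      t \<le> (Suc (n - j) * iteration_cost) * bitlen B \<and>
      bounded_by B s' \<and> Inv n s'"
  proof (induction "n - j" arbitrary: j s1)
    case 0
    then have "j = n" by simp
    then have "eval (Sub N (Var i)) s1 = 0" using limit[of s1] 0 by simp
    then have "exec (For_loop i N P) s1
        (eval_cost (Sub N (Var i)) s1 + bitlen (eval (Sub N (Var i)) s1)) s1"
      unfolding For_loop_def by (rule exec.WhileFalse)
    moreover have "eval_cost (Sub N (Var i)) s1 + bitlen (eval (Sub N (Var i)) s1)
        \<le> (Suc (n - j) * iteration_cost) * bitlen B"
      using eval_cost_le_ecost[OF 0(4), of "Sub N (Var i)"] \<open>j = n\<close> by (simp add: distrib_right)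
    ultimately show ?case using 0 \<open>j = n\<close> by blast
  next
    case (Suc m)
    then have "j < n" by simp
    then have nonzero: "eval (Sub N (Var i)) s1 \<noteq> 0" using limit[of s1] Suc.prems by simp
    from spec_For_step[OF \<open>j < n\<close> Suc.prems(3,2)] Suc.prems(3) obtain t s2 where
      once: "exec (For_step i P) s1 t s2" "t \<le> cost R (For_step i P) * bitlen B"
      and s2: "bounded_by B s2" "reached (Suc j) s2"
      by (rule ensuresE) blast
    have m: "m = n - Suc j" "Suc j \<le> n" using Suc.hyps(2) by auto
    from Suc.hyps(1)[OF m s2(2,1)] obtain t' s3 where
      rest: "exec (For_loop i N P) s2 t' s3" "t' \<le> (Suc m * iteration_cost) * bitlen B"
      "bounded_by B s3" "Inv n s3"
      unfolding m(1) by blast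
    let ?t = "eval_cost (Sub N (Var i)) s1 + bitlen (eval (Sub N (Var i)) s1)"
    have "exec (For_loop i N P) s1 (?t + t + t') s3"
      using once rest nonzero unfolding For_loop_def by (blast intro: exec.WhileTrue)
    moreover have "?t + t + t' \<le> (Suc (n - j) * iteration_cost) * bitlen B"
      using eval_cost_le_ecost[OF Suc.prems(3), of "Sub N (Var i)"] once(2) rest(2)
      by (simp add: Suc.hyps(2)[symmetric] distrib_right)
    ultimately show ?case using rest by blast
  qed
qed

lemma ensures_For_exact:
  "ensures B (cost R (Assign i (Const 0)) + Suc n * iteration_cost) (For i N P) s (Inv n)"
proof -
  have "spec B R (Assign i (Const 0)) s (reached 0)"
    using init stable by (intro spec_Write) auto
  then show ?thesis
    unfolding For_def by (rule ensures_Seq) (use ensures_For_loop[of 0] in simp)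
qed

lemma ensures_For
    [case_names bound fresh limit [frame] stable init step [index counter bounded frame inv]]:
  "ensures B (Suc n * cost R (For i N P)) (For i N P) s (Inv n)"
proof (rule ensures_mono[OF ensures_For_exact])
  have "cost R (Assign i (Const 0)) + iteration_cost \<le> cost R (For i N P)"
    by (simp add: For_def For_loop_def)
  then have "Suc n * (cost R (Assign i (Const 0)) + iteration_cost) \<le> Suc n * cost R (For i N P)"
    by (rule mult_le_mono2)
  then show "cost R (Assign i (Const 0)) + Suc n * iteration_cost \<le> Suc n * cost R (For i N P)"
    by (simp add: distrib_left)
qed

lemma spec_For
    [case_names bound fresh limit [frame] stable init step [index counter bounded frame inv]
      iterations]:
  assumes "n \<le> R"
  shows "spec B R (For i N P) s (Inv n)"
proof (rule ensures_mono[OF ensures_For_exact])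
  show "cost R (Assign i (Const 0)) + Suc n * iteration_cost \<le> cost R (For i N P)"
    using mult_le_mono1[of "Suc n" "Suc R" iteration_cost] assms
      by (simp add: For_def For_loop_def)
qed

end

section \<open>Hashing\<close>

text \<open>Arguments are meant to be less than \<open>T\<close>. The modulus is then so large compared with the
  arguments that it need not be prime: for \<open>0 < D < T\<close>, the multiples of \<open>D\<close> hit a window of
  length \<open>2 T\<close> around 0 modulo \<open>M T\<close> with frequency \<open>O(1 / M)\<close>.\<close>
definition mult_hash :: "nat \<Rightarrow> nat \<Rightarrow> nat \<Rightarrow> nat \<Rightarrow> nat" where
  "mult_hash M T a x = (a * x mod (M * T)) div T"

lemma mult_hash_less: "0 < M \<Longrightarrow> 0 < T \<Longrightarrow> mult_hash M T a x < M"
  by (simp add: mult_hash_def less_mult_imp_div_less)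

lemma less_add_if_div_eq:
  assumes "a div T = b div T" "0 < (T::nat)"
  shows "a < b + T"
proof -
  have "a = T * (a div T) + a mod T" "b = T * (b div T) + b mod T" by simp_all
  moreover have "a mod T < T" using assms by simp
  ultimately show ?thesis unfolding assms(1) by linarith
qed

lemma
  fixes c D T :: nat
  assumes "0 < D"
  defines "A \<equiv> {a. c < a * D + T \<and> a * D < c + T}"
  shows finite_multiples_near: "finite A"
    and card_multiples_near_le: "card A \<le> 2 * T div D + 1"
proof -
  define m where "m = (LEAST a. a \<in> A)"
  have sub: "A \<subseteq> {m..m + 2 * T div D}"
  proof
    fix a assume a: "a \<in> A"
    then have "m \<in> A" and "m \<le> a" unfolding m_def by (rule LeastI, rule Least_le)
    then have "(a - m) * D \<le> 2 * T" using a by (auto simp: A_def diff_mult_distrib)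
    then have "a - m \<le> 2 * T div D" using assms(1) by (simp add: less_eq_div_iff_mult_less_eq)
    then show "a \<in> {m..m + 2 * T div D}" using \<open>m \<le> a\<close> by auto
  qed
  then show "finite A" by (rule finite_subset) simp
  show "card A \<le> 2 * T div D + 1" using card_mono[OF _ sub] by simp
qed

lemma mult_hash_collision_near_multiple:
  assumes "y < x" "x < T" "a < M * T" and collision: "mult_hash M T a x = mult_hash M T a y"
  obtains J where "J \<le> x - y" "M * T * J < a * (x - y) + T" "a * (x - y) < M * T * J + T"
proof -
  define W where "W = M * T"
  define p q where "p = a * x div W" and "q = a * y div W"
  define r r' where "r = a * x mod W" and "r' = a * y mod W"
  have T: "0 < T" "T \<le> W" using assms(2,3) by (cases M; simp add: W_def)+
  have ax: "a * x = W * p + r" and ay: "a * y = W * q + r'"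
    by (simp_all add: p_def q_def r_def r'_def)
  have "r div T = r' div T" using collision by (simp add: mult_hash_def W_def r_def r'_def)
  then have r: "r < r' + T" "r' < r + T" using less_add_if_div_eq T(1) by metis+
  have "q \<le> p" unfolding p_def q_def using assms(1) by (intro div_le_mono mult_le_mono2) simp
  then have pq: "W * (p - q) = W * p - W * q" "W * q \<le> W * p"
    by (simp_all add: diff_mult_distrib2)
  have D: "a * (x - y) = a * x - a * y" "a * y \<le> a * x"
    using assms(1) by (simp_all add: diff_mult_distrib2)
  have near: "W * (p - q) < a * (x - y) + T" "a * (x - y) < W * (p - q) + T"
    using ax ay r pq D by linarith+
  have "a * (x - y) \<le> W * (x - y)" using assms(3) by (simp add: W_def)
  then have "W * (p - q) < W * Suc (x - y)"
    using near(1) T(2) unfolding mult_Suc_right by linarith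
  then have "p - q \<le> x - y" by (meson less_Suc_eq_le mult_less_cancel1)
  then show thesis using near that by (simp add: W_def)
qed

lemma card_mult_hash_collisions:
  assumes "x < T" "y < T" "x \<noteq> y"
  shows "card {a. a < M * T \<and> mult_hash M T a x = mult_hash M T a y} \<le> 5 * T"
  using assms
proof (induction x y rule: linorder_wlog)
  case (sym x y)
  then show ?case by (simp add: eq_commute)
next
  case (le y x)
  define D where "D = x - y"
  define C where "C J = {a. M * T * J < a * D + T \<and> a * D < M * T * J + T}" for J
  have D: "0 < D" "D < T" using le by (auto simp: D_def)
  have "{a. a < M * T \<and> mult_hash M T a x = mult_hash M T a y} \<subseteq> (\<Union>J\<le>D. C J)"
  proof
    fix a assume "a \<in> {a. a < M * T \<and> mult_hash M T a x = mult_hash M T a y}"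
    then obtain J where "J \<le> D" "a \<in> C J"
      using mult_hash_collision_near_multiple[of y x T a M] le unfolding C_def D_def by auto
    then show "a \<in> (\<Union>J\<le>D. C J)" by blast
  qed
  then have "card {a. a < M * T \<and> mult_hash M T a x = mult_hash M T a y} \<le> card (\<Union>J\<le>D. C J)"
    using finite_multiples_near[OF D(1)] unfolding C_def by (intro card_mono) auto
  also have "\<dots> \<le> (\<Sum>J\<le>D. card (C J))" by (rule card_UN_le) simp
  also have "\<dots> \<le> (\<Sum>J\<le>D. 2 * T div D + 1)"
    using card_multiples_near_le[OF D(1)] unfolding C_def by (intro sum_mono)
  also have "\<dots> = D * (2 * T div D) + 2 * T div D + D + 1" by simp
  also have "\<dots> \<le> 2 * T + 2 * T + T"
  proof -
    have "D * (2 * T div D) \<le> 2 * T" "2 * T div D \<le> 2 * T" by simp_all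
    then show ?thesis using D by linarith
  qed
  finally show ?case by (simp add: eq_commute)
qed

lemma mult_hash_separates:
  assumes "finite P" "0 < T" "5 * card P < M"
    and P: "\<And>x y. (x, y) \<in> P \<Longrightarrow> x < T \<and> y < T \<and> x \<noteq> y"
  obtains a where "a < M * T" "\<And>x y. (x, y) \<in> P \<Longrightarrow> mult_hash M T a x \<noteq> mult_hash M T a y"
proof -
  define C where "C p = {a. a < M * T \<and> mult_hash M T a (fst p) = mult_hash M T a (snd p)}" for p
  have "card (\<Union>p\<in>P. C p) \<le> (\<Sum>p\<in>P. card (C p))" by (rule card_UN_le[OF assms(1)])
  also have "\<dots> \<le> (\<Sum>p\<in>P. 5 * T)"
    using P unfolding C_def by (intro sum_mono card_mult_hash_collisions) auto
  also have "\<dots> < card {..<M * T}" using assms(2,3) by simp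
  finally have less: "card (\<Union>p\<in>P. C p) < card {..<M * T}" .
  have "finite (\<Union>p\<in>P. C p)" using assms(1) by (simp add: C_def)
  then have "\<not> {..<M * T} \<subseteq> (\<Union>p\<in>P. C p)" using less card_mono not_le by blast
  then obtain a where a: "a < M * T" "\<forall>p\<in>P. a \<notin> C p" by auto
  have "mult_hash M T a x \<noteq> mult_hash M T a y" if "(x, y) \<in> P" for x y
    using bspec[OF a(2) that] a(1) by (simp add: C_def)
  then show thesis using that a(1) by blast
qed

section \<open>Coding by numbers\<close>

lemma ex_digits:
  assumes "\<And>i. i < k \<Longrightarrow> f i < (r::nat)"
  shows "\<exists>x < r ^ k * Suc y. (\<forall>i<k. x div r ^ i mod r = f i) \<and> x div r ^ k = y"
  using assms
proof (induction k arbitrary: f)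
  case 0
  then show ?case by auto
next
  case (Suc k)
  obtain x where x: "x < r ^ k * Suc y" "\<And>i. i < k \<Longrightarrow> x div r ^ i mod r = f (Suc i)"
    "x div r ^ k = y"
    using Suc.IH[of "\<lambda>i. f (Suc i)"] Suc.prems by auto
  define e where "e = f 0 + r * x"
  have e: "e mod r = f 0" "e div r = x" using Suc.prems[of 0] by (simp_all add: e_def)
  have shift: "e div r ^ Suc i = x div r ^ i" for i using e by (simp add: div_mult2_eq)
  have "e < r * Suc x" using Suc.prems[of 0] by (simp add: e_def)
  also have "\<dots> \<le> r * (r ^ k * Suc y)" using x(1) by (intro mult_le_mono2) simp
  finally have "e < r ^ Suc k * Suc y" by (simp only: power_Suc mult.assoc)
  moreover have "e div r ^ i mod r = f i" if "i < Suc k" for i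
    using that x(2) e shift by (cases i) auto
  ultimately show ?case using shift[of k] x(3) by blast
qed

text \<open>The number \<open>x\<close> is read as a sequence of \<open>j\<close> bits: 0 moves to the next block of \<open>m\<close> cells, 1
  marks a cell of the current block, whose offset is the next digit in base \<open>m\<close>. Coding an
  unordered set in this way saves a factor of about \<open>k\<close> for each marked cell compared with listing
  the cells.\<close>
primrec decode_marks :: "nat \<Rightarrow> nat \<Rightarrow> nat \<Rightarrow> nat \<Rightarrow> nat set" where
  "decode_marks m 0 x p = {}"
| "decode_marks m (Suc j) x p =
    (if x mod 2 = 0 then decode_marks m j (x div 2) (Suc p)
     else insert (p * m + x div 2 mod m) (decode_marks m j (x div 2 div m) p))"

lemma decode_marks_next_block: "decode_marks m (Suc j) (2 * x) p = decode_marks m j x (Suc p)"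
  by simp

lemma decode_marks_mark:
  assumes "r < m"
  shows "decode_marks m (Suc j) (1 + 2 * (r + m * x)) p = insert (p * m + r) (decode_marks m j x p)"
proof -
  have "(1 + 2 * (r + m * x)) mod 2 = 1" "(1 + 2 * (r + m * x)) div 2 = r + m * x" by simp_all
  moreover have "(r + m * x) mod m = r" "(r + m * x) div m = x" using assms by simp_all
  ultimately show ?thesis by (simp only: decode_marks.simps) simp
qed

lemma mark_code_less:
  fixes m N r x :: nat
  assumes "r < m" "x < N"
  shows "1 + 2 * (r + m * x) < 2 * (m * N)"
proof -
  have "r + m * x < m * Suc x" using assms(1) by simp
  also have "\<dots> \<le> m * N" using assms(2) by (intro mult_le_mono2) simp
  finally have "r + m * x < m * N" .
  moreover have "1 + 2 * u < 2 * v" if "u < v" for u v :: nat using that by linarith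
  ultimately show ?thesis by blast
qed

lemma subset_next_blocks:
  fixes m p b :: nat
  assumes "S \<subseteq> {p * m..<(p + b) * m}" "\<And>r. r < m \<Longrightarrow> p * m + r \<notin> S"
  shows "S \<subseteq> {Suc p * m..<(Suc p + (b - 1)) * m}"
proof
  fix y assume y: "y \<in> S"
  then have "p * m \<le> y" "y < (p + b) * m" using assms(1) by auto
  moreover have "\<not> y - p * m < m" using assms(2)[of "y - p * m"] y \<open>p * m \<le> y\<close> by auto
  then have "Suc p * m \<le> y" using \<open>p * m \<le> y\<close> by simp
  moreover have "b \<noteq> 0" using calculation(1,2) by (cases b) auto
  ultimately show "y \<in> {Suc p * m..<(Suc p + (b - 1)) * m}" by simp
qed

lemma decode_marks_onto:
  assumes "S \<subseteq> {p * m..<(p + b) * m}" "b + card S \<le> j"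
  shows "\<exists>x < 2 ^ j * m ^ card S. decode_marks m j x p = S"
  using assms
proof (induction j arbitrary: S p b)
  case 0
  then show ?case by auto
next
  case (Suc j)
  have fin: "finite S" using Suc.prems(1) finite_subset by blast
  show ?case
  proof (cases "\<exists>r < m. p * m + r \<in> S")
    case True
    then obtain r where r: "r < m" "p * m + r \<in> S" by blast
    define S' where "S' = S - {p * m + r}"
    have S: "S = insert (p * m + r) S'" using r(2) by (auto simp: S'_def)
    have card: "card S = Suc (card S')" using card.remove[OF fin r(2)] by (simp add: S'_def)
    have "S' \<subseteq> {p * m..<(p + b) * m}" "b + card S' \<le> j"
      using Suc.prems card by (auto simp: S'_def)
    from Suc.IH[OF this] obtain x where x: "x < 2 ^ j * m ^ card S'" "decode_marks m j x p = S'"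
      by blast
    have "decode_marks m (Suc j) (1 + 2 * (r + m * x)) p = S"
      unfolding decode_marks_mark[OF r(1)] x(2) S ..
    moreover have "1 + 2 * (r + m * x) < 2 ^ Suc j * m ^ card S"
      using mark_code_less[OF r(1) x(1)] by (simp add: card mult_ac)
    ultimately show ?thesis by blast
  next
    case False
    then have sub: "S \<subseteq> {Suc p * m..<(Suc p + (b - 1)) * m}"
      using subset_next_blocks[OF Suc.prems(1)] by blast
    have "b - 1 + card S \<le> j"
      using Suc.prems by (cases b) auto
    from Suc.IH[OF sub this] obtain x where "x < 2 ^ j * m ^ card S"
      "decode_marks m j x (Suc p) = S"
      by blast
    then have "2 * x < 2 ^ Suc j * m ^ card S" "decode_marks m (Suc j) (2 * x) p = S"
      by (auto simp: decode_marks_next_block)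
    then show ?thesis by blast
  qed
qed

text \<open>Successor of the largest \<open>i < k\<close> satisfying \<open>Q\<close>, and 0 (uncolored) if there is none.\<close>
primrec last_true :: "(nat \<Rightarrow> bool) \<Rightarrow> nat \<Rightarrow> nat" where
  "last_true Q 0 = 0"
| "last_true Q (Suc i) = (if Q i then Suc i else last_true Q i)"

lemma last_true_le: "last_true Q k \<le> k"
  by (induction k) auto

lemma last_true_eq_SucD: "last_true Q k = Suc i \<Longrightarrow> Q i"
  by (induction k) (auto split: if_splits)

lemma last_true_unique: "i < k \<Longrightarrow> (\<And>j. j < k \<Longrightarrow> Q j \<longleftrightarrow> j = i) \<Longrightarrow> last_true Q k = Suc i"
  by (induction k) (auto simp: less_Suc_eq)

section \<open>Witnesses of partial Grundy colorings\<close>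

definition grundy_vertex :: "'a ugraph \<Rightarrow> ('a \<Rightarrow> nat) \<Rightarrow> nat \<Rightarrow> 'a \<Rightarrow> bool" where
  "grundy_vertex G z i v \<longleftrightarrow>
     v \<in> verts G \<and> z v = i \<and> (\<forall>j \<in> {1..<i}. \<exists>u \<in> verts G. {u, v} \<in> edges G \<and> z u = j)"

definition grundy_condition :: "'a ugraph \<Rightarrow> nat \<Rightarrow> ('a \<Rightarrow> nat) \<Rightarrow> bool" where
  "grundy_condition G k z \<longleftrightarrow> (\<forall>i \<in> {1..k}. \<exists>v. grundy_vertex G z i v)"

text \<open>Color 0 stands for uncolored.\<close>
definition grundy_witness :: "'a ugraph \<Rightarrow> nat \<Rightarrow> ('a \<Rightarrow> nat) \<Rightarrow> bool" where
  "grundy_witness G k z \<longleftrightarrow> (\<forall>v \<in> verts G. z v \<le> k) \<and>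
     (\<forall>u \<in> verts G. \<forall>v \<in> verts G. {u, v} \<in> edges G \<longrightarrow> z u \<noteq> 0 \<longrightarrow> z u \<noteq> z v) \<and>
     grundy_condition G k z"

definition color_class :: "'a ugraph \<Rightarrow> ('a \<Rightarrow> nat) \<Rightarrow> nat \<Rightarrow> 'a set" where
  "color_class G z i = {v \<in> verts G. z v = i}"

lemma grundy_witnessD:
  assumes "grundy_witness G k z"
  shows grundy_witness_le: "v \<in> verts G \<Longrightarrow> z v \<le> k"
    and grundy_witness_proper:
      "u \<in> verts G \<Longrightarrow> v \<in> verts G \<Longrightarrow> {u, v} \<in> edges G \<Longrightarrow> z u \<noteq> 0 \<Longrightarrow> z u \<noteq> z v"
    and grundy_witness_condition: "grundy_condition G k z"
  using assms unfolding grundy_witness_def by blast+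

lemma partial_grundy_coloring_iff_witness:
  "partial_grundy_coloring G k c \<longleftrightarrow> (\<forall>v \<in> verts G. c v \<noteq> 0) \<and> grundy_witness G k c"
proof -
  have "(\<forall>v \<in> verts G. c v \<in> {1..k}) \<longleftrightarrow> (\<forall>v \<in> verts G. c v \<noteq> 0) \<and> (\<forall>v \<in> verts G. c v \<le> k)"
    by (auto simp: Suc_le_eq)
  then show ?thesis
    unfolding partial_grundy_coloring_def grundy_witness_def grundy_condition_def grundy_vertex_def
    by (auto simp: Bex_def)
qed

lemma grundy_vertex_mono:
  assumes "grundy_vertex G z i v" "0 < i" "\<And>u. u \<in> verts G \<Longrightarrow> z u \<noteq> 0 \<Longrightarrow> z' u = z u"
  shows "grundy_vertex G z' i v"
proof -
  have "\<exists>u \<in> verts G. {u, v} \<in> edges G \<and> z' u = j" if "j \<in> {1..<i}" for j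
    using assms(1,3) that unfolding grundy_vertex_def by fastforce
  then show ?thesis using assms by (auto simp: grundy_vertex_def)
qed

lemma grundy_condition_mono:
  assumes "grundy_condition G k z" "\<And>u. u \<in> verts G \<Longrightarrow> z u \<noteq> 0 \<Longrightarrow> z' u = z u"
  shows "grundy_condition G k z'"
  unfolding grundy_condition_def
proof
  fix i assume "i \<in> {1..k}"
  then obtain v where "grundy_vertex G z i v"
    using assms(1) unfolding grundy_condition_def by blast
  moreover have "0 < i" using \<open>i \<in> {1..k}\<close> by simp
  ultimately have "grundy_vertex G z' i v" using assms(2) by (rule grundy_vertex_mono)
  then show "\<exists>v. grundy_vertex G z' i v" ..
qed

lemma grundy_condition_cong:
  "(\<And>v. v \<in> verts G \<Longrightarrow> z v = z' v) \<Longrightarrow> grundy_condition G k z \<longleftrightarrow> grundy_condition G k z'"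
  using grundy_condition_mono[of G k z z'] grundy_condition_mono[of G k z' z] by auto

subsection \<open>Greedy extension\<close>

lemma first_fit_color:
  assumes "\<And>v. v \<in> verts G \<Longrightarrow> z v \<le> k"
  obtains c where "0 < c" "c \<le> Suc k" "\<forall>u \<in> verts G. {u, x} \<in> edges G \<longrightarrow> z u \<noteq> c"
    "\<forall>j \<in> {1..<c}. \<exists>u \<in> verts G. {u, x} \<in> edges G \<and> z u = j"
proof -
  define free where "free c \<longleftrightarrow> 0 < c \<and> (\<forall>u \<in> verts G. {u, x} \<in> edges G \<longrightarrow> z u \<noteq> c)" for c
  have "free (Suc k)" using assms by (fastforce simp: free_def)
  then have "free (LEAST c. free c)" "(LEAST c. free c) \<le> Suc k" by (rule LeastI, rule Least_le)
  moreover have "\<exists>u \<in> verts G. {u, x} \<in> edges G \<and> z u = j" if "j \<in> {1..<LEAST c. free c}" for j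
    using not_less_Least[of j free] that by (auto simp: free_def)
  ultimately show thesis using that unfolding free_def by blast
qed

text \<open>A vertex that opens a new color sees all the old ones.\<close>
lemma grundy_witness_color_vertex:
  assumes "simple_graph G" "grundy_witness G k z" "x \<in> verts G" "z x = 0"
  obtains c k' where "0 < c" "k \<le> k'" "grundy_witness G k' (z(x := c))"
proof -
  note z = grundy_witnessD[OF assms(2)]
  obtain c where c: "0 < c" "c \<le> Suc k"
    and free: "\<forall>u \<in> verts G. {u, x} \<in> edges G \<longrightarrow> z u \<noteq> c"
    and below: "\<forall>j \<in> {1..<c}. \<exists>u \<in> verts G. {u, x} \<in> edges G \<and> z u = j"
    using z(1) by (rule first_fit_color)
  let ?z = "z(x := c)"
  have loopless: "{x, x} \<notin> edges G" using assms(1) by (auto simp: simple_graph_def)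
  have "?z u \<noteq> ?z v" if "u \<in> verts G" "v \<in> verts G" "{u, v} \<in> edges G" "?z u \<noteq> 0" for u v
    using that free z(2)[of u v] z(2)[of v u] loopless
    by (auto simp: insert_commute split: if_splits)
  moreover have "grundy_condition G (max k c) ?z"
    unfolding grundy_condition_def
  proof
    fix i assume i: "i \<in> {1..max k c}"
    show "\<exists>v. grundy_vertex G ?z i v"
    proof (cases "i \<le> k")
      case True
      then show ?thesis
        using z(3) i grundy_vertex_mono[of G z i _ ?z] assms(4)
          unfolding grundy_condition_def by fastforce
    next
      case False
      then have "i = c" using i c by auto
      moreover have "\<exists>u \<in> verts G. {u, x} \<in> edges G \<and> ?z u = j" if "j \<in> {1..<c}" for j
        using bspec[OF below that] that assms(4) by fastforce
      ultimately show ?thesis using assms(3) by (auto simp: grundy_vertex_def)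
    qed
  qed
  ultimately have "grundy_witness G (max k c) ?z"
    using z(1) by (auto simp: grundy_witness_def le_max_iff_disj)
  then show thesis using that c(1) by (meson max.cobounded1)
qed

theorem grundy_witness_extend:
  assumes "simple_graph G" "grundy_witness G k z"
  shows "\<exists>k' \<ge> k. \<exists>c. partial_grundy_coloring G k' c"
  using assms(2)
proof (induction "card (color_class G z 0)" arbitrary: z k rule: less_induct)
  case less
  have fin: "finite (verts G)" using assms(1) by (simp add: simple_graph_def)
  show ?case
  proof (cases "\<exists>x \<in> verts G. z x = 0")
    case False
    then have "partial_grundy_coloring G k z"
      using less.prems by (simp add: partial_grundy_coloring_iff_witness)
    then show ?thesis by blast
  next
    case True
    then obtain x where x: "x \<in> verts G" "z x = 0" by blast
    then obtain c k' where "0 < c" "k \<le> k'" and witness: "grundy_witness G k' (z(x := c))"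
      using grundy_witness_color_vertex[OF assms(1) less.prems] by blast
    have "color_class G (z(x := c)) 0 = color_class G z 0 - {x}"
      using \<open>0 < c\<close> by (auto simp: color_class_def)
    moreover have "x \<in> color_class G z 0" "finite (color_class G z 0)"
      using x fin by (simp_all add: color_class_def)
    ultimately have "card (color_class G (z(x := c)) 0) < card (color_class G z 0)"
      by (metis card_Diff1_less)
    from less.hyps[OF this witness] show ?thesis using \<open>k \<le> k'\<close> by (meson le_trans)
  qed
qed

subsection \<open>Small witnesses\<close>

lemma partial_grundy_coloring_witness_vertices:
  assumes "partial_grundy_coloring G k' c" "k \<le> k'"
  obtains f g where "\<And>i. i \<in> {1..k} \<Longrightarrow> f i \<in> verts G \<and> c (f i) = i"
    "\<And>i j. i \<in> {1..k} \<Longrightarrow> j \<in> {1..<i} \<Longrightarrow>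
      g i j \<in> verts G \<and> {g i j, f i} \<in> edges G \<and> c (g i j) = j"
proof -
  have "\<forall>i \<in> {1..k}. \<exists>v. grundy_vertex G c i v"
    using assms
      by (simp add: partial_grundy_coloring_iff_witness grundy_witness_def grundy_condition_def)
  then obtain f where f: "\<And>i. i \<in> {1..k} \<Longrightarrow> grundy_vertex G c i (f i)" by metis
  then have "\<forall>i j. \<exists>u. i \<in> {1..k} \<longrightarrow> j \<in> {1..<i} \<longrightarrow> u \<in> verts G \<and> {u, f i} \<in> edges G \<and> c u = j"
    unfolding grundy_vertex_def by blast
  then obtain g where "\<And>i j. i \<in> {1..k} \<Longrightarrow> j \<in> {1..<i} \<Longrightarrow>
      g i j \<in> verts G \<and> {g i j, f i} \<in> edges G \<and> c (g i j) = j"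
    by metis
  then show thesis using that f unfolding grundy_vertex_def by blast
qed

lemma partial_grundy_coloring_small_witness:
  assumes "partial_grundy_coloring G k' c" "k \<le> k'"
  obtains z where "grundy_witness G k z" "\<And>i. i < k \<Longrightarrow> card (color_class G z (Suc i)) \<le> k - i"
proof -
  obtain f g where f: "\<And>i. i \<in> {1..k} \<Longrightarrow> f i \<in> verts G \<and> c (f i) = i"
    and g: "\<And>i j. i \<in> {1..k} \<Longrightarrow> j \<in> {1..<i} \<Longrightarrow>
      g i j \<in> verts G \<and> {g i j, f i} \<in> edges G \<and> c (g i j) = j"
    using partial_grundy_coloring_witness_vertices[OF assms] by blast
  define W where "W = f ` {1..k} \<union> (\<Union>i\<in>{1..k}. g i ` {1..<i})"
  define z where "z v = (if v \<in> W then c v else 0)" for v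
  have z_f: "z (f i) = i" if "i \<in> {1..k}" for i using f[OF that] that by (auto simp: z_def W_def)
  have z_g: "z (g i j) = j" if "i \<in> {1..k}" "j \<in> {1..<i}" for i j
    using g[OF that] that by (force simp: z_def W_def)
  have "grundy_vertex G z i (f i)" if "i \<in> {1..k}" for i
    using f g z_f z_g that unfolding grundy_vertex_def by blast
  moreover have "z v \<le> k" for v
    using f g by (force simp: z_def W_def)
  moreover have "z u \<noteq> z v" if "u \<in> verts G" "v \<in> verts G" "{u, v} \<in> edges G" "z u \<noteq> 0" for u v
    using assms(1) that unfolding partial_grundy_coloring_def z_def by (auto split: if_splits)
  ultimately have "grundy_witness G k z"
    unfolding grundy_witness_def grundy_condition_def by blast
  moreover have "card (color_class G z (Suc i)) \<le> k - i" if "i < k" for i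
  proof -
    let ?X = "insert (f (Suc i)) ((\<lambda>i'. g i' (Suc i)) ` {Suc i<..k})"
    have "color_class G z (Suc i) \<subseteq> ?X"
      using f g by (auto simp: color_class_def z_def W_def split: if_splits)
    then have "card (color_class G z (Suc i)) \<le> card ?X" by (intro card_mono) auto
    also have "\<dots> \<le> Suc (card ((\<lambda>i'. g i' (Suc i)) ` {Suc i<..k}))"
      by (rule card_insert_le_m1) auto
    also have "\<dots> \<le> Suc (card {Suc i<..k})" using card_image_le[of "{Suc i<..k}"] by simp
    also have "\<dots> = k - i" using that by simp
    finally show ?thesis .
  qed
  ultimately show thesis by (rule that)
qed

subsection \<open>Repairing improper colorings\<close>

definition unblock :: "'a ugraph \<Rightarrow> ('a \<Rightarrow> nat) \<Rightarrow> ('a \<Rightarrow> nat) \<Rightarrow> 'a \<Rightarrow> nat" where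
  "unblock G rk c v =
     (if \<exists>w \<in> verts G. {v, w} \<in> edges G \<and> rk v < rk w \<and> c w = c v then 0 else c v)"

lemma unblock_cong:
  "(\<And>v. v \<in> verts G \<Longrightarrow> c v = c' v) \<Longrightarrow> v \<in> verts G \<Longrightarrow> unblock G rk c v = unblock G rk c' v"
  by (auto simp: unblock_def)

lemma unblock_proper:
  assumes "simple_graph G" "inj_on rk (verts G)" "u \<in> verts G" "v \<in> verts G" "{u, v} \<in> edges G"
    and "unblock G rk c u \<noteq> 0"
  shows "unblock G rk c u \<noteq> unblock G rk c v"
proof
  assume same: "unblock G rk c u = unblock G rk c v"
  then have "c u = c v" using assms(6) by (auto simp: unblock_def split: if_splits)
  have "u \<noteq> v" using assms(1,5) by (auto simp: simple_graph_def)
  then have "rk u \<noteq> rk v" using assms(2-4) by (meson inj_onD)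
  then consider "rk u < rk v" | "rk v < rk u" by linarith
  then have "unblock G rk c u = 0 \<or> unblock G rk c v = 0"
  proof cases
    case 1
    then show ?thesis using assms(4,5) \<open>c u = c v\<close> by (auto simp: unblock_def)
  next
    case 2
    then show ?thesis using assms(3,5) \<open>c u = c v\<close> by (auto simp: unblock_def insert_commute)
  qed
  then show False using same assms(6) by auto
qed

lemma grundy_witness_unblock:
  assumes "simple_graph G" "inj_on rk (verts G)" "\<And>v. v \<in> verts G \<Longrightarrow> c v \<le> k"
    and "grundy_condition G k (unblock G rk c)"
  shows "grundy_witness G k (unblock G rk c)"
proof -
  have "unblock G rk c v \<le> k" if "v \<in> verts G" for v
    using assms(3)[OF that] by (simp add: unblock_def)
  then show ?thesis
    using assms(4) unblock_proper[OF assms(1,2)] unfolding grundy_witness_def by blast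
qed

lemma grundy_condition_unblock:
  assumes "grundy_condition G k z"
    and agree: "\<And>v. v \<in> verts G \<Longrightarrow> z v \<noteq> 0 \<Longrightarrow> c v = z v"
    and unblocked: "\<And>v w. v \<in> verts G \<Longrightarrow> w \<in> verts G \<Longrightarrow> z v \<noteq> 0 \<Longrightarrow> {v, w} \<in> edges G \<Longrightarrow>
      rk v < rk w \<Longrightarrow> c w \<noteq> z v"
  shows "grundy_condition G k (unblock G rk c)"
proof (rule grundy_condition_mono[OF assms(1)])
  fix v assume v: "v \<in> verts G" "z v \<noteq> 0"
  then have "c v = z v" and "\<not> (\<exists>w \<in> verts G. {v, w} \<in> edges G \<and> rk v < rk w \<and> c w = c v)"
    using agree unblocked by auto
  then show "unblock G rk c v = z v" unfolding unblock_def by (simp only: if_False)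
qed

lemma grundy_condition_unblock_last_true:
  assumes wit: "grundy_witness G k z"
    and own: "\<And>i v. i < k \<Longrightarrow> v \<in> color_class G z (Suc i) \<Longrightarrow> Q i v"
    and other: "\<And>i j v. i < k \<Longrightarrow> j < k \<Longrightarrow> j \<noteq> i \<Longrightarrow> v \<in> color_class G z (Suc j) \<Longrightarrow> \<not> Q i v"
    and later: "\<And>i v w. i < k \<Longrightarrow> v \<in> color_class G z (Suc i) \<Longrightarrow> w \<in> verts G \<Longrightarrow>
      {v, w} \<in> edges G \<Longrightarrow> rk v < rk w \<Longrightarrow> \<not> Q i w"
  shows "grundy_condition G k (unblock G rk (\<lambda>v. last_true (\<lambda>i. Q i v) k))"
proof (rule grundy_condition_unblock[OF grundy_witness_condition[OF wit]])
  fix v assume v: "v \<in> verts G" "z v \<noteq> 0"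
  then obtain i where i: "z v = Suc i" "i < k"
    using grundy_witness_le[OF wit, of v] by (cases "z v") auto
  have "v \<in> color_class G z (Suc i)" using v i by (simp add: color_class_def)
  then show "last_true (\<lambda>i. Q i v) k = z v"
    unfolding i(1) using own[OF i(2)] other[OF _ i(2)] by (intro last_true_unique[OF i(2)]) blast
  show "last_true (\<lambda>i. Q i w) k \<noteq> z v" if "w \<in> verts G" "{v, w} \<in> edges G" "rk v < rk w" for w
    using later[OF i(2) \<open>v \<in> color_class G z (Suc i)\<close> that]
      last_true_eq_SucD[of "\<lambda>i. Q i w" k i] i(1)
    by auto
qed

section \<open>Degeneracy orders and bicliques\<close>

definition degeneracy_ranking :: "nat \<Rightarrow> 'a ugraph \<Rightarrow> ('a \<Rightarrow> nat) \<Rightarrow> bool" where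
  "degeneracy_ranking d H rk \<longleftrightarrow> inj_on rk (verts H) \<and>
     (\<forall>v \<in> verts H. card {w \<in> verts H. {v, w} \<in> edges H \<and> rk v < rk w} \<le> d)"

text \<open>The vertices of rank 0 are those that have not been removed yet.\<close>
definition removable :: "nat \<Rightarrow> 'a ugraph \<Rightarrow> ('a \<Rightarrow> nat) \<Rightarrow> 'a \<Rightarrow> bool" where
  "removable d H rk v \<longleftrightarrow>
     v \<in> verts H \<and> rk v = 0 \<and> card {w \<in> verts H. {v, w} \<in> edges H \<and> rk w = 0} \<le> d"

definition partial_ranking :: "nat \<Rightarrow> 'a ugraph \<Rightarrow> nat \<Rightarrow> ('a \<Rightarrow> nat) \<Rightarrow> bool" where
  "partial_ranking d H r rk \<longleftrightarrow> card {v \<in> verts H. rk v = 0} + r = card (verts H) \<and>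
     (\<forall>v \<in> verts H. rk v \<le> r) \<and> inj_on rk {v \<in> verts H. rk v \<noteq> 0} \<and>
     (\<forall>v \<in> verts H. rk v \<noteq> 0 \<longrightarrow>
        card {w \<in> verts H. {v, w} \<in> edges H \<and> (rk w = 0 \<or> rk v < rk w)} \<le> d)"

lemma degenerate_low_degree:
  assumes "degenerate d G" "simple_graph G" "U \<subseteq> verts G" "U \<noteq> {}"
  obtains v where "v \<in> U" "card {w \<in> U. {v, w} \<in> edges G} \<le> d"
proof -
  define H where "H = \<lparr>verts = U, edges = {e \<in> edges G. e \<subseteq> U}\<rparr>"
  have U: "finite U" using assms(2,3) by (auto simp: simple_graph_def intro: finite_subset)
  then have "subgraph H G"
    using assms(2,3) by (auto simp: subgraph_def simple_graph_def H_def)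
  moreover have "verts H = U" by (simp add: H_def)
  ultimately obtain v where v: "v \<in> U" "degree H v \<le> d"
    using assms(1,4) unfolding degenerate_def by blast
  have "(\<lambda>w. {v, w}) ` {w \<in> U. {v, w} \<in> edges G} \<subseteq> {e \<in> edges H. v \<in> e}"
    using v by (auto simp: H_def)
  moreover have "finite {e \<in> edges H. v \<in> e}"
    by (rule finite_subset[of _ "Pow U"]) (use U in \<open>auto simp: H_def\<close>)
  moreover have "inj_on (\<lambda>w. {v, w}) {w \<in> U. {v, w} \<in> edges G}"
    by (auto simp: inj_on_def doubleton_eq_iff)
  ultimately have "card {w \<in> U. {v, w} \<in> edges G} \<le> degree H v"
    unfolding degree_def by (metis (lifting) card_image card_mono)
  then show thesis using v that by (meson le_trans)
qed

lemma ex_removable: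
  assumes "degenerate d H" "simple_graph H" "partial_ranking d H r rk" "r < card (verts H)"
  shows "\<exists>v. removable d H rk v"
proof -
  have "{v \<in> verts H. rk v = 0} \<noteq> {}"
  proof
    assume "{v \<in> verts H. rk v = 0} = {}"
    then have "card {v \<in> verts H. rk v = 0} = 0" by (simp only: card.empty)
    then show False using assms(3,4) by (simp add: partial_ranking_def)
  qed
  then obtain v where "v \<in> {v \<in> verts H. rk v = 0}"
    "card {w \<in> {v \<in> verts H. rk v = 0}. {v, w} \<in> edges H} \<le> d"
    using degenerate_low_degree[OF assms(1,2), of "{v \<in> verts H. rk v = 0}"] by blast
  then show ?thesis by (auto simp: removable_def conj_ac)
qed

lemma partial_ranking_0: "(\<And>v. rk v = 0) \<Longrightarrow> partial_ranking d H 0 rk"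
  by (simp add: partial_ranking_def)

lemma partial_ranking_Suc:
  assumes fin: "finite (verts H)" and rk: "partial_ranking d H r rk" and v: "removable d H rk v"
  shows "partial_ranking d H (Suc r) (rk(v := Suc r))"
proof -
  let ?rk = "rk(v := Suc r)"
  let ?later = "\<lambda>rk u. {w \<in> verts H. {u, w} \<in> edges H \<and> (rk w = 0 \<or> rk u < rk w)}"
  have unranked: "v \<in> verts H" "rk v = 0" and rank_le: "\<And>u. u \<in> verts H \<Longrightarrow> rk u \<le> r"
    using rk v by (auto simp: partial_ranking_def removable_def)
  have "{u \<in> verts H. rk u = 0} = insert v {u \<in> verts H. ?rk u = 0}" using unranked by auto
  moreover have "v \<notin> {u \<in> verts H. ?rk u = 0}" by simp
  ultimately have "card {u \<in> verts H. ?rk u = 0} + Suc r = card (verts H)"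
    using rk fin by (simp add: partial_ranking_def)
  moreover have "inj_on ?rk {u \<in> verts H. ?rk u \<noteq> 0}"
  proof (rule inj_onI)
    fix x y assume "x \<in> {u \<in> verts H. ?rk u \<noteq> 0}" "y \<in> {u \<in> verts H. ?rk u \<noteq> 0}" "?rk x = ?rk y"
    then show "x = y" using rank_le[of x] rank_le[of y] inj_onD[of rk _ x y] rk
      by (auto simp: partial_ranking_def split: if_splits)
  qed
  moreover have "card (?later ?rk u) \<le> d" if u: "u \<in> verts H" "?rk u \<noteq> 0" for u
  proof (cases "u = v")
    case True
    have "\<not> Suc r < rk w" if "w \<in> verts H" for w using rank_le[OF that] by simp
    then have "?later ?rk v \<subseteq> {w \<in> verts H. {v, w} \<in> edges H \<and> rk w = 0}"
      using unranked by (auto split: if_splits)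
    then have "card (?later ?rk v) \<le> card {w \<in> verts H. {v, w} \<in> edges H \<and> rk w = 0}"
      using fin by (intro card_mono) auto
    then show ?thesis using True v by (simp add: removable_def)
  next
    case False
    then have "?later ?rk u \<subseteq> ?later rk u" using unranked by auto
    then have "card (?later ?rk u) \<le> card (?later rk u)" using fin by (intro card_mono) auto
    also have "\<dots> \<le> d" using rk u False by (simp add: partial_ranking_def)
    finally show ?thesis .
  qed
  ultimately show ?thesis using rank_le by (simp add: partial_ranking_def le_SucI)
qed

lemma degeneracy_ranking_if_partial_ranking:
  assumes "finite (verts H)" "partial_ranking d H (card (verts H)) rk"
  shows "degeneracy_ranking d H rk"
proof -
  have nonzero: "rk v \<noteq> 0" if "v \<in> verts H" for v
    using assms that by (auto simp: partial_ranking_def)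
  then have "{v \<in> verts H. rk v \<noteq> 0} = verts H" by blast
  moreover have "{w \<in> verts H. {v, w} \<in> edges H \<and> (rk w = 0 \<or> rk v < rk w)} =
      {w \<in> verts H. {v, w} \<in> edges H \<and> rk v < rk w}" for v
    using nonzero by blast
  ultimately show ?thesis
    using assms(2) nonzero unfolding partial_ranking_def degeneracy_ranking_def by simp
qed

lemma simple_graph_delete_edges: "simple_graph G \<Longrightarrow> simple_graph (delete_edges G F)"
  by (simp add: simple_graph_def delete_edges_def)

lemma biclique_edge_iff:
  assumes "edges A = {{u, v} | u v. u \<in> L \<and> v \<in> R}"
  shows "{u, v} \<in> edges A \<longleftrightarrow> u \<in> L \<and> v \<in> R \<or> u \<in> R \<and> v \<in> L"
  unfolding assms by (auto simp: doubleton_eq_iff)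

lemma biclique_ex_edge: "biclique A \<Longrightarrow> \<exists>u v. {u, v} \<in> edges A"
  unfolding biclique_def by (elim exE conjE) fastforce

lemma
  assumes "biclique A" "{s, r} \<in> edges A"
  shows biclique_join: "{s, u} \<in> edges A \<Longrightarrow> {r, v} \<in> edges A \<Longrightarrow> {u, v} \<in> edges A"
    and biclique_cover: "{u, v} \<in> edges A \<Longrightarrow> {s, u} \<in> edges A \<or> {s, v} \<in> edges A"
proof -
  from assms(1) obtain L R where LR: "L \<inter> R = {}" "edges A = {{u, v} | u v. u \<in> L \<and> v \<in> R}"
    unfolding biclique_def by (elim exE conjE)
  note iff = biclique_edge_iff[OF LR(2)]
  have "s \<in> L \<and> r \<in> R \<or> s \<in> R \<and> r \<in> L" using assms(2) by (simp add: iff)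
  then show "{s, u} \<in> edges A \<Longrightarrow> {r, v} \<in> edges A \<Longrightarrow> {u, v} \<in> edges A"
    "{u, v} \<in> edges A \<Longrightarrow> {s, u} \<in> edges A \<or> {s, v} \<in> edges A"
    using LR(1) by (auto simp: iff)
qed

lemma biclique_independent_avoids_side:
  assumes "biclique A" "{s, r} \<in> edges A" "\<And>u v. u \<in> X \<Longrightarrow> v \<in> X \<Longrightarrow> {u, v} \<notin> edges A"
  shows "(\<forall>v \<in> X. {s, v} \<notin> edges A) \<or> (\<forall>v \<in> X. {r, v} \<notin> edges A)"
proof (rule ccontr)
  assume "\<not> ?thesis"
  then obtain u v where "u \<in> X" "{s, u} \<in> edges A" "v \<in> X" "{r, v} \<in> edges A" by blast
  then show False using biclique_join[OF assms(1,2)] assms(3) by metis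
qed

section \<open>Guesses\<close>

subsection \<open>Explicit lists of color classes\<close>

primrec listed_coloring :: "nat \<Rightarrow> (nat \<Rightarrow> 'a) \<Rightarrow> nat \<Rightarrow> 'a \<Rightarrow> nat" where
  "listed_coloring k f 0 = (\<lambda>_. 0)"
| "listed_coloring k f (Suc p) = (listed_coloring k f p)(f p := Suc (p div k))"

lemma listed_coloring_le: "p \<le> k * k \<Longrightarrow> listed_coloring k f p v \<le> k"
  by (induction p) (auto simp: Suc_le_eq less_mult_imp_div_less)

lemma listed_coloring_cong:
  "(\<And>q. q < p \<Longrightarrow> f q = g q) \<Longrightarrow> listed_coloring k f p = listed_coloring k g p"
  by (induction p) auto

lemma listed_coloring_eq:
  "(\<And>q. q < p \<Longrightarrow> f q = v \<Longrightarrow> Suc (q div k) = c) \<Longrightarrow>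
    listed_coloring k f p v = (if v \<in> f ` {..<p} then c else 0)"
  by (induction p) (auto simp: lessThan_Suc)

lemma ex_enumeration_with_repetition:
  assumes "finite X" "X \<noteq> {}" "card X \<le> k"
  shows "\<exists>f. f ` {..<k} = X"
proof -
  obtain h where h: "bij_betw h {0..<card X} X" using ex_bij_betw_nat_finite[OF assms(1)] by blast
  have "0 < card X" using assms(1,2) by (simp add: card_gt_0_iff)
  moreover have "j \<in> (\<lambda>j. min j (card X - 1)) ` {..<k}" if "j < card X" for j
    using that assms(3) by (intro image_eqI[of _ _ j]) auto
  ultimately have "(\<lambda>j. min j (card X - 1)) ` {..<k} = {0..<card X}" by auto
  then have "(\<lambda>j. h (min j (card X - 1))) ` {..<k} = X"
    using h by (metis bij_betw_imp_surj_on image_image)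
  then show ?thesis by blast
qed

lemma ex_listed_coloring_eq:
  assumes wit: "grundy_witness G k z" and fin: "finite (verts G)"
    and small: "\<And>i. i < k \<Longrightarrow> card (color_class G z (Suc i)) \<le> k"
  shows "\<exists>F. F ` {..<k * k} \<subseteq> verts G \<and> (\<forall>v \<in> verts G. listed_coloring k F (k * k) v = z v)"
proof -
  have "\<exists>f. f ` {..<k} = color_class G z (Suc i)" if "i < k" for i
  proof (rule ex_enumeration_with_repetition)
    have "Suc i \<in> {1..k}" using that by simp
    then show "color_class G z (Suc i) \<noteq> {}"
      using grundy_witness_condition[OF wit]
      unfolding grundy_condition_def grundy_vertex_def color_class_def by blast
  qed (use fin small[OF that] in \<open>simp_all add: color_class_def\<close>)
  then obtain f where f: "\<And>i. i < k \<Longrightarrow> f i ` {..<k} = color_class G z (Suc i)" by metis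
  define F where "F p = f (p div k) (p mod k)" for p
  have F: "F p \<in> color_class G z (Suc (p div k))" if "p < k * k" for p
    using f[of "p div k"] that by (cases "k = 0") (auto simp: F_def less_mult_imp_div_less)
  have "listed_coloring k F (k * k) v = z v" if v: "v \<in> verts G" for v
  proof -
    have "listed_coloring k F (k * k) v = (if v \<in> F ` {..<k * k} then z v else 0)"
      using F by (intro listed_coloring_eq) (auto simp: color_class_def)
    moreover have "v \<in> F ` {..<k * k}" if "z v \<noteq> 0"
    proof -
      obtain i where i: "z v = Suc i" "i < k"
        using \<open>z v \<noteq> 0\<close> grundy_witness_le[OF wit v] by (cases "z v") auto
      then have "v \<in> f i ` {..<k}" using f[OF i(2)] v by (simp add: color_class_def)
      then obtain j where "j < k" "v = f i j" by auto
      then have "v = F (i * k + j)" by (simp add: F_def)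
      moreover have "i * k + j < Suc i * k" using \<open>j < k\<close> by simp
      then have "i * k + j < k * k" using i(2) by (meson Suc_leI less_le_trans mult_le_mono1)
      ultimately show ?thesis by blast
    qed
    ultimately show ?thesis by auto
  qed
  moreover have "F ` {..<k * k} \<subseteq> verts G" using F by (auto simp: color_class_def)
  ultimately show ?thesis by blast
qed

subsection \<open>Hashed color classes\<close>

lemma mult_add_less:
  fixes c :: nat
  assumes "i < m" "j < c"
  shows "i * c + j < m * c"
proof -
  have "i * c + j < Suc i * c" using assms(2) by simp
  also have "\<dots> \<le> m * c" using assms(1) by (intro mult_le_mono1) simp
  finally show ?thesis .
qed

lemma sum_descending: "(\<Sum>i<k. k - i) = k * Suc k div (2::nat)"
proof -
  have "(\<Sum>i<k. k - i) = (\<Sum>i<k. Suc i)"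
    by (rule sum.reindex_bij_witness[of _ "\<lambda>i. k - Suc i" "\<lambda>i. k - Suc i"]) auto
  also have "\<dots> = k * Suc k div 2" by (induction k) auto
  finally show ?thesis .
qed

locale spgc_parameters =
  fixes n k d l :: nat
  assumes k_pos: "0 < k" and d_pos: "0 < d" and l_pos: "0 < l" and two_le_n: "2 \<le> n"
begin

text \<open>Each color is separated from at most \<open>k d + k\<^sup>2\<close> vertices, in at most \<open>2 d k\<^sup>3\<close> pairs; as
  each pair excludes a fraction \<open>5 / M\<close> of the multipliers, range \<open>13 d k\<^sup>3\<close> suffices for one
  color and \<open>13 d k\<^sup>4\<close> for all.\<close>
definition block_size :: nat where
  "block_size = 13 * d * k * k"

definition inner_range :: nat where
  "inner_range = k * block_size"

definition outer_range :: nat where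
  "outer_range = k * inner_range"

definition inner_modulus :: nat where
  "inner_modulus = inner_range * outer_range"

definition outer_modulus :: nat where
  "outer_modulus = outer_range * n"

definition cell :: "nat \<Rightarrow> (nat \<Rightarrow> nat) \<Rightarrow> nat \<Rightarrow> nat \<Rightarrow> nat" where
  "cell a0 a i v =
     i * inner_range + mult_hash inner_range outer_range (a i) (mult_hash outer_range n a0 v)"

lemmas size_defs = block_size_def inner_range_def outer_range_def inner_modulus_def
  outer_modulus_def

lemma sizes_pos:
  shows n_pos: "0 < n" and block_size_pos: "0 < block_size" and inner_range_pos: "0 < inner_range"
    and outer_range_pos: "0 < outer_range" and inner_modulus_pos: "0 < inner_modulus"
    and outer_modulus_pos: "0 < outer_modulus"
  using k_pos d_pos two_le_n by (simp_all add: size_defs)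

lemma cell_less: "i < k \<Longrightarrow> cell a0 a i v < k * inner_range"
  unfolding cell_def by (intro mult_add_less mult_hash_less sizes_pos)

lemma cell_eq_imp_color_eq:
  assumes "cell a0 a i v = cell a0 a j w"
  shows "i = j"
proof -
  have "cell a0 a i v div inner_range = i" for i v
    using mult_hash_less sizes_pos by (simp add: cell_def)
  then show ?thesis using assms by metis
qed

lemma ex_outer_multiplier:
  assumes fin: "\<And>i. i < k \<Longrightarrow> finite (P i)"
    and card: "\<And>i. i < k \<Longrightarrow> card (P i) \<le> 2 * d * k * k * k"
    and P: "\<And>i x y. i < k \<Longrightarrow> (x, y) \<in> P i \<Longrightarrow> x < n \<and> y < n \<and> x \<noteq> y"
  obtains a where "a < outer_modulus"
    "\<And>i x y. i < k \<Longrightarrow> (x, y) \<in> P i \<Longrightarrow> mult_hash outer_range n a x \<noteq> mult_hash outer_range n a y"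
proof -
  have range: "5 * (2 * d * k * k * k) < inner_range" "k * inner_range = outer_range"
    using k_pos d_pos by (simp_all add: size_defs)
  have "card (\<Union>i<k. P i) \<le> (\<Sum>i<k. card (P i))" by (rule card_UN_le) simp
  also have "\<dots> \<le> (\<Sum>i<k. 2 * d * k * k * k)" using card by (intro sum_mono) auto
  finally have "card (\<Union>i<k. P i) \<le> k * (2 * d * k * k * k)" by simp
  then have "5 * card (\<Union>i<k. P i) \<le> k * (5 * (2 * d * k * k * k))" by linarith
  also have "\<dots> < k * inner_range" using range(1) k_pos by simp
  finally have "5 * card (\<Union>i<k. P i) < outer_range" by (simp add: range(2))
  then obtain a where "a < outer_modulus"
    "\<And>x y. (x, y) \<in> (\<Union>i<k. P i) \<Longrightarrow> mult_hash outer_range n a x \<noteq> mult_hash outer_range n a y"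
    unfolding outer_modulus_def
    using mult_hash_separates[of "\<Union>i<k. P i" n outer_range] fin P n_pos by blast
  then show thesis by (intro that) auto
qed

lemma ex_inner_multiplier:
  assumes "finite P" "card P \<le> 2 * d * k * k * k"
    and "\<And>x y. (x, y) \<in> P \<Longrightarrow> x < outer_range \<and> y < outer_range \<and> x \<noteq> y"
  shows "\<exists>a<inner_modulus. \<forall>(x, y) \<in> P.
    mult_hash inner_range outer_range a x \<noteq> mult_hash inner_range outer_range a y"
proof -
  have "5 * (2 * d * k * k * k) < inner_range" using k_pos d_pos by (simp add: size_defs)
  then have "5 * card P < inner_range" using assms(2) by linarith
  then obtain a where "a < inner_modulus"
    "\<And>x y. (x, y) \<in> P \<Longrightarrow>
      mult_hash inner_range outer_range a x \<noteq> mult_hash inner_range outer_range a y"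
    unfolding inner_modulus_def
    using mult_hash_separates[of P outer_range inner_range] assms(1,3) outer_range_pos by blast
  then show ?thesis by (auto intro!: exI[of _ a])
qed

lemma ex_separating_cells:
  assumes fin: "\<And>i. i < k \<Longrightarrow> finite (P i)"
    and card: "\<And>i. i < k \<Longrightarrow> card (P i) \<le> 2 * d * k * k * k"
    and P: "\<And>i x y. i < k \<Longrightarrow> (x, y) \<in> P i \<Longrightarrow> x < n \<and> y < n \<and> x \<noteq> y"
  obtains a0 a where "a0 < outer_modulus" "\<And>i. i < k \<Longrightarrow> a i < inner_modulus"
    "\<And>i x y. i < k \<Longrightarrow> (x, y) \<in> P i \<Longrightarrow> cell a0 a i x \<noteq> cell a0 a i y"
proof -
  obtain a0 where a0: "a0 < outer_modulus" "\<And>i x y. i < k \<Longrightarrow> (x, y) \<in> P i \<Longrightarrow>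
      mult_hash outer_range n a0 x \<noteq> mult_hash outer_range n a0 y"
    by (rule ex_outer_multiplier[OF fin card P]) (assumption | rule that)+
  define h where "h = mult_hash outer_range n a0"
  have "\<exists>a<inner_modulus. \<forall>(x, y) \<in> map_prod h h ` P i.
      mult_hash inner_range outer_range a x \<noteq> mult_hash inner_range outer_range a y"
    if "i < k" for i
  proof (rule ex_inner_multiplier)
    show "card (map_prod h h ` P i) \<le> 2 * d * k * k * k"
      using card_image_le[OF fin[OF that], of "map_prod h h"] card[OF that] by linarith
    show "u < outer_range \<and> v < outer_range \<and> u \<noteq> v" if "(u, v) \<in> map_prod h h ` P i" for u v
      using that \<open>i < k\<close> a0(2) mult_hash_less sizes_pos by (auto simp: h_def)
  qed (simp add: fin[OF that])
  then obtain a where "\<And>i. i < k \<Longrightarrow> a i < inner_modulus \<and> (\<forall>(x, y) \<in> map_prod h h ` P i.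
      mult_hash inner_range outer_range (a i) x \<noteq> mult_hash inner_range outer_range (a i) y)"
    by metis
  then show thesis using that[OF a0(1), of a] by (fastforce simp: cell_def h_def)
qed

definition hashed_guesses :: nat where
  "hashed_guesses =
    outer_modulus * inner_modulus ^ k * 2 ^ (l * k) *
      2 ^ (2 * k * k) * block_size ^ (k * Suc k div 2)"

definition outer_multiplier :: "nat \<Rightarrow> nat" where
  "outer_multiplier e = e mod outer_modulus"

definition inner_multiplier :: "nat \<Rightarrow> nat \<Rightarrow> nat" where
  "inner_multiplier e i = e div outer_modulus div inner_modulus ^ i mod inner_modulus"

definition side_bit :: "nat \<Rightarrow> nat \<Rightarrow> nat" where
  "side_bit e y = e div outer_modulus div inner_modulus ^ k div 2 ^ y mod 2"

definition marked_cells :: "nat \<Rightarrow> nat set" where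
  "marked_cells e =
    decode_marks block_size (2 * k * k)
      (e div outer_modulus div inner_modulus ^ k div 2 ^ (l * k)) 0"

abbreviation "marked e i v \<equiv> cell (outer_multiplier e) (inner_multiplier e) i v \<in> marked_cells e"

lemma side_bit_less_2: "side_bit e y < 2"
  by (simp add: side_bit_def)

lemma ex_mark_code:
  assumes "S \<subseteq> {..<k * inner_range}" "card S \<le> k * Suc k div 2"
  obtains e where "e < 2 ^ (2 * k * k) * block_size ^ (k * Suc k div 2)"
    "decode_marks block_size (2 * k * k) e 0 = S"
proof -
  have half: "k * Suc k div 2 \<le> k * k" using k_pos by (induction k) auto
  have "S \<subseteq> {0 * block_size..<(0 + k * k) * block_size}"
    using assms(1) by (auto simp: inner_range_def mult.assoc)
  moreover have "k * k + card S \<le> 2 * k * k" using assms(2) half by linarith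
  ultimately obtain e where e: "e < 2 ^ (2 * k * k) * block_size ^ card S"
    "decode_marks block_size (2 * k * k) e 0 = S"
    using decode_marks_onto by blast
  have "block_size ^ card S \<le> block_size ^ (k * Suc k div 2)"
    using assms(2) block_size_pos by (intro power_increasing) auto
  then have "e < 2 ^ (2 * k * k) * block_size ^ (k * Suc k div 2)"
    using e(1) by (meson mult_le_mono2 order_less_le_trans)
  then show thesis using e(2) that by blast
qed

lemma ex_guess:
  assumes a0: "a0 < outer_modulus" and a: "\<And>i. i < k \<Longrightarrow> a i < inner_modulus"
    and g: "\<And>y. y < l * k \<Longrightarrow> g y < 2"
    and S: "S \<subseteq> {..<k * inner_range}" "card S \<le> k * Suc k div 2"
  obtains e where "e < hashed_guesses" "outer_multiplier e = a0"
    "\<And>i. i < k \<Longrightarrow> inner_multiplier e i = a i" "\<And>y. y < l * k \<Longrightarrow> side_bit e y = g y"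
    "marked_cells e = S"
proof -
  let ?marks = "2 ^ (2 * k * k) * block_size ^ (k * Suc k div 2)"
  obtain e3 where e3: "e3 < ?marks" "decode_marks block_size (2 * k * k) e3 0 = S"
    using ex_mark_code[OF S] by blast
  obtain e2 where e2: "e2 < 2 ^ (l * k) * Suc e3" "\<And>y. y < l * k \<Longrightarrow> e2 div 2 ^ y mod 2 = g y"
    "e2 div 2 ^ (l * k) = e3"
    using ex_digits[of "l * k" g 2 e3] g by blast
  obtain e1 where e1: "e1 < inner_modulus ^ k * Suc e2"
    "\<And>i. i < k \<Longrightarrow> e1 div inner_modulus ^ i mod inner_modulus = a i" "e1 div inner_modulus ^ k = e2"
    using ex_digits[of k a inner_modulus e2] a by blast
  define e where "e = a0 + outer_modulus * e1"
  have e: "e mod outer_modulus = a0" "e div outer_modulus = e1" using a0 by (simp_all add: e_def)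
  have "e < outer_modulus * Suc e1" using a0 by (simp add: e_def)
  also have "\<dots> \<le> outer_modulus * (inner_modulus ^ k * Suc e2)"
    using e1(1) by (intro mult_le_mono2) simp
  also have "\<dots> \<le> outer_modulus * (inner_modulus ^ k * (2 ^ (l * k) * Suc e3))"
    using e2(1) by (intro mult_le_mono2) simp
  also have "\<dots> \<le> outer_modulus * (inner_modulus ^ k * (2 ^ (l * k) * ?marks))"
    using e3(1) by (intro mult_le_mono2) simp
  finally have "e < hashed_guesses" by (simp only: hashed_guesses_def mult.assoc)
  then show thesis
    using that[of e] e e1(2,3) e2(2,3) e3(2)
    by (simp add: outer_multiplier_def inner_multiplier_def side_bit_def marked_cells_def)
qed

definition direct :: bool where
  "direct \<longleftrightarrow> n ^ (2 * k) \<le> 2 ^ l"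

definition num_guesses :: nat where
  "num_guesses = (if direct then n ^ (k * k) else hashed_guesses)"

lemma hashed_guesses_pos: "0 < hashed_guesses"
  using sizes_pos by (simp add: hashed_guesses_def)

lemma num_guesses_pos: "0 < num_guesses"
  using two_le_n hashed_guesses_pos by (simp add: num_guesses_def)

end

section \<open>Instances and their guessed colorings\<close>

locale spgc_instance =
  fixes x :: spgc_input
  assumes valid: "spgc_valid x"
begin

abbreviation "k \<equiv> colors x"
abbreviation "d \<equiv> degeneracy x"
abbreviation "l \<equiv> length (bicliques x)"
abbreviation "n \<equiv> num_vertices x"
abbreviation "G \<equiv> graph x"
abbreviation "A t \<equiv> bicliques x ! t"
abbreviation "H \<equiv> delete_edges G (\<Union>A \<in> set (bicliques x). edges A)"

lemma simple_graph_G: "simple_graph G"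
  and verts_G: "verts G = {..<n}"
  and degenerate_H: "degenerate d H"
  using valid by (auto simp: spgc_valid_def)

lemma verts_H: "verts H = {..<n}"
  by (simp add: delete_edges_def verts_G)

lemma edges_H_iff: "e \<in> edges H \<longleftrightarrow> e \<in> edges G \<and> (\<forall>t<l. e \<notin> edges (A t))"
  by (simp add: delete_edges_def all_set_conv_all_nth)

lemma biclique_A: "t < l \<Longrightarrow> biclique (A t)"
  and edges_A_subset: "t < l \<Longrightarrow> edges (A t) \<subseteq> edges G"
  using valid by (auto simp: spgc_valid_def subgraph_def)

lemma edge_G_distinct:
  assumes "{u, v} \<in> edges G"
  shows "u < n" "v < n" "u \<noteq> v"
proof -
  have edge: "{u, v} \<subseteq> verts G \<and> card {u, v} = 2"
    using assms simple_graph_G unfolding simple_graph_def by blast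
  then show "u < n" "v < n" by (simp_all add: verts_G)
  from edge show "u \<noteq> v" by auto
qed

lemma ex_edge_A:
  assumes "t < l"
  obtains u v where "u < n" "v < n" "u \<noteq> v" "{u, v} \<in> edges (A t)"
proof -
  obtain u v where "{u, v} \<in> edges (A t)" using biclique_ex_edge[OF biclique_A[OF assms]] by blast
  moreover from this have "{u, v} \<in> edges G" using edges_A_subset[OF assms] by blast
  ultimately show thesis using that edge_G_distinct by blast
qed

sublocale spgc_parameters n k d l
proof
  show "0 < k" "0 < d" "0 < l" using valid by (simp_all add: spgc_valid_def)
  then obtain u v where "u < n" "v < n" "u \<noteq> v" using ex_edge_A by blast
  then show "2 \<le> n" by linarith
qed

definition edge_at :: "(nat \<Rightarrow> nat) \<Rightarrow> nat \<Rightarrow> bool" where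
  "edge_at ep t \<longleftrightarrow>
    ep (2 * t) < n \<and> ep (2 * t + 1) < n \<and> {ep (2 * t), ep (2 * t + 1)} \<in> edges (A t)"

definition endpoints :: "(nat \<Rightarrow> nat) \<Rightarrow> bool" where
  "endpoints ep \<longleftrightarrow> (\<forall>t<l. edge_at ep t)"

definition allowed :: "(nat \<Rightarrow> nat) \<Rightarrow> nat \<Rightarrow> nat \<Rightarrow> nat \<Rightarrow> bool" where
  "allowed ep e i v \<longleftrightarrow> (\<forall>t<l. {ep (2 * t + side_bit e (t * k + i)), v} \<notin> edges (A t))"

definition hashed_coloring :: "(nat \<Rightarrow> nat) \<Rightarrow> nat \<Rightarrow> nat \<Rightarrow> nat" where
  "hashed_coloring ep e v = last_true (\<lambda>i. marked e i v \<and> allowed ep e i v) k"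

definition guessed_coloring :: "(nat \<Rightarrow> nat) \<Rightarrow> nat \<Rightarrow> nat \<Rightarrow> nat" where
  "guessed_coloring ep e =
    (if direct then listed_coloring k (\<lambda>p. e div n ^ p mod n) (k * k) else hashed_coloring ep e)"

definition success :: "(nat \<Rightarrow> nat) \<Rightarrow> (nat \<Rightarrow> nat) \<Rightarrow> nat \<Rightarrow> bool" where
  "success rk ep e \<longleftrightarrow> grundy_condition G k (unblock G rk (guessed_coloring ep e))"

lemma success_sound:
  assumes "degeneracy_ranking d H rk" "success rk ep e"
  shows "spgc_yes x"
proof -
  have "inj_on rk (verts G)" using assms(1) by (simp add: degeneracy_ranking_def verts_H verts_G)
  moreover have "guessed_coloring ep e v \<le> k" for v
    by (simp add: guessed_coloring_def hashed_coloring_def listed_coloring_le last_true_le)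
  ultimately have "grundy_witness G k (unblock G rk (guessed_coloring ep e))"
    using grundy_witness_unblock[OF simple_graph_G] assms(2) by (simp add: success_def)
  then show ?thesis unfolding spgc_yes_def using grundy_witness_extend[OF simple_graph_G] by blast
qed

context
  fixes rk ep z
  assumes rk: "degeneracy_ranking d H rk" and ep: "endpoints ep"
    and wit: "grundy_witness G k z"
    and small: "\<And>i. i < k \<Longrightarrow> card (color_class G z (Suc i)) \<le> k - i"
begin

lemma listed_guess_succeeds:
  assumes direct
  shows "\<exists>e<num_guesses. success rk ep e"
proof -
  have "card (color_class G z (Suc i)) \<le> k" if "i < k" for i using small[OF that] by simp
  then obtain F where F: "F ` {..<k * k} \<subseteq> verts G"
    "\<And>v. v \<in> verts G \<Longrightarrow> listed_coloring k F (k * k) v = z v"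
    using ex_listed_coloring_eq[OF wit] by (metis finite_lessThan verts_G)
  then have "F p < n" if "p < k * k" for p using that by (auto simp: verts_G)
  then obtain e where e: "e < n ^ (k * k) * Suc 0" "\<forall>p<k * k. e div n ^ p mod n = F p"
    using ex_digits[of "k * k" F n 0] by blast
  have coloring: "guessed_coloring ep e v = z v" if "v \<in> verts G" for v
    using assms e(2) F(2)[OF that] listed_coloring_cong[of "k * k" "\<lambda>p. e div n ^ p mod n" F k]
    by (simp add: guessed_coloring_def)
  have "success rk ep e"
    unfolding success_def
  proof (rule grundy_condition_unblock[OF grundy_witness_condition[OF wit]])
    show "guessed_coloring ep e w \<noteq> z v"
      if "v \<in> verts G" "w \<in> verts G" "z v \<noteq> 0" "{v, w} \<in> edges G" for v w
      using grundy_witness_proper[OF wit that(1,2,4,3)] coloring[OF that(2)] by simp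
  qed (rule coloring)
  moreover have "e < num_guesses" using e(1) assms by (simp add: num_guesses_def)
  ultimately show ?thesis by blast
qed

abbreviation "witness_class i \<equiv> color_class G z (Suc i)"

text \<open>Vertices that must not be given color \<open>i\<close> although they may lie on the allowed side of every
  biclique.\<close>
definition conflicts :: "nat \<Rightarrow> nat set" where
  "conflicts i =
    (\<Union>v\<in>witness_class i. {w \<in> verts H. {v, w} \<in> edges H \<and> rk v < rk w}) \<union>
    (\<Union>j\<in>{..<k} - {i}. witness_class j)"

lemma finite_witness_class: "finite (witness_class i)"
  by (simp add: color_class_def verts_G)

lemma card_witness_class: "i < k \<Longrightarrow> card (witness_class i) \<le> k"
  using small[of i] by simp

lemma finite_conflicts: "finite (conflicts i)"
  by (auto simp: conflicts_def finite_witness_class verts_H)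

lemma card_conflicts:
  assumes "i < k"
  shows "card (conflicts i) \<le> k * d + k * k"
proof -
  let ?later = "\<Union>v\<in>witness_class i. {w \<in> verts H. {v, w} \<in> edges H \<and> rk v < rk w}"
  have "card ?later \<le> (\<Sum>v\<in>witness_class i. card {w \<in> verts H. {v, w} \<in> edges H \<and> rk v < rk w})"
    by (rule card_UN_le[OF finite_witness_class])
  also have "\<dots> \<le> (\<Sum>v\<in>witness_class i. d)"
    using rk
      by (intro sum_mono) (auto simp: degeneracy_ranking_def color_class_def verts_G verts_H)
  also have "\<dots> \<le> k * d" using card_witness_class[OF assms] by simp
  finally have later: "card ?later \<le> k * d" .
  have "card (\<Union>j\<in>{..<k} - {i}. witness_class j) \<le> (\<Sum>j\<in>{..<k} - {i}. card (witness_class j))"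
    by (rule card_UN_le) simp
  also have "\<dots> \<le> (\<Sum>j\<in>{..<k} - {i}. k)" using card_witness_class by (intro sum_mono) auto
  also have "\<dots> \<le> k * k" using card_mono[of "{..<k}" "{..<k} - {i}"] by simp
  finally show ?thesis
    using later card_Un_le[of ?later "\<Union>j\<in>{..<k} - {i}. witness_class j"] unfolding conflicts_def
      by linarith
qed

lemma conflicts_disjoint:
  assumes "v \<in> witness_class i" "w \<in> conflicts i"
  shows "v < n" "w < n" "v \<noteq> w"
proof -
  consider u where "u \<in> witness_class i" "w \<in> verts G" "{u, w} \<in> edges G"
    | j where "j \<noteq> i" "w \<in> witness_class j"
    using assms(2) by (auto simp: conflicts_def edges_H_iff verts_H verts_G)
  then have "w \<in> verts G \<and> z w \<noteq> Suc i"
  proof cases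
    case 1
    then show ?thesis using grundy_witness_proper[OF wit, of u w] by (auto simp: color_class_def)
  next
    case 2
    then show ?thesis by (auto simp: color_class_def)
  qed
  then show "v < n" "w < n" "v \<noteq> w" using assms(1) by (auto simp: color_class_def verts_G)
qed

lemma ex_cells_separating_conflicts:
  obtains a0 a where "a0 < outer_modulus" "\<And>i. i < k \<Longrightarrow> a i < inner_modulus"
    "\<And>i v w. i < k \<Longrightarrow> v \<in> witness_class i \<Longrightarrow> w \<in> conflicts i \<Longrightarrow> cell a0 a i v \<noteq> cell a0 a i w"
proof -
  have "finite (witness_class i \<times> conflicts i)" for i
    using finite_witness_class finite_conflicts by simp
  moreover have "card (witness_class i \<times> conflicts i) \<le> 2 * d * k * k * k" if "i < k" for i
  proof -
    have "card (witness_class i \<times> conflicts i) \<le> k * (k * d + k * k)"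
      unfolding card_cartesian_product
      using card_witness_class[OF that] card_conflicts[OF that] by (rule mult_le_mono)
    also have "\<dots> \<le> k * (k * (d * k) + k * (d * k))"
      using k_pos d_pos by (intro mult_le_mono2 add_mono) auto
    finally show ?thesis by (simp add: algebra_simps)
  qed
  moreover have "v < n \<and> w < n \<and> v \<noteq> w" if "(v, w) \<in> witness_class i \<times> conflicts i" for i v w
    using conflicts_disjoint that by blast
  ultimately obtain a0 a where "a0 < outer_modulus" "\<And>i. i < k \<Longrightarrow> a i < inner_modulus"
    "\<And>i v w. i < k \<Longrightarrow> (v, w) \<in> witness_class i \<times> conflicts i \<Longrightarrow> cell a0 a i v \<noteq> cell a0 a i w"
    by (rule ex_separating_cells[where P = "\<lambda>i. witness_class i \<times> conflicts i"])
      (assumption | rule that)+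
  then show thesis by (intro that) auto
qed

lemma ex_avoided_side:
  assumes "t < l"
  shows "\<exists>b<2. \<forall>v \<in> witness_class i. {ep (2 * t + b), v} \<notin> edges (A t)"
proof -
  have "{u, v} \<notin> edges (A t)" if "u \<in> witness_class i" "v \<in> witness_class i" for u v
    using grundy_witness_proper[OF wit, of u v] edges_A_subset[OF assms] that
    by (auto simp: color_class_def)
  then have "(\<forall>v \<in> witness_class i. {ep (2 * t), v} \<notin> edges (A t)) \<or>
      (\<forall>v \<in> witness_class i. {ep (2 * t + 1), v} \<notin> edges (A t))"
    using biclique_independent_avoids_side[OF biclique_A[OF assms]] ep assms
    by (auto simp: endpoints_def edge_at_def)
  then show ?thesis
  proof
    assume "\<forall>v \<in> witness_class i. {ep (2 * t), v} \<notin> edges (A t)"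
    then show ?thesis by (intro exI[of _ 0]) simp
  qed (intro exI[of _ 1]; simp)
qed

lemma edge_between_allowed:
  assumes "allowed ep e i v" "allowed ep e i w" "{v, w} \<in> edges G"
  shows "{v, w} \<in> edges H"
proof -
  have "{v, w} \<notin> edges (A t)" if t: "t < l" for t
  proof
    assume edge: "{v, w} \<in> edges (A t)"
    define b where "b = side_bit e (t * k + i)"
    have "b = 0 \<or> b = 1" using side_bit_less_2 by (auto simp: b_def less_2_cases_iff)
    moreover have ends: "{ep (2 * t), ep (2 * t + 1)} \<in> edges (A t)"
      "{ep (2 * t + 1), ep (2 * t)} \<in> edges (A t)"
      using ep t by (simp_all add: endpoints_def edge_at_def insert_commute)
    moreover note ends[THEN biclique_cover[OF biclique_A[OF t] _ edge]]
    ultimately have "{ep (2 * t + b), v} \<in> edges (A t) \<or> {ep (2 * t + b), w} \<in> edges (A t)"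
      by auto
    then show False using assms(1,2) t by (auto simp: allowed_def b_def)
  qed
  then show ?thesis using assms(3) by (simp add: edges_H_iff)
qed

lemma ex_guess_marking_witness:
  obtains e where "e < hashed_guesses"
    "\<And>i v. i < k \<Longrightarrow> v \<in> witness_class i \<Longrightarrow> marked e i v \<and> allowed ep e i v"
    "\<And>i w. i < k \<Longrightarrow> w \<in> conflicts i \<Longrightarrow> \<not> marked e i w"
proof -
  obtain a0 a where a: "a0 < outer_modulus" "\<And>i. i < k \<Longrightarrow> a i < inner_modulus"
    and separated: "\<And>i v w. i < k \<Longrightarrow> v \<in> witness_class i \<Longrightarrow> w \<in> conflicts i \<Longrightarrow>
        cell a0 a i v \<noteq> cell a0 a i w"
    by (rule ex_cells_separating_conflicts) (rule that)
  obtain side where side: "\<And>t i. t < l \<Longrightarrow>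
      side t i < 2 \<and> (\<forall>v \<in> witness_class i. {ep (2 * t + side t i), v} \<notin> edges (A t))"
    using ex_avoided_side by metis
  define g where "g y = side (y div k) (y mod k)" for y
  have g_index: "g (t * k + i) = side t i" "t * k + i < l * k" if "t < l" "i < k" for t i
    using that mult_add_less by (simp_all add: g_def)
  have g: "g y < 2" if "y < l * k" for y
    using side less_mult_imp_div_less[OF that] by (simp add: g_def)
  define S where "S = (\<Union>i<k. cell a0 a i ` witness_class i)"
  have "card S \<le> (\<Sum>i<k. card (cell a0 a i ` witness_class i))"
    unfolding S_def by (rule card_UN_le) simp
  also have "\<dots> \<le> (\<Sum>i<k. k - i)"
    by (intro sum_mono order_trans[OF card_image_le[OF finite_witness_class] small]) simp
  finally have "card S \<le> k * Suc k div 2" by (simp add: sum_descending)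
  moreover have "S \<subseteq> {..<k * inner_range}" using cell_less by (auto simp: S_def)
  ultimately obtain e where e: "e < hashed_guesses" "outer_multiplier e = a0" "marked_cells e = S"
    and inner: "\<And>i. i < k \<Longrightarrow> inner_multiplier e i = a i"
    and bits: "\<And>y. y < l * k \<Longrightarrow> side_bit e y = g y"
    using ex_guess[of a0 a g S] a g by metis
  have cell: "cell (outer_multiplier e) (inner_multiplier e) i v = cell a0 a i v" if "i < k" for i v
    using e(2) inner[OF that] by (simp add: cell_def)
  have "allowed ep e i v" if "i < k" "v \<in> witness_class i" for i v
    using side that g_index bits by (simp add: allowed_def)
  moreover have "cell a0 a i w \<notin> S" if "i < k" "w \<in> conflicts i" for i w
    using separated that cell_eq_imp_color_eq[of a0 a i w] by (fastforce simp: S_def)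
  ultimately show thesis using cell by (intro that[OF e(1)]) (auto simp: e(3) S_def)
qed

lemma hashed_guess_succeeds:
  assumes "\<not> direct"
  shows "\<exists>e<num_guesses. success rk ep e"
proof -
  obtain e where e: "e < hashed_guesses"
    and own: "\<And>i v. i < k \<Longrightarrow> v \<in> witness_class i \<Longrightarrow> marked e i v \<and> allowed ep e i v"
    and avoided: "\<And>i w. i < k \<Longrightarrow> w \<in> conflicts i \<Longrightarrow> \<not> marked e i w"
    by (rule ex_guess_marking_witness) (rule that)
  have "grundy_condition G k (unblock G rk (\<lambda>v. last_true (\<lambda>i. marked e i v \<and> allowed ep e i v) k))"
  proof (rule grundy_condition_unblock_last_true[OF wit])
    fix i j v assume "i < k" "j < k" "j \<noteq> i" "v \<in> witness_class j"
    then have "v \<in> conflicts i" by (auto simp: conflicts_def)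
    then show "\<not> (marked e i v \<and> allowed ep e i v)"
      using avoided \<open>i < k\<close> by blast
  next
    fix i v w assume "i < k" "v \<in> witness_class i" "w \<in> verts G" "{v, w} \<in> edges G" "rk v < rk w"
    then have "w \<in> conflicts i" if "allowed ep e i w"
      using own that edge_between_allowed[of e i v w] by (auto simp: conflicts_def verts_H verts_G)
    then show "\<not> (marked e i w \<and> allowed ep e i w)"
      using avoided \<open>i < k\<close> by blast
  qed (rule own)
  then have "success rk ep e"
    using assms by (simp add: success_def guessed_coloring_def hashed_coloring_def[abs_def])
  then show ?thesis using e assms by (auto simp: num_guesses_def)
qed

end

theorem success_complete:
  assumes "degeneracy_ranking d H rk" "endpoints ep" "spgc_yes x"
  shows "\<exists>e<num_guesses. success rk ep e"
proof -
  obtain k' c where "k \<le> k'" "partial_grundy_coloring G k' c"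
    using assms(3) unfolding spgc_yes_def by blast
  then obtain z where "grundy_witness G k z" "\<And>i. i < k \<Longrightarrow> card (color_class G z (Suc i)) \<le> k - i"
    using partial_grundy_coloring_small_witness by blast
  with assms(1,2) show ?thesis
    using listed_guess_succeeds hashed_guess_succeeds by (cases "direct") blast+
qed

end

section \<open>The program\<close>

text \<open>Array 0 holds \<open>k\<close>, \<open>d\<close>, \<open>l\<close>, \<open>n\<close>, followed from address 4 on by the adjacency matrices of
  the graph and of the bicliques. The arrays from 30 on are loop counters.\<close>
definition in_k :: exp where
  "in_k = Read 0 (Const 0)"

definition in_d :: exp where
  "in_d = Read 0 (Const 1)"

definition in_l :: exp where
  "in_l = Read 0 (Const 2)"

definition in_n :: exp where
  "in_n = Read 0 (Const 3)"

definition in_graph :: "exp \<Rightarrow> exp \<Rightarrow> exp" where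
  "in_graph u v = Read 0 (Add (Const 4) (Add (Mul u in_n) v))"

definition in_biclique :: "exp \<Rightarrow> exp \<Rightarrow> exp \<Rightarrow> exp" where
  "in_biclique t u v =
    Read 0 (Add (Const 4) (Add (Mul (Mul in_n in_n) (Add t (Const 1))) (Add (Mul u in_n) v)))"

definition exp_block :: exp where
  "exp_block = Mul (Mul (Mul (Const 13) in_d) in_k) in_k"

definition exp_inner :: exp where
  "exp_inner = Mul in_k exp_block"

definition exp_outer :: exp where
  "exp_outer = Mul in_k exp_inner"

definition exp_inner_modulus :: exp where
  "exp_inner_modulus = Mul exp_inner exp_outer"

definition exp_outer_modulus :: exp where
  "exp_outer_modulus = Mul exp_outer in_n"

lemmas input_defs = in_k_def in_d_def in_l_def in_n_def in_graph_def in_biclique_def exp_block_def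
  exp_inner_def exp_outer_def exp_inner_modulus_def exp_outer_modulus_def

abbreviation (input) "arr_rank \<equiv> 2 :: nat"
abbreviation (input) "arr_ends \<equiv> 3 :: nat"
abbreviation (input) "arr_color \<equiv> 4 :: nat"
abbreviation (input) "arr_kept \<equiv> 5 :: nat"
abbreviation (input) "arr_mult \<equiv> 6 :: nat"
abbreviation (input) "arr_side \<equiv> 7 :: nat"
abbreviation (input) "arr_mark \<equiv> 8 :: nat"

abbreviation (input) "var_edge \<equiv> 10 :: nat"
abbreviation (input) "var_degree \<equiv> 11 :: nat"
abbreviation (input) "var_best \<equiv> 12 :: nat"
abbreviation (input) "var_direct \<equiv> 13 :: nat"
abbreviation (input) "var_guesses \<equiv> 14 :: nat"
abbreviation (input) "var_two_l \<equiv> 15 :: nat"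
abbreviation (input) "var_n_2k \<equiv> 16 :: nat"
abbreviation (input) "var_code \<equiv> 17 :: nat"
abbreviation (input) "var_outer \<equiv> 18 :: nat"
abbreviation (input) "var_block \<equiv> 19 :: nat"
abbreviation (input) "var_hash \<equiv> 20 :: nat"
abbreviation (input) "var_hit \<equiv> 21 :: nat"
abbreviation (input) "var_seen \<equiv> 22 :: nat"
abbreviation (input) "var_all \<equiv> 23 :: nat"
abbreviation (input) "var_found \<equiv> 24 :: nat"
abbreviation (input) "var_ok \<equiv> 25 :: nat"

abbreviation (input) "ctr_vertex \<equiv> 30 :: nat"
abbreviation (input) "ctr_nbr \<equiv> 31 :: nat"
abbreviation (input) "ctr_color \<equiv> 32 :: nat"
abbreviation (input) "ctr_lower \<equiv> 33 :: nat"
abbreviation (input) "ctr_biclique \<equiv> 34 :: nat"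
abbreviation (input) "ctr_pair \<equiv> 35 :: nat"
abbreviation (input) "ctr_step \<equiv> 36 :: nat"
abbreviation (input) "ctr_round \<equiv> 37 :: nat"
abbreviation (input) "ctr_guess \<equiv> 38 :: nat"

definition residual_edge_prog :: com where
  "residual_edge_prog = Seq (Assign var_edge (in_graph (Var ctr_vertex) (Var ctr_nbr)))
     (For ctr_biclique in_l (Assign var_edge
       (Sub (Var var_edge) (in_biclique (Var ctr_biclique) (Var ctr_vertex) (Var ctr_nbr)))))"

definition count_residual_edge_prog :: com where
  "count_residual_edge_prog = If (Read arr_rank (Var ctr_nbr)) Skip
     (Seq residual_edge_prog (Assign var_degree (Add (Var var_degree) (Var var_edge))))"

definition residual_degree_prog :: com where
  "residual_degree_prog =
    Seq (Assign var_degree (Const 0)) (For ctr_nbr in_n count_residual_edge_prog)"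

definition test_removable_prog :: com where
  "test_removable_prog = If (Read arr_rank (Var ctr_vertex)) Skip (Seq residual_degree_prog
     (If (Sub (Var var_degree) in_d) Skip (Assign var_best (Var ctr_vertex))))"

definition removable_prog :: com where
  "removable_prog = For ctr_vertex in_n test_removable_prog"

definition ranking_prog :: com where
  "ranking_prog = For ctr_round in_n
     (Seq removable_prog (Write arr_rank (Var var_best) (Add (Var ctr_round) (Const 1))))"

definition endpoint_prog :: com where
  "endpoint_prog = For ctr_pair (Mul in_n in_n)
     (If (in_biclique (Var ctr_biclique) (Div (Var ctr_pair) in_n) (Mod (Var ctr_pair) in_n))
       (Seq (Write arr_ends (Mul (Const 2) (Var ctr_biclique)) (Div (Var ctr_pair) in_n))
         (Write arr_ends (Add (Mul (Const 2) (Var ctr_biclique)) (Const 1))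
           (Mod (Var ctr_pair) in_n)))
       Skip)"

definition endpoints_prog :: com where
  "endpoints_prog = For ctr_biclique in_l endpoint_prog"

definition power_prog :: "nat \<Rightarrow> exp \<Rightarrow> exp \<Rightarrow> com" where
  "power_prog x N r = For ctr_step N (Assign x (Mul (Var x) r))"

primrec power_product_prog :: "nat \<Rightarrow> (exp \<times> exp) list \<Rightarrow> com" where
  "power_product_prog x [] = Assign x (Const 1)"
| "power_product_prog x (f # fs) = Seq (power_product_prog x fs) (power_prog x (fst f) (snd f))"

definition num_guesses_prog :: com where
  "num_guesses_prog =
     Seq (power_product_prog var_two_l [(in_l, Const 2)])
     (Seq (power_product_prog var_n_2k [(Mul (Const 2) in_k, in_n)])
     (Seq (Assign var_direct (Sub (Add (Var var_two_l) (Const 1)) (Var var_n_2k)))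
     (If (Var var_direct)
       (power_product_prog var_guesses [(Mul in_k in_k, in_n)])
       (power_product_prog var_guesses [(Const 1, exp_outer_modulus), (in_k, exp_inner_modulus),
          (Mul in_l in_k, Const 2), (Mul (Mul (Const 2) in_k) in_k, Const 2),
          (Div (Mul in_k (Add in_k (Const 1))) (Const 2), exp_block)]))))"

definition setup_prog :: com where
  "setup_prog = Seq ranking_prog (Seq endpoints_prog num_guesses_prog)"

definition digits_prog :: "nat \<Rightarrow> exp \<Rightarrow> exp \<Rightarrow> com" where
  "digits_prog a N r = For ctr_step N
     (Seq (Write a (Var ctr_step) (Mod (Var var_code) r)) (Assign var_code (Div (Var var_code) r)))"

definition clear_prog :: "nat \<Rightarrow> exp \<Rightarrow> com" where
  "clear_prog a N = For ctr_step N (Write a (Var ctr_step) (Const 0))"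

definition decode_marks_prog :: com where
  "decode_marks_prog = For ctr_step (Mul (Mul (Const 2) in_k) in_k)
     (If (Mod (Var var_code) (Const 2))
       (Seq (Assign var_code (Div (Var var_code) (Const 2)))
         (Seq (Write arr_mark
             (Add (Mul (Var var_block) exp_block) (Mod (Var var_code) exp_block)) (Const 1))
           (Assign var_code (Div (Var var_code) exp_block))))
       (Seq (Assign var_code (Div (Var var_code) (Const 2)))
         (Assign var_block (Add (Var var_block) (Const 1)))))"

definition marked_cells_prog :: com where
  "marked_cells_prog = Seq (clear_prog arr_mark (Mul in_k exp_inner))
     (Seq (Assign var_block (Const 0)) decode_marks_prog)"

definition multipliers_prog :: com where
  "multipliers_prog = Seq (Assign var_outer (Mod (Var var_code) exp_outer_modulus))
     (Seq (Assign var_code (Div (Var var_code) exp_outer_modulus))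
     (digits_prog arr_mult in_k exp_inner_modulus))"

definition decode_guess_prog :: com where
  "decode_guess_prog =
     Seq multipliers_prog (Seq (digits_prog arr_side (Mul in_l in_k) (Const 2)) marked_cells_prog)"

definition allowed_prog :: com where
  "allowed_prog = For ctr_biclique in_l
     (If (in_biclique (Var ctr_biclique)
           (Read arr_ends (Add (Mul (Const 2) (Var ctr_biclique))
             (Read arr_side (Add (Mul (Var ctr_biclique) in_k) (Var ctr_color)))))
           (Var ctr_vertex))
       (Assign var_hit (Const 0)) Skip)"

definition exp_hash :: exp where
  "exp_hash = Div (Mod (Mul (Var var_outer) (Var ctr_vertex)) exp_outer_modulus) in_n"

definition exp_cell :: exp where
  "exp_cell = Add (Mul (Var ctr_color) exp_inner)
     (Div (Mod (Mul (Read arr_mult (Var ctr_color)) (Var var_hash)) exp_inner_modulus) exp_outer)"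

definition test_color_prog :: com where
  "test_color_prog = Seq (Assign var_hit (Read arr_mark exp_cell)) allowed_prog"

definition vertex_color_prog :: com where
  "vertex_color_prog = For ctr_color in_k (Seq test_color_prog
     (If (Var var_hit) (Write arr_color (Var ctr_vertex) (Add (Var ctr_color) (Const 1))) Skip))"

definition hashed_coloring_prog :: com where
  "hashed_coloring_prog = For ctr_vertex in_n
     (Seq (Write arr_color (Var ctr_vertex) (Const 0))
     (Seq (Assign var_hash exp_hash) vertex_color_prog))"

definition listed_coloring_prog :: com where
  "listed_coloring_prog = Seq (clear_prog arr_color in_n) (For ctr_step (Mul in_k in_k)
     (Seq (Write arr_color (Mod (Var var_code) in_n) (Add (Div (Var ctr_step) in_k) (Const 1)))
     (Assign var_code (Div (Var var_code) in_n))))"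

definition guessed_coloring_prog :: com where
  "guessed_coloring_prog = Seq (Assign var_code (Var ctr_guess))
     (If (Var var_direct) listed_coloring_prog (Seq decode_guess_prog hashed_coloring_prog))"

definition blocked_prog :: com where
  "blocked_prog = For ctr_nbr in_n
     (If (Mul (in_graph (Var ctr_vertex) (Var ctr_nbr))
           (Mul (Sub (Read arr_rank (Var ctr_nbr)) (Read arr_rank (Var ctr_vertex)))
             (Eq (Read arr_color (Var ctr_nbr)) (Read arr_color (Var ctr_vertex)))))
       (Write arr_kept (Var ctr_vertex) (Const 0)) Skip)"

definition unblock_prog :: com where
  "unblock_prog = For ctr_vertex in_n
     (Seq (Write arr_kept (Var ctr_vertex) (Read arr_color (Var ctr_vertex))) blocked_prog)"

definition sees_color_prog :: com where
  "sees_color_prog = Seq (Assign var_seen (Const 0)) (For ctr_nbr in_n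
     (If (Mul (in_graph (Var ctr_nbr) (Var ctr_vertex))
           (Eq (Read arr_kept (Var ctr_nbr)) (Add (Var ctr_lower) (Const 1))))
       (Assign var_seen (Const 1)) Skip))"

definition sees_lower_colors_prog :: com where
  "sees_lower_colors_prog = Seq (Assign var_all (Const 1)) (For ctr_lower (Var ctr_color)
     (Seq sees_color_prog (If (Var var_seen) Skip (Assign var_all (Const 0)))))"

definition test_grundy_vertex_prog :: com where
  "test_grundy_vertex_prog =
    If (Eq (Read arr_kept (Var ctr_vertex)) (Add (Var ctr_color) (Const 1)))
     (Seq sees_lower_colors_prog (If (Var var_all) (Assign var_found (Const 1)) Skip)) Skip"

definition grundy_vertex_prog :: com where
  "grundy_vertex_prog =
    Seq (Assign var_found (Const 0)) (For ctr_vertex in_n test_grundy_vertex_prog)"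

definition grundy_condition_prog :: com where
  "grundy_condition_prog = Seq (Assign var_ok (Const 1)) (For ctr_color in_k
     (Seq grundy_vertex_prog (If (Var var_found) Skip (Assign var_ok (Const 0)))))"

definition test_guess_prog :: com where
  "test_guess_prog = Seq guessed_coloring_prog (Seq unblock_prog (Seq grundy_condition_prog
     (If (Var var_ok) (Assign 1 (Const 1)) Skip)))"

definition spgc_prog :: com where
  "spgc_prog = Seq setup_prog (For ctr_guess (Var var_guesses) test_guess_prog)"

lemmas prog_defs = residual_edge_prog_def count_residual_edge_prog_def residual_degree_prog_def
  test_removable_prog_def removable_prog_def ranking_prog_def endpoint_prog_def endpoints_prog_def
  power_prog_def num_guesses_prog_def setup_prog_def digits_prog_def clear_prog_def
  decode_marks_prog_def marked_cells_prog_def multipliers_prog_def decode_guess_prog_def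
  allowed_prog_def test_color_prog_def vertex_color_prog_def hashed_coloring_prog_def
  listed_coloring_prog_def guessed_coloring_prog_def blocked_prog_def unblock_prog_def
  sees_color_prog_def sees_lower_colors_prog_def test_grundy_vertex_prog_def
  grundy_vertex_prog_def grundy_condition_prog_def test_guess_prog_def

section \<open>Bounds on iterations and values\<close>

context spgc_parameters
begin

definition iteration_bound :: nat where
  "iteration_bound = 13 * d * (k * k * k * k) * (n * n) * l"

definition value_bound :: nat where
  "value_bound = iteration_bound + 2 ^ l + n ^ (2 * k) + n ^ (k * k) + hashed_guesses"

lemma dvd_le_iteration_bound: "m dvd iteration_bound \<Longrightarrow> m \<le> iteration_bound"
  using k_pos d_pos l_pos two_le_n by (intro dvd_imp_le) (auto simp: iteration_bound_def)

lemma iteration_bounds: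
  shows k_le_iteration_bound: "k \<le> iteration_bound"
    and d_le_iteration_bound: "d \<le> iteration_bound"
    and l_le_iteration_bound: "l \<le> iteration_bound"
    and n_le_iteration_bound: "n \<le> iteration_bound"
    and outer_modulus_le_iteration_bound: "outer_modulus \<le> iteration_bound"
    and thirteen_le_iteration_bound: "13 \<le> iteration_bound"
    and two_k_squared_le_iteration_bound: "2 * k * k \<le> iteration_bound"
    and "n * n \<le> iteration_bound" "k * k \<le> iteration_bound" "l * k \<le> iteration_bound"
      "k * inner_range \<le> iteration_bound" "2 * k \<le> iteration_bound"
      "k * Suc k div 2 \<le> iteration_bound"
proof -
  show "k \<le> iteration_bound" "d \<le> iteration_bound" "l \<le> iteration_bound" "n \<le> iteration_bound"
    "n * n \<le> iteration_bound" "k * k \<le> iteration_bound" "l * k \<le> iteration_bound"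
    "k * inner_range \<le> iteration_bound" "outer_modulus \<le> iteration_bound" "13 \<le> iteration_bound"
    by (rule dvd_le_iteration_bound, simp add: iteration_bound_def size_defs mult_ac dvd_mult)+
  have "13 * (k * k) \<le> iteration_bound"
    by (rule dvd_le_iteration_bound) (simp add: iteration_bound_def mult_ac dvd_mult)
  then show "2 * k * k \<le> iteration_bound" by simp
  moreover have "2 * k \<le> 2 * k * k" "k * Suc k \<le> 2 * k * k" using k_pos by simp_all
  moreover have "k * Suc k div 2 \<le> k * Suc k" by simp
  ultimately show "2 * k \<le> iteration_bound" "k * Suc k div 2 \<le> iteration_bound" by linarith+
qed

lemma value_bounds:
  shows iteration_bound_le_value_bound: "iteration_bound \<le> value_bound"
    and two_power_l_le_value_bound: "2 ^ l \<le> value_bound"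
    and "n ^ (2 * k) \<le> value_bound" "n ^ (k * k) \<le> value_bound"
      "hashed_guesses \<le> value_bound" "num_guesses \<le> value_bound"
  by (simp_all add: value_bound_def num_guesses_def)

lemma le_value_bound: "m \<le> iteration_bound \<Longrightarrow> m \<le> value_bound"
  using iteration_bound_le_value_bound by simp

lemma one_le_value_bound [simp]: "Suc 0 \<le> value_bound"
  using le_value_bound[OF thirteen_le_iteration_bound] by simp

lemma index_le_value_bound: "j < m \<Longrightarrow> m \<le> iteration_bound \<Longrightarrow> Suc j \<le> value_bound"
  using le_value_bound[of m] by simp

abbreviation achieves :: "com \<Rightarrow> state \<Rightarrow> (state \<Rightarrow> bool) \<Rightarrow> bool" where
  "achieves \<equiv> spec value_bound iteration_bound"

lemma achieves_For
    [case_names fresh limit [frame] stable init step [index counter bounded frame inv] iterations]: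
  assumes "i \<notin> writes P"
    and "\<And>s'. (\<And>a. a \<notin> insert i (writes P) \<Longrightarrow> s' a = s a) \<Longrightarrow> eval N s' = m"
    and "\<And>j s' y. Inv j s' \<Longrightarrow> Inv j (s'(i := y))"
    and "Inv 0 s"
    and "\<And>j s'. j < m \<Longrightarrow> s' i 0 = j \<Longrightarrow> bounded_by value_bound s' \<Longrightarrow>
      (\<And>a. a \<notin> insert i (writes P) \<Longrightarrow> s' a = s a) \<Longrightarrow> Inv j s' \<Longrightarrow> achieves P s' (Inv (Suc j))"
    and "m \<le> iteration_bound"
  shows "achieves (For i N P) s (Inv m)"
  by (rule spec_For[OF le_value_bound[OF assms(6)] assms])

subsection \<open>Powers and digits\<close>

lemma achieves_power:
  assumes "reads N \<subseteq> {0}" "reads r \<subseteq> {0}" "x \<noteq> 0" "x \<noteq> ctr_step"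
    and "eval N s \<le> iteration_bound" "0 < eval r s" "s x 0 * eval r s ^ eval N s \<le> value_bound"
  shows "achieves (power_prog x N r) s (\<lambda>s'. s' x 0 = s x 0 * eval r s ^ eval N s)"
proof -
  have input_only: "eval N s' = eval N s" "eval r s' = eval r s" if "s' 0 = s 0" for s'
    using assms(1,2) that by (auto intro!: eval_cong)
  show ?thesis
    unfolding power_prog_def
  proof (induction rule: achieves_For[where Inv = "\<lambda>j s'. s' x 0 = s x 0 * eval r s ^ j"])
    case (limit s')
    then show ?case using assms(3) by (intro input_only) simp
  next
    case (step j s')
    have "s' 0 = s 0" using step.frame assms(3) by simp
    have "s x 0 * eval r s ^ Suc j \<le> s x 0 * eval r s ^ eval N s"
      using step.index assms(6) by (intro mult_le_mono2 power_increasing) auto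
    then have "s x 0 * eval r s ^ Suc j \<le> value_bound" using assms(7) by (rule le_trans)
    then show ?case
      using step.inv input_only[of s', OF \<open>s' 0 = s 0\<close>] by (intro spec_Write) (auto simp: mult_ac)
  qed (use assms in auto)
qed

lemma writes_power_product_prog: "writes (power_product_prog x fs) \<subseteq> {x, ctr_step}"
  by (induction fs) (auto simp: power_prog_def)

lemma achieves_power_product:
  assumes "\<And>N r. (N, r) \<in> set fs \<Longrightarrow>
      reads N \<subseteq> {0} \<and> reads r \<subseteq> {0} \<and> eval N s \<le> iteration_bound \<and> 0 < eval r s"
    and "x \<noteq> 0" "x \<noteq> ctr_step" "(\<Prod>(N, r)\<leftarrow>fs. eval r s ^ eval N s) \<le> value_bound"
  shows "achieves (power_product_prog x fs) s (\<lambda>s'. s' x 0 = (\<Prod>(N, r)\<leftarrow>fs. eval r s ^ eval N s))"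
  using assms
proof (induction fs)
  case Nil
  show ?case unfolding power_product_prog.simps by (rule spec_Write) simp_all
next
  case (Cons f fs)
  obtain N r where f: "f = (N, r)" by (cases f)
  let ?rest = "\<Prod>(N, r)\<leftarrow>fs. eval r s ^ eval N s"
  have N: "reads N \<subseteq> {0}" and r: "reads r \<subseteq> {0}"
    and eval: "eval N s \<le> iteration_bound" "0 < eval r s"
    using Cons.prems(1)[of N r] by (simp_all add: f)
  have "?rest \<le> ?rest * eval r s ^ eval N s" using eval by simp
  also have bound: "\<dots> \<le> value_bound" using Cons.prems(4) by (simp add: f mult.commute)
  finally have "?rest \<le> value_bound" .
  with Cons.prems(1)[OF list.set_intros(2)] Cons.prems(2,3)
  have "achieves (power_product_prog x fs) s (\<lambda>s'. s' x 0 = ?rest)"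
    by (rule Cons.IH)
  then show ?case
    unfolding power_product_prog.simps
  proof (induction rule: spec_Seq)
    case (second s1)
    have "0 \<notin> writes (power_product_prog x fs)"
      using writes_power_product_prog[of x fs] Cons.prems(2) by auto
    then have "s1 0 = s 0" by (rule second.frame)
    then have same: "eval N s1 = eval N s" "eval r s1 = eval r s"
      using N r by (auto intro!: eval_cong)
    then have "achieves (power_prog x N r) s1 (\<lambda>s'. s' x 0 = s1 x 0 * eval r s1 ^ eval N s1)"
      using N r eval bound second.post Cons.prems(2,3) by (intro achieves_power) simp_all
    then show ?case by (simp add: f same second.post mult.commute)
  qed
qed

lemma achieves_digits:
  assumes "reads N \<subseteq> {0}" "reads r \<subseteq> {0}" "a \<noteq> 0" "a \<noteq> ctr_step" "a \<noteq> var_code"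
    and "eval N s \<le> iteration_bound"
  shows "achieves (digits_prog a N r) s
    (\<lambda>s'. (\<forall>i<eval N s. s' a i = s var_code 0 div eval r s ^ i mod eval r s) \<and>
      s' var_code 0 = s var_code 0 div eval r s ^ eval N s)"
proof -
  have input_only: "eval N s' = eval N s" "eval r s' = eval r s" if "s' 0 = s 0" for s'
    using assms(1,2) that by (auto intro!: eval_cong)
  show ?thesis
    unfolding digits_prog_def
  proof (induction rule: achieves_For[where
        Inv = "\<lambda>j s'. (\<forall>i<j. s' a i = s var_code 0 div eval r s ^ i mod eval r s) \<and>
          s' var_code 0 = s var_code 0 div eval r s ^ j"])
    case (limit s')
    then show ?case using assms(3) by (intro input_only) simp
  next
    case (step j s')
    have "s' 0 = s 0" using step.frame assms(3) by simp
    then have r: "eval r s' = eval r s" "eval r (s'(a := y)) = eval r s" for y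
      using input_only(2)[of s'] input_only(2)[of "s'(a := y)"] assms(3) by simp_all
    have "s' var_code 0 mod eval r s \<le> value_bound" "s' var_code 0 div eval r s \<le> value_bound"
      using bounded_byD[OF step.bounded, of var_code 0]
      by (meson div_le_dividend mod_less_eq_dividend le_trans)+
    then show ?case
      using step.counter step.inv assms(4,5)
      by (intro spec_Seq_Write spec_Write)
        (auto simp: r less_Suc_eq div_mult2_eq[symmetric] mult.commute)
  qed (use assms in auto)
qed

lemma achieves_clear:
  assumes "reads N \<subseteq> {0}" "a \<noteq> 0" "a \<noteq> ctr_step" "eval N s \<le> iteration_bound"
  shows "achieves (clear_prog a N) s (\<lambda>s'. \<forall>i<eval N s. s' a i = 0)"
  unfolding clear_prog_def
proof (induction rule: achieves_For[where Inv = "\<lambda>j s'. \<forall>i<j. s' a i = 0"])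
  case (limit s')
  then show ?case using assms(1,2) by (intro eval_cong) auto
next
  case (step j s')
  then show ?case using assms(3) by (intro spec_Write) (auto simp: less_Suc_eq)
qed (use assms in auto)

end

section \<open>Correctness of the program\<close>

subsection \<open>The input\<close>

lemma length_concat_uniform:
  "(\<And>xs. xs \<in> set xss \<Longrightarrow> length xs = c) \<Longrightarrow> length (concat xss) = length xss * c"
  by (induction xss) auto

lemma nth_concat_uniform:
  "(\<And>xs. xs \<in> set xss \<Longrightarrow> length xs = c) \<Longrightarrow> i < length xss \<Longrightarrow> j < c \<Longrightarrow>
    concat xss ! (i * c + j) = xss ! i ! j"
proof (induction xss arbitrary: i)
  case (Cons xs xss)
  then show ?case by (cases i) (auto simp: nth_append)
qed simp

lemma length_adjacency_matrix: "length (adjacency_matrix n G) = n * n"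
  unfolding adjacency_matrix_def by (subst length_concat_uniform[where c = n]) auto

lemma nth_adjacency_matrix:
  assumes "u < n" "v < n"
  shows "adjacency_matrix n G ! (u * n + v) = (if {u, v} \<in> edges G then 1 else 0)"
  unfolding adjacency_matrix_def using assms by (subst nth_concat_uniform[where c = n]) auto

lemma adjacency_matrix_le_1: "y \<in> set (adjacency_matrix n G) \<Longrightarrow> y \<le> 1"
  by (auto simp: adjacency_matrix_def split: if_splits)

lemma card_less_Suc_if: "card {w. w < Suc j \<and> Q w} = card {w. w < j \<and> Q w} + (if Q j then 1 else 0)"
proof -
  have "{w. w < Suc j \<and> Q w} = (if Q j then insert j {w. w < j \<and> Q w} else {w. w < j \<and> Q w})"
    by (auto simp: less_Suc_eq)
  then show ?thesis by simp
qed

context spgc_instance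
begin

abbreviation "input \<equiv> initial (spgc_encode x) 0"

lemma input_graph:
  assumes "u < n" "v < n"
  shows "input (4 + (u * n + v)) = (if {u, v} \<in> edges G then 1 else 0)"
proof -
  have "input (4 + (u * n + v)) = adjacency_matrix n G ! (u * n + v)"
    using mult_add_less[OF assms]
    by (simp add: initial_def spgc_encode_def nth_append length_adjacency_matrix)
  then show ?thesis using assms by (simp add: nth_adjacency_matrix)
qed

lemma input_biclique:
  assumes "t < l" "u < n" "v < n"
  shows "input (4 + (n * n * (t + 1) + (u * n + v))) = (if {u, v} \<in> edges (A t) then 1 else 0)"
proof -
  let ?C = "map (adjacency_matrix n) (bicliques x)"
  have p: "u * n + v < n * n" using assms by (intro mult_add_less)
  have len: "length (concat ?C) = l * (n * n)"
    by (subst length_concat_uniform[where c = "n * n"]) (auto simp: length_adjacency_matrix)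
  have "input (4 + (n * n + q)) = concat ?C ! q" if "q < l * (n * n)" for q
    using that len by (simp add: initial_def spgc_encode_def nth_append length_adjacency_matrix)
  from this[OF mult_add_less[OF assms(1) p]]
  have "input (4 + (n * n * (t + 1) + (u * n + v))) = concat ?C ! (t * (n * n) + (u * n + v))"
    by (simp add: algebra_simps)
  also have "\<dots> = ?C ! t ! (u * n + v)"
    using assms p by (intro nth_concat_uniform) (auto simp: length_adjacency_matrix)
  finally show ?thesis using assms by (simp add: nth_adjacency_matrix)
qed

lemma eval_input [simp]:
  assumes "s 0 = input"
  shows "eval in_k s = k" "eval in_d s = d" "eval in_l s = l" "eval in_n s = n"
  using assms by (simp_all add: input_defs initial_def spgc_encode_def)

lemma eval_sizes [simp]:
  assumes "s 0 = input"
  shows "eval exp_block s = block_size" "eval exp_inner s = inner_range"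
    "eval exp_outer s = outer_range"
    "eval exp_inner_modulus s = inner_modulus" "eval exp_outer_modulus s = outer_modulus"
  using assms by (simp_all add: exp_block_def exp_inner_def exp_outer_def exp_inner_modulus_def
      exp_outer_modulus_def size_defs)

lemma reads_input [simp]:
  "reads in_k = {0}" "reads in_d = {0}" "reads in_l = {0}" "reads in_n = {0}"
    "reads exp_block = {0}"
  "reads exp_inner = {0}" "reads exp_inner_modulus = {0}" "reads exp_outer_modulus = {0}"
  by (simp_all add: input_defs)

lemma eval_in_graph [simp]:
  "s 0 = input \<Longrightarrow> eval e s < n \<Longrightarrow> eval f s < n \<Longrightarrow>
    eval (in_graph e f) s = (if {eval e s, eval f s} \<in> edges G then 1 else 0)"
  using input_graph by (simp add: in_graph_def)

lemma eval_in_biclique [simp]: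
  "s 0 = input \<Longrightarrow> eval t s < l \<Longrightarrow> eval e s < n \<Longrightarrow> eval f s < n \<Longrightarrow>
    eval (in_biclique t e f) s = (if {eval e s, eval f s} \<in> edges (A (eval t s)) then 1 else 0)"
  using input_biclique by (simp add: in_biclique_def)

lemma bounded_by_input: "bounded_by value_bound (initial (spgc_encode x))"
proof (rule bounded_by_initial)
  show "2 \<le> value_bound" using le_value_bound[OF thirteen_le_iteration_bound] by simp
  fix y assume "y \<in> set (spgc_encode x)"
  then consider "y \<in> {k, d, l, n}" | G where "y \<in> set (adjacency_matrix n G)"
    by (auto simp: spgc_encode_def)
  then show "y \<le> value_bound"
  proof cases
    case 1
    then show ?thesis
      using le_value_bound k_le_iteration_bound d_le_iteration_bound l_le_iteration_bound
        n_le_iteration_bound by blast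
  next
    case 2
    then show ?thesis using adjacency_matrix_le_1[OF 2] one_le_value_bound by linarith
  qed
qed

subsection \<open>Ranking the vertices\<close>

lemma achieves_residual_edge:
  assumes "s 0 = input" "s ctr_vertex 0 = u" "s ctr_nbr 0 = v" "u < n" "v < n"
  shows "achieves residual_edge_prog s (\<lambda>s'. s' var_edge 0 = (if {u, v} \<in> edges H then 1 else 0))"
proof -
  let ?flag = "\<lambda>j. if {u, v} \<in> edges G \<and> (\<forall>t<j. {u, v} \<notin> edges (A t)) then 1 else 0 :: nat"
  have "achieves (Assign var_edge (in_graph (Var ctr_vertex) (Var ctr_nbr))) s
    (\<lambda>s'. s' var_edge 0 = ?flag 0)"
    using assms by (intro spec_Write) auto
  then show ?thesis
    unfolding residual_edge_prog_def edges_H_iff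
  proof (induction rule: spec_Seq)
    case init: (second s1)
    show ?case
    proof (induction rule: achieves_For[where Inv = "\<lambda>j s'. s' var_edge 0 = ?flag j"])
      case (step j s')
      have "s' 0 = input" "s' ctr_vertex 0 = u" "s' ctr_nbr 0 = v"
        using step.frame init.frame assms by simp_all
      then show ?case
        using step.index step.counter step.inv assms(4,5)
          by (intro spec_Write) (auto simp: less_Suc_eq)
    qed (use init assms iteration_bounds in auto)
  qed
qed

lemma achieves_count_residual_edge:
  assumes "s 0 = input" "s ctr_vertex 0 = v" "v < n" "s ctr_nbr 0 = w" "w < n" "s var_degree 0 \<le> w"
  shows "achieves count_residual_edge_prog s (\<lambda>s'. s' var_degree 0 =
    s var_degree 0 + (if {v, w} \<in> edges H \<and> s arr_rank w = 0 then 1 else 0))"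
  unfolding count_residual_edge_prog_def
proof (rule spec_If)
  assume unranked: "eval (Read arr_rank (Var ctr_nbr)) s = 0"
  from achieves_residual_edge[of s, OF assms(1,2,4,3,5)]
  show "achieves
      (Seq residual_edge_prog (Assign var_degree (Add (Var var_degree) (Var var_edge)))) s
    (\<lambda>s'. s' var_degree 0 =
      s var_degree 0 + (if {v, w} \<in> edges H \<and> s arr_rank w = 0 then 1 else 0))"
  proof (induction rule: spec_Seq)
    case (second s1)
    have "s1 var_degree 0 + s1 var_edge 0 =
        s var_degree 0 + (if {v, w} \<in> edges H \<and> s arr_rank w = 0 then 1 else 0)"
      using second.frame second.post unranked assms(4) by (simp add: prog_defs)
    moreover have "s var_degree 0 + 1 \<le> value_bound"
      using index_le_value_bound[OF assms(5) n_le_iteration_bound] assms(6) by linarith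
    ultimately show ?case by (intro spec_Write) auto
  qed
qed (rule spec_Skip, use assms(4) in auto)

lemma achieves_residual_degree:
  assumes "s 0 = input" "s ctr_vertex 0 = v" "v < n"
  shows "achieves residual_degree_prog s
    (\<lambda>s'. s' var_degree 0 = card {w \<in> verts H. {v, w} \<in> edges H \<and> s arr_rank w = 0})"
proof -
  let ?deg = "\<lambda>j. card {w. w < j \<and> {v, w} \<in> edges H \<and> s arr_rank w = 0}"
  have deg_le: "?deg j \<le> j" for j
    using card_mono[of "{..<j}" "{w. w < j \<and> {v, w} \<in> edges H \<and> s arr_rank w = 0}"] by auto
  have "achieves (Assign var_degree (Const 0)) s (\<lambda>s'. s' var_degree 0 = ?deg 0)"
    by (intro spec_Write) auto
  then have "achieves residual_degree_prog s (\<lambda>s'. s' var_degree 0 = ?deg n)"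
    unfolding residual_degree_prog_def
  proof (induction rule: spec_Seq)
    case init: (second s1)
    show ?case
    proof (induction rule: achieves_For[where Inv = "\<lambda>j s'. s' var_degree 0 = ?deg j"])
      case (step j s')
      have s': "s' 0 = input" "s' ctr_vertex 0 = v" "s' arr_rank = s arr_rank"
        using step.frame init.frame assms by (simp_all add: prog_defs)
      have "s' var_degree 0 \<le> j" using step.inv deg_le by simp
      from achieves_count_residual_edge[of s', OF s'(1,2) assms(3) step.counter step.index this]
      show ?case
        by (rule ensures_conseq) (simp add: s'(3) step.inv card_less_Suc_if)
    qed (use init assms iteration_bounds in \<open>auto simp: prog_defs\<close>)
  qed
  then show ?thesis by (simp add: verts_H)
qed

lemma achieves_test_removable:
  assumes "s 0 = input" "s ctr_vertex 0 = v" "v < n"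
  shows "achieves test_removable_prog s
    (\<lambda>s'. s' var_best 0 = (if removable d H (s arr_rank) v then v else s var_best 0))"
  unfolding test_removable_prog_def
proof (rule spec_If)
  assume "eval (Read arr_rank (Var ctr_vertex)) s \<noteq> 0"
  then show "achieves Skip s
    (\<lambda>s'. s' var_best 0 = (if removable d H (s arr_rank) v then v else s var_best 0))"
    using assms(2) by (intro spec_Skip) (simp add: removable_def)
next
  assume unranked: "eval (Read arr_rank (Var ctr_vertex)) s = 0"
  from achieves_residual_degree[of s, OF assms]
  show "achieves (Seq residual_degree_prog
      (If (Sub (Var var_degree) in_d) Skip (Assign var_best (Var ctr_vertex)))) s
    (\<lambda>s'. s' var_best 0 = (if removable d H (s arr_rank) v then v else s var_best 0))"
  proof (induction rule: spec_Seq)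
    case (second s1)
    have s1: "s1 0 = input" "s1 ctr_vertex 0 = v" "s1 var_best = s var_best"
      using second.frame assms(1,2) by (simp_all add: prog_defs)
    have "removable d H (s arr_rank) v \<longleftrightarrow> s1 var_degree 0 \<le> d"
      using second.post unranked assms(2,3) by (simp add: removable_def verts_H)
    moreover have "v \<le> value_bound"
      using index_le_value_bound[OF assms(3) n_le_iteration_bound] by linarith
    ultimately show ?case using s1 by (intro spec_If spec_Write spec_Skip) auto
  qed
qed

lemma achieves_removable:
  assumes "s 0 = input"
  shows "achieves removable_prog s
    (\<lambda>s'. (\<exists>v. removable d H (s arr_rank) v) \<longrightarrow> removable d H (s arr_rank) (s' var_best 0))"
proof -
  let ?removable = "removable d H (s arr_rank)"
  have "achieves removable_prog s (\<lambda>s'. (\<exists>v<n. ?removable v) \<longrightarrow> ?removable (s' var_best 0))"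
    unfolding removable_prog_def
  proof (induction rule: achieves_For[where
        Inv = "\<lambda>j s'. (\<exists>v<j. ?removable v) \<longrightarrow> ?removable (s' var_best 0)"])
    case (step j s')
    have s': "s' 0 = input" "s' arr_rank = s arr_rank"
      using step.frame assms by (simp_all add: prog_defs)
    from achieves_test_removable[of s', OF s'(1) step.counter step.index] show ?case
      by (rule ensures_conseq) (use step.inv s'(2) in \<open>auto simp: less_Suc_eq\<close>)
  qed (use assms iteration_bounds in \<open>auto simp: prog_defs\<close>)
  then show ?thesis
    by (rule ensures_conseq) (auto simp: removable_def verts_H)
qed

lemma achieves_ranking:
  assumes "s 0 = input" "\<And>v. s arr_rank v = 0"
  shows "achieves ranking_prog s (\<lambda>s'. degeneracy_ranking d H (s' arr_rank))"
proof -
  have "achieves ranking_prog s (\<lambda>s'. partial_ranking d H n (s' arr_rank))"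
    unfolding ranking_prog_def
  proof (induction rule: achieves_For[where Inv = "\<lambda>j s'. partial_ranking d H j (s' arr_rank)"])
    case (step j s')
    have "s' 0 = input" using step.frame assms by (simp add: prog_defs)
    from achieves_removable[of s', OF this] show ?case
    proof (induction rule: spec_Seq)
      case (second s2)
      have s2: "s2 arr_rank = s' arr_rank" "s2 ctr_round 0 = j"
        using second.frame step.counter by (simp_all add: prog_defs)
      have "\<exists>v. removable d H (s' arr_rank) v"
        using degenerate_H simple_graph_delete_edges[OF simple_graph_G] step.inv step.index
        by (intro ex_removable) (simp_all add: verts_H)
      then have "partial_ranking d H (Suc j) ((s' arr_rank)(s2 var_best 0 := Suc j))"
        using second.post step.inv by (intro partial_ranking_Suc) (simp_all add: verts_H)
      then show ?case
        using s2 index_le_value_bound[OF step.index n_le_iteration_bound] by (intro spec_Write) auto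
    qed
  qed (use assms partial_ranking_0 iteration_bounds in \<open>auto simp: prog_defs\<close>)
  then show ?thesis
    by (rule ensures_conseq) (simp add: degeneracy_ranking_if_partial_ranking verts_H)
qed

end

context spgc_instance
begin

lemma achieves_endpoint:
  assumes "s 0 = input" "s ctr_biclique 0 = t" "t < l"
  shows "achieves endpoint_prog s
    (\<lambda>s'. edge_at (s' arr_ends) t \<and> (\<forall>j<2 * t. s' arr_ends j = s arr_ends j))"
proof -
  define edge where "edge p \<longleftrightarrow> {p div n, p mod n} \<in> edges (A t)" for p
  obtain u v where "u < n" "v < n" "{u, v} \<in> edges (A t)" using ex_edge_A[OF assms(3)] by blast
  then have "edge (u * n + v)" "u * n + v < n * n" by (simp_all add: edge_def mult_add_less)
  then have ex: "\<exists>p<n * n. edge p" by blast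
  have "achieves endpoint_prog s (\<lambda>s'. ((\<exists>p<n * n. edge p) \<longrightarrow> edge_at (s' arr_ends) t) \<and>
      (\<forall>j<2 * t. s' arr_ends j = s arr_ends j))"
    unfolding endpoint_prog_def
  proof (induction rule: achieves_For[where
        Inv = "\<lambda>q s'. ((\<exists>p<q. edge p) \<longrightarrow> edge_at (s' arr_ends) t) \<and>
      (\<forall>j<2 * t. s' arr_ends j = s arr_ends j)"])
    case (step j s')
    have s': "s' 0 = input" "s' ctr_biclique 0 = t" using step.frame assms by simp_all
    have less: "j div n < n" "j mod n < n"
      using step.index n_pos by (simp_all add: less_mult_imp_div_less)
    then have "j div n \<le> value_bound" "j mod n \<le> value_bound"
      using le_value_bound[OF n_le_iteration_bound] by linarith+
    then show ?case
      using s' less step.counter step.inv assms(3)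
      by (intro spec_If spec_Seq_Write spec_Write spec_Skip)
        (auto simp: edge_def edge_at_def less_Suc_eq split: if_splits)
  qed (use assms iteration_bounds in auto)
  then show ?thesis using ex by simp
qed

lemma achieves_endpoints:
  assumes "s 0 = input"
  shows "achieves endpoints_prog s (\<lambda>s'. endpoints (s' arr_ends))"
  unfolding endpoints_prog_def endpoints_def
proof (induction rule: achieves_For[where Inv = "\<lambda>j s'. \<forall>t<j. edge_at (s' arr_ends) t"])
  case (step j s')
  have "s' 0 = input" using step.frame assms by (simp add: prog_defs)
  from achieves_endpoint[of s', OF this step.counter step.index] show ?case
    by (rule ensures_conseq) (use step.inv in \<open>auto simp: edge_at_def less_Suc_eq\<close>)
qed (use assms iteration_bounds in \<open>auto simp: prog_defs\<close>)

subsection \<open>The number of guesses\<close>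

lemma achieves_power_two_l:
  "s 0 = input \<Longrightarrow>
    achieves (power_product_prog var_two_l [(in_l, Const 2)]) s (\<lambda>s'. s' var_two_l 0 = 2 ^ l)"
  using iteration_bounds value_bounds by (intro ensures_conseq[OF achieves_power_product]) auto

lemma achieves_power_n_2k:
  "s 0 = input \<Longrightarrow>
    achieves (power_product_prog var_n_2k [(Mul (Const 2) in_k, in_n)]) s
      (\<lambda>s'. s' var_n_2k 0 = n ^ (2 * k))"
  using iteration_bounds value_bounds sizes_pos
    by (intro ensures_conseq[OF achieves_power_product]) auto

lemma achieves_direct_guesses:
  "s 0 = input \<Longrightarrow>
    achieves (power_product_prog var_guesses [(Mul in_k in_k, in_n)]) s
      (\<lambda>s'. s' var_guesses 0 = n ^ (k * k))"
  using iteration_bounds value_bounds sizes_pos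
    by (intro ensures_conseq[OF achieves_power_product]) auto

lemma achieves_hashed_guesses:
  "s 0 = input \<Longrightarrow> achieves (power_product_prog var_guesses
      [(Const 1, exp_outer_modulus), (in_k, exp_inner_modulus), (Mul in_l in_k, Const 2),
       (Mul (Mul (Const 2) in_k) in_k, Const 2),
       (Div (Mul in_k (Add in_k (Const 1))) (Const 2), exp_block)]) s
    (\<lambda>s'. s' var_guesses 0 = hashed_guesses)"
  using iteration_bounds value_bounds sizes_pos
  by (intro ensures_conseq[OF achieves_power_product]) (auto simp: hashed_guesses_def mult.assoc)

lemma achieves_num_guesses:
  assumes "s 0 = input"
  shows "achieves num_guesses_prog s
    (\<lambda>s'. (s' var_direct 0 \<noteq> 0 \<longleftrightarrow> direct) \<and> s' var_guesses 0 = num_guesses)"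
  unfolding num_guesses_prog_def
  using achieves_power_two_l[of s, OF assms]
proof (induction rule: spec_Seq)
  case two_l: (second s1)
  have s1: "s1 0 = input" using two_l.frame assms by (simp add: prog_defs)
  from achieves_power_n_2k[of s1, OF this] show ?case
  proof (induction rule: spec_Seq)
    case n_2k: (second s2)
    have s2: "s2 0 = input" "s2 var_two_l 0 = 2 ^ l"
      using n_2k.frame s1 two_l.post by (simp_all add: prog_defs)
    have "0 < n ^ (2 * k)" using n_pos by simp
    then have "2 ^ l + 1 - n ^ (2 * k) \<le> 2 ^ l" by linarith
    then have "2 ^ l + 1 - n ^ (2 * k) \<le> value_bound"
      using two_power_l_le_value_bound by (rule le_trans)
    then have "achieves (Assign var_direct (Sub (Add (Var var_two_l) (Const 1)) (Var var_n_2k))) s2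
      (\<lambda>s'. s' var_direct 0 \<noteq> 0 \<longleftrightarrow> direct)"
      using s2 n_2k.post by (intro spec_Write) (auto simp: direct_def)
    then show ?case
    proof (induction rule: spec_Seq)
      case direct: (second s3)
      have "s3 0 = input" using direct.frame s2 by simp
      then show ?case
        using direct.post
        by (intro spec_If ensures_conseq[OF achieves_direct_guesses]
          ensures_conseq[OF achieves_hashed_guesses])
          (auto simp: num_guesses_def prog_defs)
    qed
  qed
qed

lemma achieves_setup:
  assumes "s 0 = input" "\<And>v. s arr_rank v = 0"
  shows "achieves setup_prog s
      (\<lambda>s'. degeneracy_ranking d H (s' arr_rank) \<and> endpoints (s' arr_ends) \<and>
    (s' var_direct 0 \<noteq> 0 \<longleftrightarrow> direct) \<and> s' var_guesses 0 = num_guesses)"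
  unfolding setup_prog_def
  using achieves_ranking[of s, OF assms]
proof (induction rule: spec_Seq)
  case ranking: (second s1)
  have "s1 0 = input" using ranking.frame assms by (simp add: prog_defs)
  from achieves_endpoints[of s1, OF this] show ?case
  proof (induction rule: spec_Seq)
    case endpoints: (second s2)
    have s2: "s2 0 = input" "s2 arr_rank = s1 arr_rank"
      using endpoints.frame ranking.frame assms by (simp_all add: prog_defs)
    from achieves_num_guesses[of s2, OF s2(1)] show ?case
    proof (induction rule: ensures_conseq)
      case (post s3)
      have "s3 arr_rank = s2 arr_rank" "s3 arr_ends = s2 arr_ends"
        using post.frame by (simp_all add: prog_defs)
      then show ?case using post.post endpoints.post ranking.post s2(2) by simp
    qed
  qed
qed

subsection \<open>Decoding a guess\<close>

lemma achieves_decode_marks: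
  assumes "s 0 = input" "s var_block 0 = 0" "\<And>q. q < k * inner_range \<Longrightarrow> s arr_mark q = 0"
  shows "achieves decode_marks_prog s (\<lambda>s'. \<forall>q < k * inner_range.
    s' arr_mark q \<noteq> 0 \<longleftrightarrow> q \<in> decode_marks block_size (2 * k * k) (s var_code 0) 0)"
proof -
  define b where "b = 2 * k * k"
  define goal where "goal = decode_marks block_size b (s var_code 0) 0"
  define Inv where "Inv j s' \<longleftrightarrow> s' var_block 0 \<le> j \<and> (\<forall>q < k * inner_range.
    s' arr_mark q \<noteq> 0 \<or> q \<in> decode_marks block_size (b - j) (s' var_code 0) (s' var_block 0) \<longleftrightarrow>
    q \<in> goal)" for j and s' :: state
  have "achieves decode_marks_prog s (Inv b)"
    unfolding decode_marks_prog_def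
  proof (induction rule: achieves_For[where Inv = Inv])
    case (step j s')
    have s': "s' 0 = input" using step.frame assms by simp
    have code: "s' var_code 0 div y \<le> value_bound" "s' var_code 0 div 2 div y \<le> value_bound" for y
      using bounded_byD[OF step.bounded, of var_code 0] by (meson div_le_dividend le_trans)+
    have "Suc j \<le> value_bound"
      using index_le_value_bound[OF step.index[unfolded b_def] two_k_squared_le_iteration_bound] .
    then have block: "Suc (s' var_block 0) \<le> value_bound" using step.inv by (simp add: Inv_def)
    have "b - j = Suc (b - Suc j)" using step.index by simp
    then show ?case
      using step.inv s' code block
      by (intro spec_If spec_Seq_Write spec_Write) (auto simp: Inv_def)
  qed (use assms iteration_bounds in \<open>auto simp: b_def Inv_def goal_def\<close>)
  then show ?thesis by (rule ensures_conseq) (simp add: Inv_def goal_def b_def)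
qed

lemma achieves_marked_cells:
  assumes "s 0 = input"
  shows "achieves marked_cells_prog s (\<lambda>s'. \<forall>q < k * inner_range.
    s' arr_mark q \<noteq> 0 \<longleftrightarrow> q \<in> decode_marks block_size (2 * k * k) (s var_code 0) 0)"
proof -
  have "achieves (clear_prog arr_mark (Mul in_k exp_inner)) s
      (\<lambda>s'. \<forall>q<k * inner_range. s' arr_mark q = 0)"
    using achieves_clear[of "Mul in_k exp_inner" arr_mark s] assms iteration_bounds by simp
  then show ?thesis
    unfolding marked_cells_prog_def
  proof (induction rule: spec_Seq)
    case (second s1)
    have "s1 0 = input" "s1 var_code = s var_code"
      using second.frame assms by (simp_all add: prog_defs)
    then show ?case
      using second.post
        by (intro spec_Seq_Write ensures_conseq[OF achieves_decode_marks]) simp_all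
  qed
qed

lemma achieves_multipliers:
  assumes "s 0 = input" "s var_code 0 = e"
  shows "achieves multipliers_prog s (\<lambda>s'. s' var_outer 0 = outer_multiplier e \<and>
    (\<forall>i<k. s' arr_mult i = inner_multiplier e i) \<and>
    s' var_code 0 = e div outer_modulus div inner_modulus ^ k)"
proof (rule ensures_bounded)
  assume "bounded_by value_bound s"
  then have "e \<le> value_bound" using bounded_byD[of value_bound s var_code 0] assms(2) by simp
  then have small: "e mod m \<le> value_bound" "e div m \<le> value_bound" for m
    by (meson div_le_dividend mod_less_eq_dividend le_trans)+
  let ?s = "s(var_outer := (s var_outer)(0 := outer_multiplier e),
    var_code := (s var_code)(0 := e div outer_modulus))"
  have "achieves (digits_prog arr_mult in_k exp_inner_modulus) ?s
    (\<lambda>s'. (\<forall>i<k. s' arr_mult i = inner_multiplier e i) \<and>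
      s' var_code 0 = e div outer_modulus div inner_modulus ^ k)"
    using achieves_digits[of in_k exp_inner_modulus arr_mult ?s] assms iteration_bounds
    by (simp add: inner_multiplier_def)
  then have "achieves (digits_prog arr_mult in_k exp_inner_modulus) ?s
    (\<lambda>s'. s' var_outer 0 = outer_multiplier e \<and> (\<forall>i<k. s' arr_mult i = inner_multiplier e i) \<and>
      s' var_code 0 = e div outer_modulus div inner_modulus ^ k)"
    by (rule ensures_conseq) (simp add: prog_defs)
  then show "achieves multipliers_prog s (\<lambda>s'. s' var_outer 0 = outer_multiplier e \<and>
      (\<forall>i<k. s' arr_mult i = inner_multiplier e i) \<and>
      s' var_code 0 = e div outer_modulus div inner_modulus ^ k)"
    unfolding multipliers_prog_def
    using assms small by (intro spec_Seq_Write) (simp_all add: outer_multiplier_def)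
qed

definition decoded :: "nat \<Rightarrow> state \<Rightarrow> bool" where
  "decoded e s \<longleftrightarrow> s var_outer 0 = outer_multiplier e \<and> (\<forall>i<k. s arr_mult i = inner_multiplier e i) \<and>
     (\<forall>y<l * k. s arr_side y = side_bit e y) \<and>
     (\<forall>q<k * inner_range. s arr_mark q \<noteq> 0 \<longleftrightarrow> q \<in> marked_cells e)"

lemma achieves_decode_guess:
  assumes "s 0 = input" "s var_code 0 = e"
  shows "achieves decode_guess_prog s (decoded e)"
  unfolding decode_guess_prog_def
  using achieves_multipliers[of s, OF assms]
proof (induction rule: spec_Seq)
  case multipliers: (second s1)
  have s1: "s1 0 = input" using multipliers.frame assms by (simp add: prog_defs)
  have "achieves (digits_prog arr_side (Mul in_l in_k) (Const 2)) s1
    (\<lambda>s'. (\<forall>y<l * k. s' arr_side y = side_bit e y) \<and>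
      s' var_code 0 = e div outer_modulus div inner_modulus ^ k div 2 ^ (l * k))"
    using achieves_digits[of "Mul in_l in_k" "Const 2" arr_side s1] s1 multipliers.post
      iteration_bounds
    by (simp add: side_bit_def)
  then show ?case
  proof (induction rule: spec_Seq)
    case sides: (second s2)
    have s2: "s2 0 = input" "s2 var_outer = s1 var_outer" "s2 arr_mult = s1 arr_mult"
      using sides.frame s1 by (simp_all add: prog_defs)
    from achieves_marked_cells[of s2, OF s2(1)] show ?case
    proof (induction rule: ensures_conseq)
      case (post s3)
      have "s3 var_outer = s1 var_outer" "s3 arr_mult = s1 arr_mult" "s3 arr_side = s2 arr_side"
        using post.frame s2 by (simp_all add: prog_defs)
      then show ?case
        using multipliers.post sides.post post.post by (simp add: decoded_def marked_cells_def)
    qed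
  qed
qed

subsection \<open>Computing the guessed coloring\<close>

lemma endpoints_less: "endpoints ep \<Longrightarrow> t < l \<Longrightarrow> b < 2 \<Longrightarrow> ep (2 * t + b) < n"
  by (auto simp: endpoints_def edge_at_def less_2_cases_iff)

lemma achieves_allowed:
  assumes "s 0 = input" "endpoints (s arr_ends)" "decoded e s"
    and "s ctr_vertex 0 = v" "v < n" "s ctr_color 0 = i" "i < k"
  shows "achieves allowed_prog s
    (\<lambda>s'. s' var_hit 0 \<noteq> 0 \<longleftrightarrow> s var_hit 0 \<noteq> 0 \<and> allowed (s arr_ends) e i v)"
proof -
  let ?end = "\<lambda>t. s arr_ends (2 * t + side_bit e (t * k + i))"
  have "achieves allowed_prog s
    (\<lambda>s'. s' var_hit 0 \<noteq> 0 \<longleftrightarrow> s var_hit 0 \<noteq> 0 \<and> (\<forall>t<l. {?end t, v} \<notin> edges (A t)))"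
    unfolding allowed_prog_def
  proof (induction rule: achieves_For[where
        Inv = "\<lambda>j s'. s' var_hit 0 \<noteq> 0 \<longleftrightarrow> s var_hit 0 \<noteq> 0 \<and> (\<forall>t<j. {?end t, v} \<notin> edges (A t))"])
    case (step j s')
    have s': "s' 0 = input" "s' ctr_vertex 0 = v" "s' ctr_color 0 = i" "s' arr_ends = s arr_ends"
      "s' arr_side = s arr_side"
      using step.frame assms by simp_all
    have "j * k + i < l * k" using step.index assms(7) by (rule mult_add_less)
    then have "s arr_side (j * k + i) = side_bit e (j * k + i)"
      using assms(3) by (simp add: decoded_def)
    moreover have "?end j < n" using endpoints_less[OF assms(2) step.index side_bit_less_2] .
    ultimately show ?case
      using s' step.index step.counter step.inv assms(5)
      by (intro spec_If spec_Write spec_Skip) (auto simp: less_Suc_eq split: if_splits)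
  qed (use assms iteration_bounds in auto)
  then show ?thesis by (simp add: allowed_def)
qed

lemma eval_exp_hash:
  assumes "s 0 = input" "decoded e s" "s ctr_vertex 0 = v"
  shows "eval exp_hash s = mult_hash outer_range n (outer_multiplier e) v"
  using assms by (simp add: exp_hash_def decoded_def mult_hash_def outer_modulus_def)

lemma eval_exp_cell:
  assumes "s 0 = input" "decoded e s" "s ctr_color 0 = i" "i < k"
    and "s var_hash 0 = mult_hash outer_range n (outer_multiplier e) v"
  shows "eval exp_cell s = cell (outer_multiplier e) (inner_multiplier e) i v"
  using assms by (simp add: exp_cell_def decoded_def cell_def mult_hash_def inner_modulus_def)

lemma achieves_test_color:
  assumes "s 0 = input" "endpoints (s arr_ends)" "decoded e s" "s ctr_vertex 0 = v" "v < n"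
    and "s ctr_color 0 = i" "i < k" "s var_hash 0 = mult_hash outer_range n (outer_multiplier e) v"
  shows "achieves test_color_prog s (\<lambda>s'. s' var_hit 0 \<noteq> 0 \<longleftrightarrow>
    marked e i v \<and> allowed (s arr_ends) e i v)"
  unfolding test_color_prog_def
proof (rule spec_Seq_Write)
  let ?s = "s(var_hit := (s var_hit)(eval (Const 0) s := eval (Read arr_mark exp_cell) s))"
  have cell: "eval exp_cell s = cell (outer_multiplier e) (inner_multiplier e) i v"
    using assms(1,3,6,7,8) by (rule eval_exp_cell)
  have "s arr_mark (eval exp_cell s) \<noteq> 0 \<longleftrightarrow> marked e i v"
    using assms(3) cell_less[OF assms(7)] unfolding cell decoded_def by blast
  then show "achieves allowed_prog ?s (\<lambda>s'. s' var_hit 0 \<noteq> 0 \<longleftrightarrow>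
      marked e i v \<and> allowed (s arr_ends) e i v)"
    using achieves_allowed[of ?s e v i] assms by (simp add: decoded_def)
qed (simp add: bounded_byD)

lemma achieves_vertex_color:
  assumes "s 0 = input" "endpoints (s arr_ends)" "decoded e s" "s ctr_vertex 0 = v" "v < n"
    and "s arr_color v = 0" "s var_hash 0 = mult_hash outer_range n (outer_multiplier e) v"
  shows "achieves vertex_color_prog s
    (\<lambda>s'. s' arr_color = (s arr_color)(v := hashed_coloring (s arr_ends) e v))"
proof -
  define Q where "Q i \<longleftrightarrow> marked e i v \<and> allowed (s arr_ends) e i v" for i
  have "achieves vertex_color_prog s (\<lambda>s'. s' arr_color = (s arr_color)(v := last_true Q k))"
    unfolding vertex_color_prog_def
  proof (induction rule: achieves_For[where
        Inv = "\<lambda>j s'. s' arr_color = (s arr_color)(v := last_true Q j)"])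
    case (step j s')
    have frame: "s' a = s a"
      if "a \<in> {0, arr_ends, arr_mult, arr_side, arr_mark, var_outer, var_hash, ctr_vertex}" for a
      using step.frame[of a] that by (auto simp: prog_defs)
    have "achieves test_color_prog s' (\<lambda>s'. s' var_hit 0 \<noteq> 0 \<longleftrightarrow> Q j)"
      using achieves_test_color[of s' e v j] assms frame step.counter step.index
      by (simp add: Q_def decoded_def)
    then show ?case
    proof (induction rule: spec_Seq)
      case (second s2)
      have "s2 ctr_vertex 0 = v" "s2 ctr_color 0 = j" "s2 arr_color = s' arr_color"
        using second.frame frame assms(4) step.counter by (simp_all add: prog_defs)
      then show ?case
        using second.post step.inv index_le_value_bound[OF step.index k_le_iteration_bound]
        by (intro spec_If spec_Write spec_Skip) auto
    qed
  qed (use assms iteration_bounds in \<open>auto simp: prog_defs fun_eq_iff\<close>)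
  then show ?thesis by (simp add: Q_def[abs_def] hashed_coloring_def)
qed

lemma achieves_hashed_coloring:
  assumes "s 0 = input" "endpoints (s arr_ends)" "decoded e s"
  shows "achieves hashed_coloring_prog s
      (\<lambda>s'. \<forall>v<n. s' arr_color v = hashed_coloring (s arr_ends) e v)"
  unfolding hashed_coloring_prog_def
proof (induction rule: achieves_For[where
      Inv = "\<lambda>j s'. \<forall>v<j. s' arr_color v = hashed_coloring (s arr_ends) e v"])
  case (step j s')
  let ?hash = "mult_hash outer_range n (outer_multiplier e) j"
  let ?s = "s'(arr_color := (s' arr_color)(j := 0), var_hash := (s' var_hash)(0 := ?hash))"
  have frame: "s' a = s a" if "a \<in> {0, arr_ends, arr_mult, arr_side, arr_mark, var_outer}" for a
    using step.frame[of a] that by (auto simp: prog_defs)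
  have "decoded e (s'(arr_color := f))" for f using assms(3) frame by (simp add: decoded_def)
  then have hash: "eval exp_hash (s'(arr_color := f)) = ?hash" for f
    using step.counter frame assms(1) by (intro eval_exp_hash) simp_all
  have "?hash < outer_range" using sizes_pos by (intro mult_hash_less)
  also have "\<dots> \<le> outer_modulus" using n_pos by (simp add: outer_modulus_def)
  finally have "?hash \<le> value_bound"
    using le_value_bound[OF outer_modulus_le_iteration_bound] by linarith
  have "achieves vertex_color_prog ?s
    (\<lambda>s''. s'' arr_color = (?s arr_color)(j := hashed_coloring (s arr_ends) e j))"
    using achieves_vertex_color[of ?s e j] assms frame step.counter step.index
    by (simp add: decoded_def)
  then have "achieves vertex_color_prog ?s
    (\<lambda>s'. \<forall>v<Suc j. s' arr_color v = hashed_coloring (s arr_ends) e v)"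
    by (rule ensures_conseq) (use step.inv in \<open>auto simp: less_Suc_eq\<close>)
  then show ?case
    using \<open>?hash \<le> value_bound\<close> step.counter by (intro spec_Seq_Write) (simp_all add: hash)
qed (use assms iteration_bounds in \<open>auto simp: prog_defs\<close>)

lemma achieves_listed_coloring:
  assumes "s 0 = input"
  shows "achieves listed_coloring_prog s
    (\<lambda>s'. \<forall>v<n. s' arr_color v = listed_coloring k (\<lambda>p. s var_code 0 div n ^ p mod n) (k * k) v)"
proof -
  let ?c = "listed_coloring k (\<lambda>p. s var_code 0 div n ^ p mod n)"
  have "achieves (clear_prog arr_color in_n) s (\<lambda>s'. \<forall>v<n. s' arr_color v = 0)"
    using achieves_clear[of in_n arr_color s] assms iteration_bounds by simp
  then have "achieves listed_coloring_prog s
    (\<lambda>s'. (\<forall>v<n. s' arr_color v = ?c (k * k) v) \<and> s' var_code 0 = s var_code 0 div n ^ (k * k))"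
    unfolding listed_coloring_prog_def
  proof (induction rule: spec_Seq)
    case clear: (second s1)
    have s1: "s1 0 = input" "s1 var_code = s var_code"
      using clear.frame assms by (simp_all add: prog_defs)
    show ?case
    proof (induction rule: achieves_For[where Inv = "\<lambda>j s'. (\<forall>v<n. s' arr_color v = ?c j v) \<and>
        s' var_code 0 = s var_code 0 div n ^ j"])
      case (step j s')
      have "s' 0 = input" using step.frame s1 by simp
      moreover have "j div k < k" using step.index by (simp add: less_mult_imp_div_less)
      then have "Suc (j div k) \<le> value_bound"
        using k_le_iteration_bound by (rule index_le_value_bound)
      moreover have "s' var_code 0 div n \<le> value_bound"
        using bounded_byD[OF step.bounded, of var_code 0] by (meson div_le_dividend le_trans)
      ultimately show ?case
        using step.counter step.inv
        by (intro spec_Seq_Write spec_Write) (auto simp: div_mult2_eq[symmetric] mult.commute)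
    qed (use clear.post s1 iteration_bounds in auto)
  qed
  then show ?thesis by (rule ensures_conseq) simp
qed

lemma achieves_guessed_coloring:
  assumes "s 0 = input" "s var_direct 0 \<noteq> 0 \<longleftrightarrow> direct" "endpoints (s arr_ends)"
  shows "achieves guessed_coloring_prog s
    (\<lambda>s'. \<forall>v<n. s' arr_color v = guessed_coloring (s arr_ends) (s ctr_guess 0) v)"
proof -
  let ?e = "s ctr_guess 0"
  let ?s = "s(var_code := (s var_code)(0 := ?e))"
  have "achieves (Seq decode_guess_prog hashed_coloring_prog) ?s
    (\<lambda>s'. \<forall>v<n. s' arr_color v = hashed_coloring (s arr_ends) ?e v)"
  proof (rule spec_Seq)
    show "achieves decode_guess_prog ?s (decoded ?e)"
      using assms(1) by (intro achieves_decode_guess) simp_all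
    fix s1 assume "decoded ?e s1" and "\<And>a. a \<notin> writes decode_guess_prog \<Longrightarrow> s1 a = ?s a"
    then show "achieves hashed_coloring_prog s1
        (\<lambda>s'. \<forall>v<n. s' arr_color v = hashed_coloring (s arr_ends) ?e v)"
      using achieves_hashed_coloring[of s1 ?e] assms(1,3) by (simp add: prog_defs)
  qed
  then show ?thesis
    unfolding guessed_coloring_prog_def
    using achieves_listed_coloring[of ?s] assms
    by (intro spec_Seq_Write spec_If) (simp_all add: guessed_coloring_def bounded_byD)
qed

subsection \<open>Testing a guess\<close>

lemma achieves_blocked:
  assumes "s 0 = input" "s ctr_vertex 0 = v" "v < n" "s arr_kept v = s arr_color v"
  shows "achieves blocked_prog s
    (\<lambda>s'. s' arr_kept = (s arr_kept)(v := unblock G (s arr_rank) (s arr_color) v))"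
proof -
  define Q where "Q w \<longleftrightarrow>
      {v, w} \<in> edges G \<and> s arr_rank v < s arr_rank w \<and> s arr_color w = s arr_color v" for w
  have "achieves blocked_prog s
    (\<lambda>s'. s' arr_kept = (s arr_kept)(v := if \<exists>w<n. Q w then 0 else s arr_color v))"
    unfolding blocked_prog_def
  proof (induction rule: achieves_For[where
        Inv = "\<lambda>j s'. s' arr_kept = (s arr_kept)(v := if \<exists>w<j. Q w then 0 else s arr_color v)"])
    case (step j s')
    have s': "s' 0 = input" "s' ctr_vertex 0 = v" "s' arr_rank = s arr_rank"
      "s' arr_color = s arr_color"
      using step.frame assms by simp_all
    let ?blocks = "Mul (in_graph (Var ctr_vertex) (Var ctr_nbr))
      (Mul (Sub (Read arr_rank (Var ctr_nbr)) (Read arr_rank (Var ctr_vertex)))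
        (Eq (Read arr_color (Var ctr_nbr)) (Read arr_color (Var ctr_vertex))))"
    have "eval ?blocks s' \<noteq> 0 \<longleftrightarrow> Q j"
      using s' step.index step.counter assms(3) by (auto simp: Q_def)
    then show ?case
      using s'(2) step.inv
        by (intro spec_If spec_Write spec_Skip) (auto simp: less_Suc_eq simp del: eval.simps(5))
  qed (use assms iteration_bounds in \<open>auto simp: fun_eq_iff\<close>)
  then show ?thesis by (simp add: Q_def unblock_def verts_G Bex_def)
qed

lemma achieves_unblock:
  assumes "s 0 = input"
  shows "achieves unblock_prog s
      (\<lambda>s'. \<forall>v<n. s' arr_kept v = unblock G (s arr_rank) (s arr_color) v)"
  unfolding unblock_prog_def
proof (induction rule: achieves_For[where
      Inv = "\<lambda>j s'. \<forall>v<j. s' arr_kept v = unblock G (s arr_rank) (s arr_color) v"])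
  case (step j s')
  let ?s = "s'(arr_kept := (s' arr_kept)(j := s arr_color j))"
  have s': "s' 0 = input" "s' arr_rank = s arr_rank" "s' arr_color = s arr_color"
    using step.frame assms by (simp_all add: prog_defs)
  have "achieves blocked_prog ?s
    (\<lambda>s''. s'' arr_kept = (?s arr_kept)(j := unblock G (s arr_rank) (s arr_color) j))"
    using achieves_blocked[of ?s j] s' step.counter step.index by simp
  then have "achieves blocked_prog ?s
      (\<lambda>s'. \<forall>v<Suc j. s' arr_kept v = unblock G (s arr_rank) (s arr_color) v)"
    by (rule ensures_conseq) (use step.inv in \<open>auto simp: less_Suc_eq\<close>)
  moreover have "s arr_color j \<le> value_bound"
    using bounded_byD[OF step.bounded, of arr_color j] s'(3) by simp
  ultimately show ?case using s'(3) step.counter by (intro spec_Seq_Write) simp_all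
qed (use assms iteration_bounds in \<open>auto simp: prog_defs\<close>)

definition sees :: "(nat \<Rightarrow> nat) \<Rightarrow> nat \<Rightarrow> nat \<Rightarrow> bool" where
  "sees z v c \<longleftrightarrow> (\<exists>u \<in> verts G. {u, v} \<in> edges G \<and> z u = c)"

lemma grundy_vertex_Suc_iff:
  "grundy_vertex G z (Suc i) v \<longleftrightarrow> v < n \<and> z v = Suc i \<and> (\<forall>c \<in> {1..i}. sees z v c)"
  by (simp add: grundy_vertex_def sees_def verts_G atLeastLessThanSuc_atLeastAtMost)

lemma achieves_sees_color:
  assumes "s 0 = input" "s ctr_vertex 0 = v" "v < n" "s ctr_lower 0 = c"
  shows "achieves sees_color_prog s (\<lambda>s'. s' var_seen 0 \<noteq> 0 \<longleftrightarrow> sees (s arr_kept) v (Suc c))"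
proof -
  let ?seen = "\<lambda>j. \<exists>u<j. {u, v} \<in> edges G \<and> s arr_kept u = Suc c"
  have "achieves (Assign var_seen (Const 0)) s (\<lambda>s'. s' var_seen 0 = 0)"
    by (intro spec_Write) simp_all
  then have "achieves sees_color_prog s (\<lambda>s'. s' var_seen 0 \<noteq> 0 \<longleftrightarrow> ?seen n)"
    unfolding sees_color_prog_def
  proof (induction rule: spec_Seq)
    case init: (second s1)
    show ?case
    proof (induction rule: achieves_For[where Inv = "\<lambda>j s'. s' var_seen 0 \<noteq> 0 \<longleftrightarrow> ?seen j"])
      case (step j s')
      have "s' 0 = input" "s' ctr_vertex 0 = v" "s' ctr_lower 0 = c" "s' arr_kept = s arr_kept"
        using step.frame init.frame assms by simp_all
      then show ?case
        using step.index step.counter step.inv assms(3)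
        by (intro spec_If spec_Write spec_Skip) (auto simp: less_Suc_eq split: if_splits)
    qed (use init assms iteration_bounds in auto)
  qed
  then show ?thesis by (simp add: sees_def verts_G Bex_def)
qed

lemma achieves_sees_lower_colors:
  assumes "s 0 = input" "s ctr_vertex 0 = v" "v < n" "s ctr_color 0 = i" "i \<le> iteration_bound"
  shows "achieves sees_lower_colors_prog s
    (\<lambda>s'. s' var_all 0 \<noteq> 0 \<longleftrightarrow> (\<forall>c \<in> {1..i}. sees (s arr_kept) v c))"
proof -
  have "achieves (Assign var_all (Const 1)) s (\<lambda>s'. s' var_all 0 = 1)"
    by (intro spec_Write) simp_all
  then show ?thesis
    unfolding sees_lower_colors_prog_def
  proof (induction rule: spec_Seq)
    case init: (second s1)
    show ?case
    proof (induction rule: achieves_For[where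
          Inv = "\<lambda>j s'. s' var_all 0 \<noteq> 0 \<longleftrightarrow> (\<forall>c \<in> {1..j}. sees (s arr_kept) v c)"])
      case (step j s')
      have s': "s' 0 = input" "s' ctr_vertex 0 = v" "s' arr_kept = s arr_kept"
        using step.frame init.frame assms by (simp_all add: prog_defs)
      from achieves_sees_color[of s', OF s'(1,2) assms(3) step.counter] show ?case
      proof (induction rule: spec_Seq)
        case (second s2)
        have "s2 var_all = s' var_all" using second.frame by (simp add: prog_defs)
        then show ?case
          using second.post step.inv s'(3)
          by (intro spec_If spec_Write spec_Skip) (auto simp: atLeastAtMostSuc_conv)
      qed
    qed (use init assms in \<open>auto simp: prog_defs\<close>)
  qed
qed

lemma achieves_test_grundy_vertex:
  assumes "s 0 = input" "s ctr_vertex 0 = v" "v < n" "s ctr_color 0 = i" "i \<le> iteration_bound"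
  shows "achieves test_grundy_vertex_prog s
    (\<lambda>s'. s' var_found 0 \<noteq> 0 \<longleftrightarrow> s var_found 0 \<noteq> 0 \<or> grundy_vertex G (s arr_kept) (Suc i) v)"
  unfolding test_grundy_vertex_prog_def
proof (rule spec_If)
  assume "eval (Eq (Read arr_kept (Var ctr_vertex)) (Add (Var ctr_color) (Const 1))) s \<noteq> 0"
  then have color: "s arr_kept v = Suc i" using assms(2,4) by (simp split: if_splits)
  from achieves_sees_lower_colors[of s, OF assms]
  show "achieves (Seq sees_lower_colors_prog (If (Var var_all) (Assign var_found (Const 1)) Skip)) s
    (\<lambda>s'. s' var_found 0 \<noteq> 0 \<longleftrightarrow> s var_found 0 \<noteq> 0 \<or> grundy_vertex G (s arr_kept) (Suc i) v)"
  proof (induction rule: spec_Seq)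
    case (second s1)
    have "s1 var_found = s var_found" using second.frame by (simp add: prog_defs)
    moreover have "s1 var_all 0 \<noteq> 0 \<longleftrightarrow> grundy_vertex G (s arr_kept) (Suc i) v"
      using second.post color assms(3) by (simp add: grundy_vertex_Suc_iff)
    ultimately show ?case by (intro spec_If spec_Write spec_Skip) auto
  qed
next
  assume "eval (Eq (Read arr_kept (Var ctr_vertex)) (Add (Var ctr_color) (Const 1))) s = 0"
  then have "\<not> grundy_vertex G (s arr_kept) (Suc i) v"
    using assms(2,4) by (simp add: grundy_vertex_Suc_iff split: if_splits)
  then show "achieves Skip s
    (\<lambda>s'. s' var_found 0 \<noteq> 0 \<longleftrightarrow> s var_found 0 \<noteq> 0 \<or> grundy_vertex G (s arr_kept) (Suc i) v)"
    by (intro spec_Skip) simp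
qed

lemma achieves_grundy_vertex:
  assumes "s 0 = input" "s ctr_color 0 = i" "i \<le> iteration_bound"
  shows "achieves grundy_vertex_prog s
    (\<lambda>s'. s' var_found 0 \<noteq> 0 \<longleftrightarrow> (\<exists>v. grundy_vertex G (s arr_kept) (Suc i) v))"
proof -
  let ?found = "\<lambda>j. \<exists>v<j. grundy_vertex G (s arr_kept) (Suc i) v"
  have "achieves (Assign var_found (Const 0)) s (\<lambda>s'. s' var_found 0 = 0)"
    by (intro spec_Write) simp_all
  then have "achieves grundy_vertex_prog s (\<lambda>s'. s' var_found 0 \<noteq> 0 \<longleftrightarrow> ?found n)"
    unfolding grundy_vertex_prog_def
  proof (induction rule: spec_Seq)
    case init: (second s1)
    show ?case
    proof (induction rule: achieves_For[where Inv = "\<lambda>j s'. s' var_found 0 \<noteq> 0 \<longleftrightarrow> ?found j"])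
      case (step j s')
      have s': "s' 0 = input" "s' ctr_color 0 = i" "s' arr_kept = s arr_kept"
        using step.frame init.frame assms by (simp_all add: prog_defs)
      from achieves_test_grundy_vertex[of s', OF s'(1) step.counter step.index s'(2) assms(3)]
      show ?case
        by (rule ensures_conseq) (use step.inv s'(3) in \<open>auto simp: less_Suc_eq\<close>)
    qed (use init assms iteration_bounds in \<open>auto simp: prog_defs\<close>)
  qed
  then show ?thesis by (rule ensures_conseq) (auto simp: grundy_vertex_def verts_G)
qed

lemma achieves_grundy_condition:
  assumes "s 0 = input"
  shows "achieves grundy_condition_prog s (\<lambda>s'. s' var_ok 0 \<noteq> 0 \<longleftrightarrow>
      grundy_condition G k (s arr_kept))"
proof -
  have "achieves (Assign var_ok (Const 1)) s (\<lambda>s'. s' var_ok 0 = 1)"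
    by (intro spec_Write) simp_all
  then show ?thesis
    unfolding grundy_condition_prog_def
  proof (induction rule: spec_Seq)
    case init: (second s1)
    show ?case
    proof (induction rule: achieves_For[where
          Inv = "\<lambda>j s'. s' var_ok 0 \<noteq> 0 \<longleftrightarrow> grundy_condition G j (s arr_kept)"])
      case (step j s')
      have s': "s' 0 = input" "s' arr_kept = s arr_kept"
        using step.frame init.frame assms by (simp_all add: prog_defs)
      have "j \<le> iteration_bound" using step.index k_le_iteration_bound by linarith
      from achieves_grundy_vertex[of s', OF s'(1) step.counter this] show ?case
      proof (induction rule: spec_Seq)
        case (second s2)
        have "s2 var_ok = s' var_ok" using second.frame by (simp add: prog_defs)
        then show ?case
          using second.post step.inv s'(2)
          by (intro spec_If spec_Write spec_Skip)
            (auto simp: grundy_condition_def atLeastAtMostSuc_conv)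
      qed
    qed (use init assms iteration_bounds in \<open>auto simp: prog_defs grundy_condition_def\<close>)
  qed
qed

lemma achieves_test_guess:
  assumes "s 0 = input" "s var_direct 0 \<noteq> 0 \<longleftrightarrow> direct" "endpoints (s arr_ends)"
  shows "achieves test_guess_prog s
    (\<lambda>s'. s' 1 0 \<noteq> 0 \<longleftrightarrow> s 1 0 \<noteq> 0 \<or> success (s arr_rank) (s arr_ends) (s ctr_guess 0))"
  unfolding test_guess_prog_def
  using achieves_guessed_coloring[of s, OF assms]
proof (induction rule: spec_Seq)
  case colored: (second s1)
  have s1: "s1 0 = input" "s1 arr_rank = s arr_rank" "s1 1 = s 1"
    using colored.frame assms(1) by (simp_all add: prog_defs)
  from achieves_unblock[of s1, OF s1(1)] show ?case
  proof (induction rule: spec_Seq)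
    case unblocked: (second s2)
    have s2: "s2 0 = input" "s2 1 = s 1" using unblocked.frame s1 by (simp_all add: prog_defs)
    have "s2 arr_kept v = unblock G (s arr_rank) (guessed_coloring (s arr_ends) (s ctr_guess 0)) v"
      if "v \<in> verts G" for v
      using unblocked.post that s1(2) colored.post
        unblock_cong[of G "s1 arr_color"
          "guessed_coloring (s arr_ends) (s ctr_guess 0)" v "s arr_rank"]
      by (simp add: verts_G)
    then have success: "grundy_condition G k (s2 arr_kept) \<longleftrightarrow>
        success (s arr_rank) (s arr_ends) (s ctr_guess 0)"
      unfolding success_def by (rule grundy_condition_cong)
    from achieves_grundy_condition[of s2, OF s2(1)] show ?case
    proof (induction rule: spec_Seq)
      case (second s3)
      have "s3 1 = s 1" using second.frame s2 by (simp add: prog_defs)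
      then show ?case
        using second.post success by (intro spec_If spec_Write spec_Skip) auto
    qed
  qed
qed

subsection \<open>The whole program\<close>

lemma achieves_spgc:
  assumes "s 0 = input" "\<And>v. s arr_rank v = 0" "s 1 0 = 0"
  shows "ensures value_bound (Suc num_guesses * cost iteration_bound spgc_prog) spgc_prog s
    (\<lambda>s'. accepting s' \<longleftrightarrow> spgc_yes x)"
proof -
  let ?loop = "For ctr_guess (Var var_guesses) test_guess_prog"
  have "ensures value_bound
      (cost iteration_bound setup_prog + Suc num_guesses * cost iteration_bound ?loop)
    spgc_prog s (\<lambda>s'. accepting s' \<longleftrightarrow> spgc_yes x)"
    unfolding spgc_prog_def
    using achieves_setup[of s, OF assms(1,2)]
  proof (induction rule: ensures_Seq)
    case prepared: (second s1)
    let ?success = "success (s1 arr_rank) (s1 arr_ends)"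
    have s1: "s1 0 = input" "s1 1 0 = 0" using prepared.frame assms by (simp_all add: prog_defs)
    have "ensures value_bound (Suc num_guesses * cost iteration_bound ?loop) ?loop s1
      (\<lambda>s'. s' 1 0 \<noteq> 0 \<longleftrightarrow> (\<exists>e<num_guesses. ?success e))"
    proof (induction rule: ensures_For[where Inv = "\<lambda>j s'. s' 1 0 \<noteq> 0 \<longleftrightarrow> (\<exists>e<j. ?success e)"])
      case (step j s')
      have "s' 0 = input" "s' arr_rank = s1 arr_rank" "s' arr_ends = s1 arr_ends"
        "s' var_direct = s1 var_direct"
        using step.frame s1 by (simp_all add: prog_defs)
      then show ?case
        using prepared.post step.counter step.inv
        by (intro ensures_conseq[OF achieves_test_guess]) (auto simp: less_Suc_eq)
    qed (use s1 prepared.post value_bounds in \<open>auto simp: prog_defs\<close>)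
    then show ?case
    proof (rule ensures_conseq)
      fix s' :: state assume "s' 1 0 \<noteq> 0 \<longleftrightarrow> (\<exists>e<num_guesses. ?success e)"
      then show "accepting s' \<longleftrightarrow> spgc_yes x"
        using success_sound success_complete prepared.post unfolding accepting_def by blast
    qed
  qed
  then show ?thesis
    by (rule ensures_mono) (simp add: spgc_prog_def distrib_left)
qed

end

section \<open>Bounding the running time\<close>

lemma power_le_two_power:
  assumes "c \<le> 2 ^ j" "j * e \<le> m"
  shows "(c::nat) ^ e \<le> 2 ^ m"
proof -
  have "c ^ e \<le> (2 ^ j) ^ e" using assms(1) by (rule power_mono) simp
  also have "\<dots> = 2 ^ (j * e)" by (simp add: power_mult)
  also have "\<dots> \<le> 2 ^ m" using assms(2) by (intro power_increasing) auto
  finally show ?thesis .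
qed

lemma power_le_two_power_mult: "c * e \<le> m \<Longrightarrow> (c::nat) ^ e \<le> 2 ^ m"
  by (rule power_le_two_power[OF less_imp_le[OF less_exp]])

lemma thirteen_power_le: "4 * e \<le> m \<Longrightarrow> (13::nat) ^ e \<le> 2 ^ m"
  by (rule power_le_two_power[where j = 4]) simp_all

lemma power_le_self_power_mult_two_power:
  assumes "0 < m"
  shows "(l::nat) ^ m \<le> m ^ m * 2 ^ l"
proof -
  let ?q = "l div m"
  have "l \<le> m * Suc ?q" using dividend_less_times_div[OF assms, of l] by simp
  also have "\<dots> \<le> m * 2 ^ ?q" using less_exp[of ?q] by (intro mult_le_mono2) (simp add: Suc_le_eq)
  finally have "l ^ m \<le> (m * 2 ^ ?q) ^ m" by (rule power_mono) simp
  also have "\<dots> = m ^ m * 2 ^ (?q * m)" by (simp add: power_mult_distrib power_mult)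
  also have "\<dots> \<le> m ^ m * 2 ^ l" by (intro mult_le_mono2 power_increasing) simp_all
  finally show ?thesis .
qed

definition poly_overhead :: "nat \<Rightarrow> nat" where
  "poly_overhead e = 2 ^ e * Suc (2 * e) ^ Suc (2 * e)"

context spgc_parameters
begin

definition kkd :: nat where
  "kkd = k * k * d"

abbreviation "main_factor \<equiv> 2 ^ (l * k) * k ^ (k * k)"

lemma kkd_bounds:
  shows d_le_kkd: "d \<le> kkd" and k_le_kkd: "k \<le> kkd" and k_squared_le_kkd: "k * k \<le> kkd"
    and d_k_squared_le_kkd: "d * (k * k) \<le> kkd" and "1 \<le> kkd" "d * k \<le> kkd"
  using k_pos d_pos by (auto simp: kkd_def mult_ac)

lemma outer_modulus_le: "outer_modulus \<le> 2 ^ (9 * kkd) * n"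
proof -
  have bounds: "13 ^ 1 \<le> (2::nat) ^ (4 * kkd)" "d ^ 1 \<le> 2 ^ kkd" "k ^ 4 \<le> 2 ^ (4 * kkd)"
    by (rule thirteen_power_le, use kkd_bounds in simp)
      (rule power_le_two_power_mult, use kkd_bounds in simp)+
  have "k ^ 4 = k * (k * (k * k))" by (simp add: eval_nat_numeral)
  then have "outer_modulus = 13 ^ 1 * d ^ 1 * k ^ 4 * n"
    by (simp only: size_defs power_one_right mult_ac)
  also have "\<dots> \<le> 2 ^ (4 * kkd) * 2 ^ kkd * 2 ^ (4 * kkd) * n"
    by (intro mult_le_mono order_refl bounds)
  also have "\<dots> = 2 ^ (9 * kkd) * n" by (simp add: power_add[symmetric])
  finally show ?thesis .
qed

lemma inner_modulus_power_le: "inner_modulus ^ k \<le> 2 ^ (17 * kkd)"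
proof -
  have bounds: "13 ^ (2 * k) \<le> (2::nat) ^ (8 * kkd)" "d ^ (2 * k) \<le> 2 ^ (2 * kkd)"
    "k ^ (7 * k) \<le> 2 ^ (7 * kkd)"
    by (rule thirteen_power_le, use kkd_bounds in simp)
      (rule power_le_two_power_mult, use kkd_bounds in \<open>simp add: mult.left_commute\<close>)+
  have "k ^ 7 = k * (k * (k * (k * (k * (k * k)))))" by (simp add: eval_nat_numeral)
  then have "inner_modulus ^ k = (13 ^ 2 * d ^ 2 * k ^ 7) ^ k"
    by (simp only: size_defs power2_eq_square mult_ac)
  also have "\<dots> = 13 ^ (2 * k) * d ^ (2 * k) * k ^ (7 * k)"
    by (simp only: power_mult_distrib power_mult[symmetric])
  also have "\<dots> \<le> 2 ^ (8 * kkd) * 2 ^ (2 * kkd) * 2 ^ (7 * kkd)"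
    by (intro mult_le_mono bounds)
  also have "\<dots> = 2 ^ (17 * kkd)" by (simp add: power_add[symmetric])
  finally show ?thesis .
qed

lemma block_size_power_le: "block_size ^ (k * Suc k div 2) \<le> 2 ^ (6 * kkd) * k ^ (k * k)"
proof -
  define q where "q = k * Suc k div 2"
  have q2: "2 * q = k * k + k" unfolding q_def by (subst dvd_mult_div_cancel) auto
  have "k \<le> k * k" using k_pos by simp
  then have q: "q \<le> k * k" using q2 by linarith
  have dq: "d * q \<le> kkd" using mult_le_mono2[OF q, of d] d_k_squared_le_kkd by linarith
  have bounds: "13 ^ q \<le> (2::nat) ^ (4 * kkd)" "d ^ q \<le> 2 ^ kkd" "k ^ k \<le> 2 ^ kkd"
    by (rule thirteen_power_le, use k_squared_le_kkd q in linarith)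
      (rule power_le_two_power_mult, use k_squared_le_kkd dq in simp)+
  have "block_size ^ q = 13 ^ q * d ^ q * k ^ (2 * q)"
    unfolding block_size_def power_mult_distrib mult_2 power_add by (simp only: mult_ac)
  also have "\<dots> = 13 ^ q * d ^ q * k ^ k * k ^ (k * k)" by (simp add: q2 power_add)
  also have "\<dots> \<le> 2 ^ (4 * kkd) * 2 ^ kkd * 2 ^ kkd * k ^ (k * k)"
    by (intro mult_le_mono order_refl bounds)
  also have "\<dots> = 2 ^ (6 * kkd) * k ^ (k * k)" by (simp add: power_add[symmetric])
  finally show ?thesis by (simp only: q_def)
qed

lemma hashed_guesses_le: "hashed_guesses \<le> 2 ^ (34 * kkd) * main_factor * n"
proof -
  have bits: "(2::nat) ^ (2 * k * k) \<le> 2 ^ (2 * kkd)"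
    using k_squared_le_kkd by (intro power_increasing) auto
  have "hashed_guesses \<le>
      (2 ^ (9 * kkd) * n) * 2 ^ (17 * kkd) * 2 ^ (l * k) * 2 ^ (2 * kkd) *
      (2 ^ (6 * kkd) * k ^ (k * k))"
    unfolding hashed_guesses_def
    by (intro mult_le_mono outer_modulus_le inner_modulus_power_le block_size_power_le bits
        order_refl)
  also have "\<dots> = 2 ^ (9 * kkd + 17 * kkd + 2 * kkd + 6 * kkd) * main_factor * n"
    by (simp only: power_add mult_ac)
  finally show ?thesis by simp
qed

lemma direct_guesses_mult_power_le:
  assumes direct
  shows "n ^ (k * k) * l ^ e \<le> Suc (2 * e) ^ Suc (2 * e) * 2 ^ (l * k)"
proof -
  let ?c = "Suc (2 * e)"
  have "(n ^ (k * k) * l ^ e)\<^sup>2 = (n ^ (2 * k)) ^ k * l ^ (2 * e)"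
    by (simp add: power_mult_distrib power_mult[symmetric] mult_ac)
  also have "\<dots> \<le> (2 ^ l) ^ k * l ^ ?c"
    using assms l_pos by (intro mult_le_mono power_mono power_increasing) (auto simp: direct_def)
  also have "\<dots> \<le> (2 ^ l) ^ k * (?c ^ ?c * 2 ^ l)"
    by (intro mult_le_mono2 power_le_self_power_mult_two_power) simp
  also have "\<dots> \<le> 2 ^ (l * k) * (?c ^ ?c * 2 ^ (l * k))"
    using k_pos by (intro mult_le_mono order_refl power_increasing) (auto simp: power_mult)
  also have "\<dots> \<le> (?c ^ ?c * 2 ^ (l * k))\<^sup>2"
    by (simp add: power2_eq_square Suc_le_eq)
  finally show ?thesis by (rule power2_le_imp_le) simp
qed

lemma l_power_le_if_not_direct:
  assumes "\<not> direct"
  shows "l ^ e \<le> 2 ^ e * 2 ^ (e * kkd) * n ^ e"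
proof -
  have "(2::nat) ^ l < n ^ (2 * k)" using assms by (simp add: direct_def)
  also have "\<dots> \<le> 2 ^ (n * (2 * k))" by (rule power_le_two_power_mult) simp
  finally have "l \<le> 2 * k * n" by (simp add: mult_ac)
  then have "l ^ e \<le> (2 * k * n) ^ e" by (rule power_mono) simp
  also have "\<dots> = 2 ^ e * k ^ e * n ^ e" by (simp add: power_mult_distrib)
  also have "\<dots> \<le> 2 ^ e * 2 ^ (e * kkd) * n ^ e"
    using power_le_two_power_mult[of k e "e * kkd"] k_le_kkd by (simp add: mult.commute)
  finally show ?thesis .
qed

lemma num_guesses_mult_power_le:
  "num_guesses * l ^ e \<le> poly_overhead e * (2 ^ ((34 + e) * kkd) * main_factor * n ^ (e + 1))"
proof (cases "direct")
  case True
  have "num_guesses * l ^ e \<le> Suc (2 * e) ^ Suc (2 * e) * 2 ^ (l * k)"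
    using direct_guesses_mult_power_le[OF True] True by (simp add: num_guesses_def)
  also have "\<dots> = 1 * Suc (2 * e) ^ Suc (2 * e) * (1 * (2 ^ (l * k) * 1) * 1)" by simp
  also have "\<dots> \<le> poly_overhead e * (2 ^ ((34 + e) * kkd) * main_factor * n ^ (e + 1))"
    unfolding poly_overhead_def
      using k_pos two_le_n by (intro mult_le_mono order_refl one_le_power) auto
  finally show ?thesis .
next
  case False
  have "num_guesses * l ^ e \<le>
      (2 ^ (34 * kkd) * main_factor * n) * (2 ^ e * 2 ^ (e * kkd) * n ^ e)"
    using False hashed_guesses_le l_power_le_if_not_direct[OF False]
    by (simp only: num_guesses_def if_False) (rule mult_le_mono)
  also have "\<dots> = 2 ^ e * (2 ^ ((34 + e) * kkd) * main_factor * n ^ (e + 1))"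
    unfolding power_add distrib_right power_one_right by (simp only: mult_ac)
  also have "\<dots> \<le> poly_overhead e * (2 ^ ((34 + e) * kkd) * main_factor * n ^ (e + 1))"
    using one_le_power[of "Suc (2 * e)" "Suc (2 * e)"] unfolding poly_overhead_def
    by (intro mult_le_mono1) simp
  finally show ?thesis .
qed

lemma iteration_bound_power_le:
  "iteration_bound ^ e \<le> 13 ^ e * 2 ^ (5 * e * kkd) * n ^ (2 * e) * l ^ e"
proof -
  have bounds: "d ^ e \<le> 2 ^ (e * kkd)" "k ^ (4 * e) \<le> 2 ^ (4 * e * kkd)"
    using d_le_kkd k_le_kkd by (simp_all add: power_le_two_power_mult mult.commute)
  have "iteration_bound ^ e = (13 * d * k ^ 4 * n ^ 2 * l) ^ e"
    by (simp add: iteration_bound_def power2_eq_square power4_eq_xxxx mult_ac)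
  also have "\<dots> = 13 ^ e * d ^ e * k ^ (4 * e) * n ^ (2 * e) * l ^ e"
    by (simp only: power_mult_distrib power_mult[symmetric])
  also have "\<dots> \<le> 13 ^ e * 2 ^ (e * kkd) * 2 ^ (4 * e * kkd) * n ^ (2 * e) * l ^ e"
    by (intro mult_le_mono order_refl bounds)
  also have "\<dots> = 13 ^ e * 2 ^ (5 * e * kkd) * n ^ (2 * e) * l ^ e"
    by (simp add: power_add[symmetric] mult.assoc)
  finally show ?thesis .
qed

lemma const_le_n_power: "c \<le> n ^ c"
proof -
  have "c \<le> 2 ^ c" by simp
  also have "\<dots> \<le> n ^ c" using two_le_n by (rule power_mono) simp
  finally show ?thesis .
qed

lemma num_guesses_mult_iteration_bound_le:
  "num_guesses * (C * iteration_bound ^ e) \<le>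
    2 ^ ((34 + 6 * e) * kkd) * main_factor * n ^ (3 * e + 1 + C * 13 ^ e * poly_overhead e)"
proof -
  let ?c = "C * 13 ^ e * poly_overhead e"
  have "num_guesses * (C * iteration_bound ^ e) \<le>
      num_guesses * (C * (13 ^ e * 2 ^ (5 * e * kkd) * n ^ (2 * e) * l ^ e))"
    by (intro mult_le_mono2 iteration_bound_power_le)
  also have "\<dots> = C * 13 ^ e * 2 ^ (5 * e * kkd) * n ^ (2 * e) * (num_guesses * l ^ e)"
    by (simp only: mult_ac)
  also have "\<dots> \<le> C * 13 ^ e * 2 ^ (5 * e * kkd) * n ^ (2 * e) *
      (poly_overhead e * (2 ^ ((34 + e) * kkd) * main_factor * n ^ (e + 1)))"
    by (intro mult_le_mono2 num_guesses_mult_power_le)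
  also have "\<dots> = ?c * (2 ^ (5 * e * kkd + (34 + e) * kkd) * main_factor * n ^ (2 * e + (e + 1)))"
    by (simp only: power_add mult_ac)
  also have "\<dots> \<le>
      n ^ ?c * (2 ^ (5 * e * kkd + (34 + e) * kkd) * main_factor * n ^ (2 * e + (e + 1)))"
    by (intro mult_le_mono1 const_le_n_power)
  also have "\<dots> = 2 ^ (5 * e * kkd + (34 + e) * kkd) * main_factor * n ^ (2 * e + (e + 1) + ?c)"
    by (simp only: power_add mult_ac)
  also have "5 * e * kkd + (34 + e) * kkd = (34 + 6 * e) * kkd" by (simp add: algebra_simps)
  finally show ?thesis by (simp add: add.assoc)
qed

lemma power_le_iteration_bound_power:
  assumes "c \<le> iteration_bound" "e \<le> iteration_bound"
  shows "c ^ e \<le> iteration_bound ^ iteration_bound"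
proof -
  have "c ^ e \<le> iteration_bound ^ e" using assms(1) by (rule power_mono) simp
  also have "\<dots> \<le> iteration_bound ^ iteration_bound"
    using assms(2) thirteen_le_iteration_bound by (intro power_increasing) auto
  finally show ?thesis .
qed

lemma size_le_iteration_bound:
  "block_size \<le> iteration_bound" "inner_range \<le> iteration_bound" "outer_range \<le> iteration_bound"
  by (rule dvd_le_iteration_bound, simp add: iteration_bound_def size_defs mult_ac dvd_mult)+

lemma value_bound_le: "value_bound \<le> (iteration_bound ^ iteration_bound) ^ 7"
proof -
  let ?P = "iteration_bound ^ iteration_bound"
  have "outer_modulus ^ 1 * (inner_range ^ k * outer_range ^ k) * 2 ^ (l * k) * 2 ^ (2 * k * k) *
      block_size ^ (k * Suc k div 2) \<le> ?P * (?P * ?P) * ?P * ?P * ?P"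
    using iteration_bounds size_le_iteration_bound
    by (intro mult_le_mono power_le_iteration_bound_power) auto
  then have hashed: "hashed_guesses \<le> ?P ^ 6"
    by (simp add: hashed_guesses_def inner_modulus_def power_mult_distrib eval_nat_numeral
        mult.assoc)
  have "13 ^ 1 \<le> ?P" using iteration_bounds by (intro power_le_iteration_bound_power) auto
  then have P: "13 \<le> ?P" by simp
  have "?P ^ 1 \<le> ?P ^ 6" using P by (intro power_increasing) auto
  moreover have "iteration_bound ^ 1 \<le> ?P" "2 ^ l \<le> ?P" "n ^ (2 * k) \<le> ?P" "n ^ (k * k) \<le> ?P"
    using iteration_bounds by (auto intro!: power_le_iteration_bound_power)
  ultimately have "value_bound \<le> 5 * ?P ^ 6"
    using hashed unfolding value_bound_def by simp
  also have "\<dots> \<le> ?P * ?P ^ 6" using P by (intro mult_le_mono1) simp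
  finally show ?thesis by (simp add: eval_nat_numeral)
qed

lemma bitlen_value_bound: "bitlen value_bound \<le> 7 * iteration_bound * iteration_bound"
proof (rule bitlen_le)
  have pos: "0 < iteration_bound" using thirteen_le_iteration_bound by simp
  have "value_bound \<le> iteration_bound ^ (7 * iteration_bound)"
    using value_bound_le by (simp add: power_mult[symmetric] mult.commute)
  also have "\<dots> < (2 ^ iteration_bound) ^ (7 * iteration_bound)"
    using pos by (intro power_strict_mono) auto
  also have "\<dots> = 2 ^ (7 * iteration_bound * iteration_bound)"
    by (simp add: power_mult[symmetric] mult_ac)
  finally show "value_bound < 2 ^ (7 * iteration_bound * iteration_bound)" .
  show "0 < 7 * iteration_bound * iteration_bound" using pos by simp
qed

lemma program_time_le:
  "Suc num_guesses * cost iteration_bound P * bitlen value_bound \<le>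
    num_guesses * (14 * cost 0 P * 2 ^ size P * iteration_bound ^ (size P + 2))"
proof -
  have "Suc iteration_bound \<le> 2 * iteration_bound" using thirteen_le_iteration_bound by simp
  then have "cost 0 P * Suc iteration_bound ^ size P \<le> cost 0 P * (2 * iteration_bound) ^ size P"
    by (intro mult_le_mono2 power_mono) simp_all
  then have cost: "cost iteration_bound P \<le> cost 0 P * (2 * iteration_bound) ^ size P"
    by (rule order_trans[OF cost_le_polynomial])
  have "Suc num_guesses \<le> 2 * num_guesses" using num_guesses_pos by simp
  then have "Suc num_guesses * cost iteration_bound P * bitlen value_bound \<le>
      (2 * num_guesses) * (cost 0 P * (2 * iteration_bound) ^ size P) *
      (7 * iteration_bound * iteration_bound)"
    by (intro mult_le_mono cost bitlen_value_bound)
  also have "\<dots> = num_guesses * (14 * cost 0 P * 2 ^ size P * iteration_bound ^ (size P + 2))"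
    unfolding power_mult_distrib power_add power2_eq_square by simp
  finally show ?thesis .
qed

end

lemma real_fpt_bound_eq:
  fixes k d l n a b :: nat
  assumes "0 < k"
  shows "real (2 ^ (a * (k * k * d)) * (2 ^ (l * k) * k ^ (k * k)) * n ^ b) =
    2 powr (real a * ((real k)\<^sup>2 * real d)) *
      2 powr (real l * real k + (real k)\<^sup>2 * log 2 (real k)) * real n ^ b"
proof -
  have powr: "2 powr real m = 2 ^ m" "real k powr real m = real k ^ m" for m
    using assms by (simp_all add: powr_realpow)
  have "real (2 ^ (a * (k * k * d)) * (2 ^ (l * k) * k ^ (k * k)) * n ^ b) =
      2 powr real (a * (k * k * d)) * (2 powr real (l * k) * real k powr real (k * k)) * real n ^ b"
    unfolding powr by (simp only: of_nat_mult of_nat_power of_nat_numeral)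
  also have "real k powr real (k * k) = 2 powr ((real k)\<^sup>2 * log 2 (real k))"
    using assms by (simp add: powr_def log_def power2_eq_square)
  finally show ?thesis by (simp add: powr_add power2_eq_square)
qed

definition exponent_factor :: nat where
  "exponent_factor = 34 + 6 * (size spgc_prog + 2)"

definition poly_exponent :: nat where
  "poly_exponent = 3 * (size spgc_prog + 2) + 1 +
  (14 * cost 0 spgc_prog * 2 ^ size spgc_prog) * 13 ^ (size spgc_prog + 2) *
    poly_overhead (size spgc_prog + 2)"

context spgc_instance
begin

lemma spgc_prog_time_le:
  "Suc num_guesses * cost iteration_bound spgc_prog * bitlen value_bound \<le>
    2 ^ (exponent_factor * (k * k * d)) * main_factor * n ^ poly_exponent"
proof -
  have "Suc num_guesses * cost iteration_bound spgc_prog * bitlen value_bound \<le>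
      num_guesses *
        (14 * cost 0 spgc_prog * 2 ^ size spgc_prog * iteration_bound ^ (size spgc_prog + 2))"
    by (rule program_time_le)
  also have "\<dots> \<le> 2 ^ (exponent_factor * (k * k * d)) * main_factor * n ^ poly_exponent"
    unfolding exponent_factor_def poly_exponent_def
    by (rule num_guesses_mult_iteration_bound_le[unfolded kkd_def])
  finally show ?thesis .
qed

theorem spgc_prog_correct:
  "\<exists>t s. exec spgc_prog (initial (spgc_encode x)) t s \<and>
    real t \<le> 2 powr (real exponent_factor * ((real k)\<^sup>2 * real d)) *
      2 powr (real l * real k + (real k)\<^sup>2 * log 2 (real k)) * real n ^ poly_exponent \<and>
    (accepting s \<longleftrightarrow> spgc_yes x)"
proof -
  have "ensures value_bound (Suc num_guesses * cost iteration_bound spgc_prog) spgc_prog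
      (initial (spgc_encode x)) (\<lambda>s. accepting s \<longleftrightarrow> spgc_yes x)"
    by (rule achieves_spgc) (simp_all add: initial_def)
  then obtain t s where run: "exec spgc_prog (initial (spgc_encode x)) t s"
      "accepting s \<longleftrightarrow> spgc_yes x"
    and time: "t \<le> Suc num_guesses * cost iteration_bound spgc_prog * bitlen value_bound"
    using bounded_by_input by (rule ensuresE)
  have "real t \<le> real (2 ^ (exponent_factor * (k * k * d)) * main_factor *
      n ^ poly_exponent)"
    using order_trans[OF time spgc_prog_time_le] by (simp only: of_nat_le_iff)
  then show ?thesis unfolding real_fpt_bound_eq[OF k_pos] using run by blast
qed

end

theorem theorem20:
  shows "\<exists>(P :: com) (a :: nat) (b :: nat).
    decides_in_time P spgc_encode spgc_valid spgc_yes
      (\<lambda>x. let k = real (colors x); d = real (degeneracy x);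
               l = real (length (bicliques x)); n = real (num_vertices x)
           in 2 powr (real a * (k\<^sup>2 * d)) * 2 powr (l * k + k\<^sup>2 * log 2 k) * n ^ b)"
proof (rule exI[of _ spgc_prog], rule exI[of _ exponent_factor], rule exI[of _ poly_exponent],
    unfold decides_in_time_def Let_def, intro allI impI)
  fix x assume "spgc_valid x"
  then interpret spgc_instance x by unfold_locales
  show "\<exists>t s. exec spgc_prog (initial (spgc_encode x)) t s \<and>
      real t \<le> 2 powr (real exponent_factor * ((real k)\<^sup>2 * real d)) *
        2 powr (real l * real k + (real k)\<^sup>2 * log 2 (real k)) * real n ^ poly_exponent \<and>
      (accepting s \<longleftrightarrow> spgc_yes x)"
    by (rule spgc_prog_correct)
qed

end
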